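(* Let $P\in L_2[0,1]$ be a self-similar function with self-similarity parameters $N$, $\{a_k\}_{k=1}^N$, $\{d_k\}_{k=1}^N$, $\{\beta_k\}_{k=1}^N$, which is non-arithmetically self-similar and has positive spectral order $D$. Let $\rho\in\mathring{W}_2^{-1}[0,1]$ be the generalized derivative of $P$. Then: 1. there exist nonnegative numbers $s_+$ and $s_-$ such that, as $\lambda\to\pm\infty$, $$\operatorname{ind}T_\rho(\lambda)=|\lambda|^{D/2}\cdot(s_\pm+o(1));$$ 2. if $d_k<0$ for some $k\in\{1,\dots,N\}$, then $s_+=s_-$; 3. if $\langle\rho,|y|^2\rangle>0$ for some $y\in\mathring{W}_2^1[0,1]$, then $s_+>0$; similarly, if $\langle\rho,|y|^2\rangle<0$ for some $y\in\mathring{W}_2^1[0,1]$, then $s_->0$.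
   Context: Spaces: $\mathring{W}_2^1[0,1]$ is the Sobolev space of (complex-valued) functions $y\in W_2^1[0,1]$ with $y(0)=y(1)=0$, and $\mathring{W}_2^{-1}[0,1]$ is its dual. The generalized derivative $\rho\in\mathring{W}_2^{-1}[0,1]$ of $P\in L_2[0,1]$ is given by $\langle\rho,y\rangle=-\int_0^1P\,\overline{y'}\,dx$ for $y\in\mathring{W}_2^1[0,1]$. Self-similar functions: let $N>1$ be an integer, $a_k>0$ with $\sum_{k=1}^Na_k=1$, and $d_k,\beta_k\in\mathbb R$ ($k=1,\dots,N$) with $\sum_{k=1}^Na_kd_k^2<1$. Put $\alpha_1=0$ and $\alpha_{k+1}=\alpha_k+a_k$. A (real-valued) function $P\in L_2[0,1]$ is self-similar with these parameters if for every $k\in\{1,\dots,N\}$ and almost every $x\in(\alpha_k,\alpha_{k+1})$ $$P(x)=\beta_k+d_k\,P\left(\frac{x-\alpha_k}{a_k}\right)$$ (such $P$ exists and is unique for given parameters). The spectral order $D$ is the number determined by $\sum_{k:\,d_k\ne0}(a_k|d_k|)^{D/2}=1$; it is positive exactly when at least two of the $d_k$ are nonzero. $P$ is non-arithmetically self-similar if there is no $\nu>0$ such that all numbers $\ln(a_k|d_k|)$ with $d_k\neq0$ are integer multiples of $\nu$. Operator pencil: for $\lambda\in\mathbb R$ the operator $T_\rho(\lambda):\mathring{W}_2^1[0,1]\to\mathring{W}_2^{-1}[0,1]$ is defined by $$\langle T_\rho(\lambda)y,z\rangle=\int_0^1\left\{y'\overline{z'}+\lambda P\cdot(y'\overline z+y\overline{z'})\right\}dx,\qquad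 y,z\in\mathring{W}_2^1[0,1],$$ and corresponds to the boundary value problem $-y''-\lambda\rho y=0$, $y(0)=y(1)=0$. The number $\operatorname{ind}T_\rho(\lambda)$ is the negative index of inertia: the maximal dimension of a linear subspace of $\mathring{W}_2^1[0,1]$ on which the quadratic form $\langle T_\rho(\lambda)y,y\rangle$ is negative definite. *)

theory Defs
  imports
    "HOL-Analysis.Analysis"
    "HOL-Library.Function_Algebras"
    "HOL-Library.Landau_Symbols"
    "HOL-Library.Complex_Order"
begin

(* Function_Algebras provides the pointwise additive group structure on
   real => complex; the interpretation adds the complex scalars. *)
interpretation cfun: vector_space "\<lambda>(c::complex) (f::real \<Rightarrow> complex) x. c * f x"
  by unfold_locales (auto simp: fun_eq_iff algebra_simps)

definition L2_01 :: "(real \<Rightarrow> 'a::{banach, second_countable_topology}) \<Rightarrow> bool" where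
  "L2_01 f \<longleftrightarrow> set_borel_measurable lebesgue {0..1} f \<and>
     set_integrable lebesgue {0..1} (\<lambda>x. (norm (f x))\<^sup>2)"

(* y belongs to W_2^1[0,1] with derivative g: y is the absolutely continuous
   representative, i.e. the primitive of the L_2 function g, which is unique
   up to a null set. *)
definition has_sobolev_deriv :: "(real \<Rightarrow> complex) \<Rightarrow> (real \<Rightarrow> complex) \<Rightarrow> bool" where
  "has_sobolev_deriv y g \<longleftrightarrow> L2_01 g \<and>
     (\<forall>x\<in>{0..1}. y x = y 0 + (LINT t:{0..x}|lebesgue. g t))"

(* A choice of representative; it is only used under integrals over [0,1]. *)
definition sobolev_deriv :: "(real \<Rightarrow> complex) \<Rightarrow> real \<Rightarrow> complex" where
  "sobolev_deriv y = (SOME g. has_sobolev_deriv y g)"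

(* Functions on [0,1] are encoded as functions on the real line vanishing
   outside [0,1], so that equality and linear independence in real => complex
   are those of the Sobolev space. *)
definition W21_0 :: "(real \<Rightarrow> complex) set" where
  "W21_0 = {y. (\<exists>g. has_sobolev_deriv y g) \<and> y 0 = 0 \<and> y 1 = 0 \<and> (\<forall>x. x \<notin> {0..1} \<longrightarrow> y x = 0)}"

(* Elements of the dual space are given by their pairing y |-> <rho, y>, which is
   conjugate-linear in y; only the values at y in W21_0 are meaningful. *)
definition generalized_deriv :: "(real \<Rightarrow> real) \<Rightarrow> (real \<Rightarrow> complex) \<Rightarrow> complex" where
  "generalized_deriv P y = - (LINT x:{0..1}|lebesgue. of_real (P x) * cnj (sobolev_deriv y x))"

(* pencil P lam y z = <T(lam) y, z> *)
definition pencil ::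
  "(real \<Rightarrow> real) \<Rightarrow> real \<Rightarrow> (real \<Rightarrow> complex) \<Rightarrow> (real \<Rightarrow> complex) \<Rightarrow> complex" where
  "pencil P lam y z = (LINT x:{0..1}|lebesgue.
     sobolev_deriv y x * cnj (sobolev_deriv z x)
     + of_real (lam * P x) * (sobolev_deriv y x * cnj (z x) + y x * cnj (sobolev_deriv z x)))"

(* cfun.dim is 0 on infinite-dimensional subspaces, hence the case distinction. *)
definition cfun_edim :: "(real \<Rightarrow> complex) set \<Rightarrow> enat" where
  "cfun_edim S = (if \<exists>B. finite B \<and> S \<subseteq> cfun.span B then enat (cfun.dim S) else \<infinity>)"

(* The order on complex is that of Complex_Order: u < 0 means that u is real and negative. *)
definition negative_index ::
  "((real \<Rightarrow> complex) \<Rightarrow> (real \<Rightarrow> complex) \<Rightarrow> complex) \<Rightarrow> enat" where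
  "negative_index T = Sup {cfun_edim S | S.
     cfun.subspace S \<and> S \<subseteq> W21_0 \<and> (\<forall>y\<in>S. y \<noteq> 0 \<longrightarrow> T y y < 0)}"

definition selfsim_params :: "nat \<Rightarrow> (nat \<Rightarrow> real) \<Rightarrow> (nat \<Rightarrow> real) \<Rightarrow> bool" where
  "selfsim_params N a d \<longleftrightarrow> N > 1 \<and> (\<forall>k\<in>{1..N}. a k > 0) \<and>
     (\<Sum>k=1..N. a k) = 1 \<and> (\<Sum>k=1..N. a k * (d k)\<^sup>2) < 1"

definition breakpoint :: "(nat \<Rightarrow> real) \<Rightarrow> nat \<Rightarrow> real" where
  "breakpoint a k = (\<Sum>j\<in>{1..<k}. a j)"

definition self_similar ::
  "nat \<Rightarrow> (nat \<Rightarrow> real) \<Rightarrow> (nat \<Rightarrow> real) \<Rightarrow> (nat \<Rightarrow> real) \<Rightarrow> (real \<Rightarrow> real) \<Rightarrow> bool" where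
  "self_similar N a d \<beta> P \<longleftrightarrow> (\<forall>k\<in>{1..N}. AE x in lebesgue.
     x \<in> {breakpoint a k<..<breakpoint a (k + 1)} \<longrightarrow>
       P x = \<beta> k + d k * P ((x - breakpoint a k) / a k))"

definition is_spectral_order :: "nat \<Rightarrow> (nat \<Rightarrow> real) \<Rightarrow> (nat \<Rightarrow> real) \<Rightarrow> real \<Rightarrow> bool" where
  "is_spectral_order N a d D \<longleftrightarrow>
     (\<Sum>k\<in>{k\<in>{1..N}. d k \<noteq> 0}. (a k * \<bar>d k\<bar>) powr (D / 2)) = 1"

definition non_arithmetic :: "nat \<Rightarrow> (nat \<Rightarrow> real) \<Rightarrow> (nat \<Rightarrow> real) \<Rightarrow> bool" where
  "non_arithmetic N a d \<longleftrightarrow>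
     \<not> (\<exists>\<nu>>0. \<forall>k\<in>{1..N}. d k \<noteq> 0 \<longrightarrow> (\<exists>m::int. ln (a k * \<bar>d k\<bar>) = of_int m * \<nu>))"

end

theory Submission
  imports Defs
begin

text \<open>Functions vanishing at the breakpoints form a subspace of codimension \<open>N - 1\<close> on which the
  form of the pencil splits into rescaled copies of itself with parameters \<open>a k * d k * lam\<close>. Hence
  the index \<open>n\<close> satisfies
  \<open>(\<Sum>k. n (a k * d k * lam)) \<le> n lam \<le> (\<Sum>k. n (a k * d k * lam)) + N - 1\<close>.
  In the variable \<open>t = ln \<bar>lam\<bar>\<close>, with the two signs of \<open>lam\<close> kept as a type, these are renewal
  inequalities, and \<open>exp (- t * D / 2) * n\<close> is a supersolution of a renewal equation with total
  mass 1, while adding \<open>const * exp (- t * D / 2)\<close> makes it a subsolution. If the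
  subsolution is close to its upper limit \<open>M\<close> somewhere, then it is close to \<open>M\<close> at all points reached by
  going back along sums of the numbers \<open>- ln (a k * \<bar>d k\<bar>)\<close>; these become dense because the
  weight is not arithmetic, and both parities of sign changes occur if some \<open>d k\<close> is negative. As \<open>n\<close> is monotone in
  \<open>t\<close>, it is close to \<open>M\<close> on a whole window, and the supersolution property
  propagates this lower bound to all later times, so the limit exists.\<close>

subsection \<open>Renewal inequalities\<close>

text \<open>The constants \<beta>_k disappear from the rescaled forms because a constant weight only
  contributes the integral of the derivative of |y|^2, which vanishes under Dirichlet conditions.
  \<open>P\<close> is merely square integrable, and the index is not read off from a spectrum. It is
  squeezed between two finite certificates: vectors spanning a negative definite subspace, and
  functionals whose common kernel contains no negative vector. Both kinds can be glued along the
  cells, which yields the two inequalities; finiteness comes from iterating the splitting until all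
  parameters are so small that the form is nonnegative. The renewal theorem treats equations,
  whereas only inequalities with a bounded defect are available here. Monotonicity in
  \<open>t\<close> supplies the missing regularity: it turns closeness at sufficiently dense points
  into closeness on an interval. A \<open>walk\<close> records a total delay together with the
  parity of the sign changes met on the way.\<close>

inductive walk :: "'k set \<Rightarrow> ('k \<Rightarrow> real) \<Rightarrow> ('k \<Rightarrow> bool) \<Rightarrow> bool \<Rightarrow> real \<Rightarrow> bool"
  for K \<tau> flip where
  start: "walk K \<tau> flip False 0"
| step: "walk K \<tau> flip f x \<Longrightarrow> k \<in> K \<Longrightarrow> walk K \<tau> flip (f \<noteq> flip k) (x + \<tau> k)"

section \<open>Sums of delays with parity, and their eventual density\<close>

lemma walk_add:
  assumes "walk K \<tau> flip f x" "walk K \<tau> flip g y"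
  shows "walk K \<tau> flip (f \<noteq> g) (x + y)"
  using assms(2)
proof induction
  case start
  then show ?case using assms(1) by simp
next
  case (step g y k)
  from walk.step[OF step.IH step.hyps(2)]
  have "walk K \<tau> flip ((f \<noteq> g) \<noteq> flip k) (x + y + \<tau> k)" .
  moreover have "((f \<noteq> g) \<noteq> flip k) = (f \<noteq> (g \<noteq> flip k))" by auto
  ultimately show ?case by (simp add: add.assoc)
qed

lemma walk_even_multiple:
  assumes "walk K \<tau> flip False x"
  shows "walk K \<tau> flip False (real n * x)"
proof (induction n)
  case 0
  then show ?case by (simp add: walk.start)
next
  case (Suc n)
  from walk_add[OF Suc assms] show ?case by (simp add: algebra_simps)
qed

text \<open>Two steps along the same \<open>k\<close> cancel their flips, so doubled delays have
  even parity whatever \<open>flip\<close> is.\<close>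

lemma walk_even_sum:
  assumes "finite J" "J \<subseteq> K"
  shows "walk K \<tau> flip False (\<Sum>k\<in>J. real (n k) * (2 * \<tau> k))"
  using assms
proof (induction J)
  case empty
  then show ?case by (simp add: walk.start)
next
  case (insert k J)
  have k: "walk K \<tau> flip (flip k) (\<tau> k)"
    using walk.step[OF walk.start, of k K \<tau> flip] insert.prems by simp
  have "walk K \<tau> flip False (2 * \<tau> k)"
    using walk_add[OF k k] by simp
  then have "walk K \<tau> flip False (real (n k) * (2 * \<tau> k))"
    by (rule walk_even_multiple)
  then show ?case
    using walk_add[of K \<tau> flip False "real (n k) * (2 * \<tau> k)" False] insert by simp
qed

text \<open>A subgroup of the reals without arbitrarily small positive elements is cyclic. If the
  positive values keep a distance \<delta> from 0, the least of them is a common unit for all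
  \<open>\<tau> k\<close>, against \<open>nonarith\<close>.\<close>

lemma integer_span_dense:
  fixes \<tau> :: "'k \<Rightarrow> real"
  assumes nonarith: "\<not> (\<exists>\<nu>>0. \<forall>k\<in>K. \<exists>m::int. \<tau> k = of_int m * \<nu>)"
    and fin: "finite K" and "\<delta> > 0"
  shows "\<exists>n :: 'k \<Rightarrow> int. 0 < (\<Sum>k\<in>K. of_int (n k) * \<tau> k) \<and> (\<Sum>k\<in>K. of_int (n k) * \<tau> k) < \<delta>"
proof (rule ccontr)
  define G where "G n = (\<Sum>k\<in>K. of_int (n k) * \<tau> k)" for n :: "'k \<Rightarrow> int"
  assume "\<not> ?thesis"
  then have gap: "\<And>n. G n > 0 \<Longrightarrow> G n \<ge> \<delta>" unfolding G_def by force
  have diff: "G n - of_int j * G m = G (\<lambda>k. n k - j * m k)" for n m and j :: int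
    unfolding G_def by (simp add: sum_subtractf sum_distrib_left left_diff_distrib mult.assoc)
  have unit: "G (\<lambda>i. if i = k then 1 else 0) = \<tau> k" if "k \<in> K" for k
  proof -
    have "G (\<lambda>i. if i = k then 1 else 0) = (\<Sum>i\<in>K. if i = k then \<tau> k else 0)"
      unfolding G_def by (rule sum.cong) auto
    then show ?thesis using fin that by simp
  qed
  have "\<exists>n. G n > 0"
  proof -
    have "\<exists>k\<in>K. \<tau> k \<noteq> 0"
    proof (rule ccontr)
      assume "\<not> ?thesis"
      then have "\<forall>k\<in>K. \<exists>m::int. \<tau> k = of_int m * 1" by (auto intro: exI[of _ 0])
      with nonarith show False by (metis zero_less_one)
    qed
    then obtain k where k: "k \<in> K" "\<tau> k \<noteq> 0" by blast
    let ?u = "\<lambda>i. if i = k then 1 else 0"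
    have "G ?u > 0 \<or> G (\<lambda>i. 0 - 1 * ?u i) > 0"
      using unit[OF k(1)] k(2) diff[of "\<lambda>_. 0" 1 ?u] by (auto simp: G_def)
    then show ?thesis by blast
  qed
  define A where "A = {x. \<exists>n. x = G n \<and> x > 0}"
  have A: "A \<noteq> {}" "bdd_below A"
    using \<open>\<exists>n. G n > 0\<close> unfolding A_def by (auto intro!: bdd_belowI[of _ 0])
  have "Inf A < Inf A + \<delta>" using \<open>\<delta> > 0\<close> by simp
  then obtain x where "x \<in> A" "x < Inf A + \<delta>"
    using cInf_less_iff[OF A] by blast
  then obtain m where m: "x = G m" "G m > 0" "G m < Inf A + \<delta>" unfolding A_def by blast
  \<comment> \<open>A smaller positive value would differ from \<open>G m\<close> by at least
    \<delta>, yet both lie in an interval of length less than \<delta> above the infimum.\<close>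
  have least: "G n \<ge> G m" if "G n > 0" for n
  proof (rule ccontr)
    assume "\<not> G n \<ge> G m"
    then have "G (\<lambda>k. m k - 1 * n k) > 0" using diff[of m 1 n] by simp
    then have "G m - G n \<ge> \<delta>" using gap[of "\<lambda>k. m k - 1 * n k"] diff[of m 1 n] by simp
    moreover have "Inf A \<le> G n" by (rule cInf_lower) (use A that in \<open>auto simp: A_def\<close>)
    ultimately show False using m by linarith
  qed
  have "\<exists>j::int. \<tau> k = of_int j * G m" if "k \<in> K" for k
  proof -
    let ?u = "\<lambda>i. if i = k then 1 else 0"
    \<comment> \<open>Division with remainder: the remainder belongs to the subgroup, is nonnegative
      and lies below the least positive value, so it is 0.\<close>
    define j where "j = \<lfloor>\<tau> k / G m\<rfloor>"
    have "of_int j \<le> \<tau> k / G m" "\<tau> k / G m < of_int j + 1" unfolding j_def by linarith+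
    then have "of_int j * G m \<le> \<tau> k" "\<tau> k < of_int j * G m + G m"
      using m(2) by (simp_all add: field_simps)
    moreover have "G (\<lambda>i. ?u i - j * m i) = \<tau> k - of_int j * G m"
      using diff[of ?u j m] unit[OF that] by simp
    ultimately have "\<tau> k = of_int j * G m"
      using least[of "\<lambda>i. ?u i - j * m i"] by (cases "G (\<lambda>i. ?u i - j * m i) > 0") auto
    then show ?thesis ..
  qed
  then show False using nonarith m(2) by blast
qed

text \<open>Walks admit only nonnegative coefficients. The small integer combination is therefore
  written as a difference \<open>u - v\<close> of two walks; trading copies of \<open>v\<close> for
  copies of \<open>u\<close> moves a long walk forward in steps below \<delta>. One step along
  \<open>k0\<close> adjusts the parity.\<close>

lemma walk_eventually_dense:
  assumes nonarith: "\<not> (\<exists>\<nu>>0. \<forall>k\<in>K. \<exists>m::int. \<tau> k = of_int m * \<nu>)"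
    and fin: "finite K" and pos: "\<And>k. k \<in> K \<Longrightarrow> \<tau> k > 0"
    and flip: "k0 \<in> K" "flip k0" and "\<delta> > 0"
  shows "\<exists>R\<ge>0. \<forall>y\<ge>R. \<forall>f. \<exists>x. walk K \<tau> flip f x \<and> y \<le> x \<and> x \<le> y + \<delta>"
proof -
  \<comment> \<open>Half of \<delta>, because the coefficients are doubled below to keep the parity
    even.\<close>
  obtain n :: "'a \<Rightarrow> int" where n: "0 < (\<Sum>k\<in>K. of_int (n k) * \<tau> k)"
      "(\<Sum>k\<in>K. of_int (n k) * \<tau> k) < \<delta> / 2"
    using integer_span_dense[OF nonarith fin, of "\<delta> / 2"] \<open>\<delta> > 0\<close> by auto
  define u where "u = (\<Sum>k\<in>K. real (nat (n k)) * (2 * \<tau> k))"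
  define v where "v = (\<Sum>k\<in>K. real (nat (- n k)) * (2 * \<tau> k))"
  have uv: "walk K \<tau> flip False u" "walk K \<tau> flip False v"
    unfolding u_def v_def using walk_even_sum[OF fin] by auto
  have "u - v = (\<Sum>k\<in>K. 2 * (of_int (n k) * \<tau> k))"
    unfolding u_def v_def sum_subtractf[symmetric]
  proof (rule sum.cong)
    fix k
    show "real (nat (n k)) * (2 * \<tau> k) - real (nat (- n k)) * (2 * \<tau> k) = 2 * (of_int (n k) * \<tau> k)"
      by (cases "n k \<ge> 0") simp_all
  qed simp
  also have "\<dots> = 2 * (\<Sum>k\<in>K. of_int (n k) * \<tau> k)" by (simp add: sum_distrib_left)
  finally have g: "0 < u - v" "u - v < \<delta>" using n by auto
  have v0: "v \<ge> 0" unfolding v_def by (intro sum_nonneg mult_nonneg_nonneg) (use pos in \<open>auto intro: less_imp_le\<close>)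
  have even: "\<exists>J. \<forall>y\<ge>J * v. \<exists>x. walk K \<tau> flip False x \<and> y \<le> x \<and> x \<le> y + \<delta>"
  \<comment> \<open>Without a negative part there is nothing to trade, but then \<open>u\<close>
    itself is shorter than \<delta>.\<close>
  proof (cases "v = 0")
    case True
    have "\<exists>x. walk K \<tau> flip False x \<and> y \<le> x \<and> x \<le> y + \<delta>" if "y \<ge> 0" for y
    proof -
      define j where "j = nat \<lceil>y / u\<rceil>"
      have "y / u \<le> real j" "real j < y / u + 1"
        unfolding j_def using that g True by (auto simp: of_nat_nat ceiling_correct) linarith+
      then have "y \<le> real j * u" "real j * u \<le> y + u" using g True by (auto simp: field_simps)
      then show ?thesis using walk_even_multiple[OF uv(1), of j] g True by (intro exI[of _ "real j * u"]) auto
    qed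
    then show ?thesis using True by auto
  next
    case False
    then have "v > 0" using v0 by simp
    \<comment> \<open>\<open>J\<close> trades bridge the gap between consecutive multiples of
      \<open>v\<close>, and from \<open>J * v\<close> on there are at least \<open>J\<close> copies
      of \<open>v\<close> to trade away.\<close>
    define J where "J = nat \<lceil>v / (u - v)\<rceil>"
    have J: "v / (u - v) \<le> real J" unfolding J_def using g v0 by (simp add: of_nat_nat)
    then have Jg: "v \<le> real J * (u - v)" using g by (simp add: field_simps)
    have "\<exists>x. walk K \<tau> flip False x \<and> y \<le> x \<and> x \<le> y + \<delta>" if "y \<ge> real J * v" for y
    proof -
      define L where "L = nat \<lfloor>y / v\<rfloor>"
      have "y / v \<ge> real J" using that \<open>v > 0\<close> by (simp add: field_simps)
      then have L: "J \<le> L" "real L \<le> y / v" "y / v < real L + 1"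
        unfolding L_def by (auto simp: le_nat_floor of_nat_nat)
      then have L': "real L * v \<le> y" "y < real L * v + v" using \<open>v > 0\<close> by (auto simp: field_simps)
      define j where "j = nat \<lceil>(y - real L * v) / (u - v)\<rceil>"
      have "(y - real L * v) / (u - v) \<ge> 0" using L' g by simp
      then have j: "(y - real L * v) / (u - v) \<le> real j" "real j < (y - real L * v) / (u - v) + 1"
        unfolding j_def by (auto simp: of_nat_nat) linarith+
      have "(y - real L * v) / (u - v) \<le> v / (u - v)"
        using L' g by (intro divide_right_mono) auto
      then have "(y - real L * v) / (u - v) \<le> real J" using J by linarith
      then have "j \<le> J" unfolding j_def by (simp add: ceiling_le_iff nat_le_iff)
      then have "j \<le> L" using L by simp
      have "real j * u + real (L - j) * v = real L * v + real j * (u - v)"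
        using \<open>j \<le> L\<close> by (simp add: of_nat_diff algebra_simps)
      moreover have "y - real L * v \<le> real j * (u - v)" "real j * (u - v) \<le> y - real L * v + (u - v)"
        using j g by (auto simp: field_simps)
      moreover have "walk K \<tau> flip False (real j * u + real (L - j) * v)"
        using walk_add[OF walk_even_multiple[OF uv(1), of j] walk_even_multiple[OF uv(2), of "L - j"]] by simp
      ultimately show ?thesis using g by (intro exI[of _ "real j * u + real (L - j) * v"]) auto
    qed
    then show ?thesis by blast
  qed
  then obtain J where J: "\<And>y. y \<ge> J * v \<Longrightarrow> \<exists>x. walk K \<tau> flip False x \<and> y \<le> x \<and> x \<le> y + \<delta>" by blast
  have k0: "walk K \<tau> flip True (\<tau> k0)"
    using walk.step[OF walk.start, of k0 K \<tau> flip] flip by simp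
  have "\<exists>x. walk K \<tau> flip f x \<and> y \<le> x \<and> x \<le> y + \<delta>" if y: "y \<ge> max 0 (J * v) + \<tau> k0" for y f
  proof (cases f)
    case False
    then show ?thesis using J[of y] y pos[OF flip(1)] by auto
  next
    case True
    obtain x where "walk K \<tau> flip False x" "y - \<tau> k0 \<le> x" "x \<le> y - \<tau> k0 + \<delta>"
      using J[of "y - \<tau> k0"] y max.cobounded2[of "J * v" 0] by force
    then show ?thesis using walk_add[OF _ k0, of False x] True by (intro exI[of _ "x + \<tau> k0"]) auto
  qed
  then show ?thesis using pos[OF flip(1)] by (intro exI[of _ "max 0 (J * v) + \<tau> k0"]) auto
qed

section \<open>Comparison principles for renewal inequalities\<close>

text \<open>Beyond the window, the value at \<open>s\<close> dominates a convex average of values at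
  least \<mu> and at most \<sigma> earlier, so the average never looks back past the window and the
  covered range grows by \<mu> each time. It serves for lower bounds of supersolutions and, after a
  change of sign, for upper bounds of subsolutions.\<close>

lemma renewal_window_propagate:
  fixes G :: "bool \<Rightarrow> real \<Rightarrow> real"
  assumes fin: "finite K" and pos: "\<And>k. k \<in> K \<Longrightarrow> \<tau> k > 0" and le: "\<And>k. k \<in> K \<Longrightarrow> \<tau> k \<le> \<sigma>"
    and p: "\<And>k. k \<in> K \<Longrightarrow> p k \<ge> 0" "(\<Sum>k\<in>K. p k) = 1"
    and super: "\<And>b t. (\<Sum>k\<in>K. p k * G (b \<noteq> flip k) (t - \<tau> k)) \<le> G b t"
    and window: "\<And>b s. T - \<sigma> \<le> s \<Longrightarrow> s \<le> T \<Longrightarrow> x \<le> G b s"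
    and s: "T - \<sigma> \<le> s"
  shows "x \<le> G b s"
proof -
  have "K \<noteq> {}" using p(2) by auto
  define \<mu> where "\<mu> = Min (\<tau> ` K)"
  have \<mu>: "\<mu> > 0" "\<And>k. k \<in> K \<Longrightarrow> \<mu> \<le> \<tau> k"
    unfolding \<mu>_def using fin \<open>K \<noteq> {}\<close> pos by auto
  have ind: "\<forall>b s. T - \<sigma> \<le> s \<longrightarrow> s \<le> T + real n * \<mu> \<longrightarrow> x \<le> G b s" for n
  proof (induction n)
    case 0
    then show ?case using window by simp
  next
    case (Suc n)
    show ?case
    proof (intro allI impI)
      fix b s assume s: "T - \<sigma> \<le> s" "s \<le> T + real (Suc n) * \<mu>"
      show "x \<le> G b s"
      proof (cases "s \<le> T")
        case True
        then show ?thesis using window s by simp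
      next
        case False
        have "x = (\<Sum>k\<in>K. p k * x)" using p(2) by (simp flip: sum_distrib_right)
        also have "\<dots> \<le> (\<Sum>k\<in>K. p k * G (b \<noteq> flip k) (s - \<tau> k))"
        proof (intro sum_mono mult_left_mono)
          fix k assume k: "k \<in> K"
          have "T - \<sigma> \<le> s - \<tau> k" using False le[OF k] by simp
          moreover have "s - \<tau> k \<le> T + real n * \<mu>" using s \<mu>(2)[OF k] by (simp add: algebra_simps)
          ultimately show "x \<le> G (b \<noteq> flip k) (s - \<tau> k)" using Suc by blast
        qed (use p in auto)
        also have "\<dots> \<le> G b s" by (rule super)
        finally show ?thesis .
      qed
    qed
  qed
  obtain n where "(s - T) / \<mu> \<le> real n" using real_arch_simple by blast
  then have "s \<le> T + real n * \<mu>" using \<mu> by (simp add: field_simps)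
  then show ?thesis using ind[of n] s by blast
qed

text \<open>Along a walk, the deficit below an upper bound grows at most by the inverse weight
  \<open>exp (\<theta> * x)\<close> of the walk.\<close>

lemma renewal_deficit_along_walk:
  fixes W :: "bool \<Rightarrow> real \<Rightarrow> real"
  assumes fin: "finite K" and pos: "\<And>k. k \<in> K \<Longrightarrow> \<tau> k > 0" and le: "\<And>k. k \<in> K \<Longrightarrow> \<tau> k \<le> \<sigma>"
    and p: "(\<Sum>k\<in>K. exp (- \<theta> * \<tau> k)) = 1"
    and sub: "\<And>b t. W b t \<le> (\<Sum>k\<in>K. exp (- \<theta> * \<tau> k) * W (b \<noteq> flip k) (t - \<tau> k))"
    and ub: "\<And>b s. T \<le> s \<Longrightarrow> W b s \<le> x"
    and walk: "walk K \<tau> flip f y" and "T + \<sigma> \<le> t - y"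
  shows "x - W (b \<noteq> f) (t - y) \<le> exp (\<theta> * y) * (x - W b t)"
  using walk \<open>T + \<sigma> \<le> t - y\<close>
proof induction
  case start
  then show ?case by simp
next
  case (step f y k)
  have T: "T + \<sigma> \<le> t - y" using step.prems pos[OF step.hyps(2)] by simp
  note IH = step.IH[OF T]
  let ?b = "b \<noteq> f" and ?s = "t - y"
  \<comment> \<open>The weighted deficits of all predecessors add up to at most the present deficit.
    All are nonnegative, as the predecessors still lie beyond \<open>T\<close>, so a single one can
    be isolated at the price of dividing by its weight.\<close>
  have "exp (- \<theta> * \<tau> k) * (x - W (?b \<noteq> flip k) (?s - \<tau> k)) \<le>
      (\<Sum>j\<in>K. exp (- \<theta> * \<tau> j) * (x - W (?b \<noteq> flip j) (?s - \<tau> j)))"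
  proof (rule member_le_sum[OF step.hyps(2) _ fin])
    fix j assume "j \<in> K - {k}"
    then have "T \<le> ?s - \<tau> j" using le[of j] T by simp
    then show "0 \<le> exp (- \<theta> * \<tau> j) * (x - W (?b \<noteq> flip j) (?s - \<tau> j))"
      using ub by simp
  qed
  also have "\<dots> = x * (\<Sum>j\<in>K. exp (- \<theta> * \<tau> j)) -
      (\<Sum>j\<in>K. exp (- \<theta> * \<tau> j) * W (?b \<noteq> flip j) (?s - \<tau> j))"
    by (simp add: right_diff_distrib sum_subtractf sum_distrib_left mult.commute)
  also have "\<dots> \<le> x - W ?b ?s" using sub[of ?b ?s] p by simp
  also have "\<dots> \<le> exp (\<theta> * y) * (x - W b t)" by (rule IH)
  finally have "exp (\<theta> * \<tau> k) * (exp (- \<theta> * \<tau> k) * (x - W (?b \<noteq> flip k) (?s - \<tau> k)))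
      \<le> exp (\<theta> * \<tau> k) * (exp (\<theta> * y) * (x - W b t))"
    by (rule mult_left_mono) simp
  moreover have "exp (\<theta> * \<tau> k) * exp (- (\<theta> * \<tau> k)) = 1"
    by (simp add: exp_minus)
  moreover have "exp (\<theta> * \<tau> k) * exp (\<theta> * y) = exp (\<theta> * (y + \<tau> k))"
    by (simp add: exp_add ring_distribs mult_ac)
  moreover have "(?b \<noteq> flip k) = (b \<noteq> (f \<noteq> flip k))" by auto
  ultimately show ?case by (simp add: diff_diff_eq flip: mult.assoc)
qed

lemma renewal_limit:
  fixes F :: "bool \<Rightarrow> real \<Rightarrow> real"
  assumes nonarith: "\<not> (\<exists>\<nu>>0. \<forall>k\<in>K. \<exists>m::int. \<tau> k = of_int m * \<nu>)"
    and fin: "finite K" and pos: "\<And>k. k \<in> K \<Longrightarrow> \<tau> k > 0" and \<theta>: "\<theta> > 0"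
    and p: "(\<Sum>k\<in>K. exp (- \<theta> * \<tau> k)) = 1"
    and flip: "k0 \<in> K" "flip k0"
    and mono: "\<And>b. mono (F b)" and nonneg: "\<And>b t. F b t \<ge> 0"
    and super: "\<And>b t. (\<Sum>k\<in>K. F (b \<noteq> flip k) (t - \<tau> k)) \<le> F b t"
    and sub: "\<And>b t. F b t \<le> (\<Sum>k\<in>K. F (b \<noteq> flip k) (t - \<tau> k)) + C"
  shows "\<exists>s\<ge>0. (\<forall>b. ((\<lambda>t. exp (- \<theta> * t) * F b t) \<longlongrightarrow> s) at_top) \<and> ((\<exists>b t. F b t > 0) \<longrightarrow> s > 0)"
proof -
  define \<sigma> where "\<sigma> = Max (\<tau> ` K)"
  have le: "\<And>k. k \<in> K \<Longrightarrow> \<tau> k \<le> \<sigma>" unfolding \<sigma>_def using fin by simp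
  have "\<sigma> > 0" using le[OF flip(1)] pos[OF flip(1)] by simp
  \<comment> \<open>A single delay would have to carry weight 1, which is impossible for a positive
    delay. This keeps the denominator of \<open>c\<close> positive.\<close>
  have "card K > 1"
  proof (rule ccontr)
    assume "\<not> card K > 1"
    then have "card K = 1" using flip fin card_gt_0_iff[of K] by fastforce
    then have "K = {k0}" using flip by (auto simp: card_1_singleton_iff)
    then have "exp (- \<theta> * \<tau> k0) = 1" using p by simp
    then show False using \<theta> pos[OF flip(1)] by simp
  qed
  have "C \<ge> 0" using super[of undefined 0] sub[of undefined 0] by linarith
  \<comment> \<open>Chosen so that \<open>c + C = card K * c\<close>: shifting \<open>F\<close> by
    \<open>c\<close> absorbs the additive error, and the shift dies out after multiplication by
    \<open>exp (- \<theta> * t)\<close>.\<close>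
  define c where "c = C / (real (card K) - 1)"
  have c: "c \<ge> 0" "c + C = real (card K) * c"
    unfolding c_def using \<open>C \<ge> 0\<close> \<open>card K > 1\<close> by (auto simp: field_simps)
  define Z where "Z b t = exp (- \<theta> * t) * F b t" for b t
  define W where "W b t = exp (- \<theta> * t) * (F b t + c)" for b t
  have exp_split: "exp (- (\<theta> * \<tau> k)) * exp (- (\<theta> * (t - \<tau> k))) = exp (- (\<theta> * t))" for t k
    by (simp flip: exp_add add: right_diff_distrib)
  have Zsuper: "(\<Sum>k\<in>K. exp (- \<theta> * \<tau> k) * Z (b \<noteq> flip k) (t - \<tau> k)) \<le> Z b t" for b t
  proof -
    have "(\<Sum>k\<in>K. exp (- \<theta> * \<tau> k) * Z (b \<noteq> flip k) (t - \<tau> k)) =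
        (\<Sum>k\<in>K. exp (- \<theta> * t) * F (b \<noteq> flip k) (t - \<tau> k))"
      unfolding Z_def by (rule sum.cong) (simp_all add: exp_split flip: mult.assoc)
    also have "\<dots> = exp (- \<theta> * t) * (\<Sum>k\<in>K. F (b \<noteq> flip k) (t - \<tau> k))"
      by (simp add: sum_distrib_left)
    also have "\<dots> \<le> Z b t" unfolding Z_def by (intro mult_left_mono super) simp
    finally show ?thesis .
  qed
  have Wsub: "W b t \<le> (\<Sum>k\<in>K. exp (- \<theta> * \<tau> k) * W (b \<noteq> flip k) (t - \<tau> k))" for b t
  proof -
    have "W b t \<le> exp (- \<theta> * t) * ((\<Sum>k\<in>K. F (b \<noteq> flip k) (t - \<tau> k)) + C + c)"
      unfolding W_def using sub[of b t] by (intro mult_left_mono) auto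
    also have "\<dots> = exp (- \<theta> * t) * (\<Sum>k\<in>K. F (b \<noteq> flip k) (t - \<tau> k) + c)"
      using c by (simp add: sum.distrib add.assoc add.commute[of C])
    also have "\<dots> = (\<Sum>k\<in>K. exp (- \<theta> * t) * (F (b \<noteq> flip k) (t - \<tau> k) + c))"
      by (rule sum_distrib_left)
    also have "\<dots> = (\<Sum>k\<in>K. exp (- \<theta> * \<tau> k) * W (b \<noteq> flip k) (t - \<tau> k))"
      unfolding W_def by (rule sum.cong) (simp_all add: exp_split flip: mult.assoc)
    finally show ?thesis .
  qed
  have ZW: "Z b t \<le> W b t" for b t unfolding Z_def W_def using c by simp
  have Z0: "Z b t \<ge> 0" for b t unfolding Z_def using nonneg by simp
  note Zprop = renewal_window_propagate[OF fin pos le _ p Zsuper]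
  \<comment> \<open>Eventual upper bounds common to both components, so that the infimum
    \<open>M\<close> is the upper limit of the larger of the two.\<close>
  define U where "U = {x. \<exists>T. \<forall>b. \<forall>s\<ge>T. W b s \<le> x}"
  have "bdd_below U"
  proof (rule bdd_belowI)
    fix x assume "x \<in> U"
    then obtain T where "\<forall>b. \<forall>s\<ge>T. W b s \<le> x" unfolding U_def by blast
    then have "W undefined T \<le> x" by simp
    then show "0 \<le> x" using Z0[of undefined T] ZW[of undefined T] by linarith
  qed
  \<comment> \<open>Boundedness of \<open>W\<close>: its negative is a supersolution, which
    monotonicity of \<open>F\<close> bounds from below on the window from \<open>- \<sigma>\<close>
    to 0.\<close>
  have "U \<noteq> {}"
  proof -
    let ?x = "exp (\<theta> * \<sigma>) * (F True 0 + F False 0 + c)"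
    have "- ?x \<le> - W b s" if "0 - \<sigma> \<le> s" for b s
    proof (rule renewal_window_propagate[OF fin pos le _ p, where T = 0 and G = "\<lambda>b s. - W b s"])
      fix b s assume s: "0 - \<sigma> \<le> s" "s \<le> (0::real)"
      have "F b s \<le> F b 0" using monoD[OF mono s(2)] .
      also have "\<dots> \<le> F True 0 + F False 0" using nonneg[of True 0] nonneg[of False 0] by (cases b) auto
      finally have "W b s \<le> exp (- \<theta> * s) * (F True 0 + F False 0 + c)"
        unfolding W_def by (intro mult_left_mono) auto
      also have "\<dots> \<le> ?x"
      proof (rule mult_right_mono)
        have "\<theta> * (- s) \<le> \<theta> * \<sigma>" using s \<theta> by (intro mult_left_mono) auto
        then show "exp (- \<theta> * s) \<le> exp (\<theta> * \<sigma>)" by simp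
      qed (use nonneg c in auto)
      finally show "- ?x \<le> - W b s" by simp
    next
      fix b t
      show "(\<Sum>k\<in>K. exp (- \<theta> * \<tau> k) * - W (b \<noteq> flip k) (t - \<tau> k)) \<le> - W b t"
        using Wsub[of b t] by (simp add: sum_negf)
    qed (use that in auto)
    then have "?x \<in> U" unfolding U_def by (intro CollectI exI[of _ "- \<sigma>"]) auto
    then show ?thesis by blast
  qed
  define M where "M = Inf U"
  have upper: "\<exists>T. \<forall>b. \<forall>s\<ge>T. W b s \<le> M + \<epsilon>" if \<epsilon>: "\<epsilon> > 0" for \<epsilon>
  proof -
    obtain x where "x \<in> U" "x < M + \<epsilon>"
      using cInf_less_iff[OF \<open>U \<noteq> {}\<close> \<open>bdd_below U\<close>, of "M + \<epsilon>"] \<epsilon> unfolding M_def by auto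
    from \<open>x \<in> U\<close> obtain T where "\<forall>b. \<forall>s\<ge>T. W b s \<le> x" unfolding U_def by blast
    with \<open>x < M + \<epsilon>\<close> show ?thesis by (meson less_imp_le order_trans)
  qed
  have near: "\<exists>b. \<exists>t\<ge>T. W b t > M - \<epsilon>" if "\<epsilon> > 0" for \<epsilon> T
  proof (rule ccontr)
    assume "\<not> ?thesis"
    then have "M - \<epsilon> \<in> U" unfolding U_def by (auto simp: not_less intro!: exI[of _ T])
    then have "M \<le> M - \<epsilon>" unfolding M_def by (rule cInf_lower[OF _ \<open>bdd_below U\<close>])
    then show False using that by simp
  qed
  have "M \<ge> 0"
  proof (rule ccontr)
    assume "\<not> ?thesis"
    then obtain T where "\<forall>b. \<forall>s\<ge>T. W b s \<le> M / 2" using upper[of "- M / 2"] by auto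
    then have "W undefined T \<le> M / 2" by simp
    then show False using Z0[of undefined T] ZW[of undefined T] \<open>\<not> M \<ge> 0\<close> by linarith
  qed
  have lower: "\<exists>T. \<forall>b. \<forall>s\<ge>T. M - \<eta> \<le> Z b s" if "\<eta> > 0" for \<eta>
  proof -
    \<comment> \<open>Walks hit a prescribed point only up to \<delta>; with this \<delta> the
      resulting factor \<open>exp (- \<theta> * \<delta>)\<close> costs less than half of
      \<eta>.\<close>
    have "((\<lambda>\<delta>. exp (- \<theta> * \<delta>) * M) \<longlongrightarrow> exp (- \<theta> * 0) * M) (at_right 0)"
      by (intro tendsto_intros)
    then have "\<forall>\<^sub>F \<delta> in at_right 0. exp (- \<theta> * \<delta>) * M > M - \<eta> / 2"
      by (rule order_tendstoD) (use that in auto)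
    then obtain \<delta> where \<delta>: "\<delta> > 0" "exp (- \<theta> * \<delta>) * M > M - \<eta> / 2"
      using eventually_happens[of _ "at_right (0::real)"]
      by (metis (mono_tags, lifting) eventually_at_right_less eventually_conj trivial_limit_at_right_real)
    obtain R where R: "R \<ge> 0" "\<And>y f. y \<ge> R \<Longrightarrow> \<exists>x. walk K \<tau> flip f x \<and> y \<le> x \<and> x \<le> y + \<delta>"
      using walk_eventually_dense[where flip = flip, OF nonarith fin pos flip \<delta>(1)] by metis
    \<comment> \<open>Bounds the length of the walks that lead from \<open>t\<close> back into the
      window of length \<sigma> ending at \<open>t - R\<close>.\<close>
    define X where "X = R + \<sigma> + \<delta>"
    \<comment> \<open>Covers the deficit \<open>2 * \<epsilon>\<close> at \<open>t\<close>,
      magnified by at most \<open>exp (\<theta> * X)\<close>, and a further \<epsilon> for passing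
      from \<open>W\<close> to \<open>Z\<close>; together they use up the other half of
      \<eta>.\<close>
    define \<epsilon> where "\<epsilon> = \<eta> / (4 * exp (\<theta> * X) + 2)"
    have "\<epsilon> > 0" unfolding \<epsilon>_def using that by (simp add: add_pos_pos)
    have eps: "2 * \<epsilon> * exp (\<theta> * X) + \<epsilon> = \<eta> / 2"
      unfolding \<epsilon>_def by (simp add: field_simps add_pos_pos add_nonneg_eq_0_iff)
    obtain T1 where T1: "\<And>b s. s \<ge> T1 \<Longrightarrow> W b s \<le> M + \<epsilon>" using upper[OF \<open>\<epsilon> > 0\<close>] by blast
    have "((\<lambda>t. c * exp (- (\<theta> * t))) \<longlongrightarrow> c * 0) at_top"
      by (intro tendsto_mult tendsto_const filterlim_compose[OF exp_at_bot]
          filterlim_compose[OF filterlim_uminus_at_bot_at_top]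
          filterlim_tendsto_pos_mult_at_top[OF tendsto_const \<theta> filterlim_ident])
    then have "\<forall>\<^sub>F t in at_top. c * exp (- (\<theta> * t)) < \<epsilon>"
      by (rule order_tendstoD) (use \<open>\<epsilon> > 0\<close> in simp)
    then obtain T2 where T2: "\<And>t. t \<ge> T2 \<Longrightarrow> c * exp (- (\<theta> * t)) < \<epsilon>"
      unfolding eventually_at_top_linorder by blast
    define T0 where "T0 = max T1 T2"
    obtain b0 t where t: "t \<ge> T0 + \<sigma> + X" "W b0 t > M - \<epsilon>"
      using near[OF \<open>\<epsilon> > 0\<close>] by blast
    have "M - \<eta> \<le> Z b s" if s: "t - R - \<sigma> \<le> s" "s \<le> t - R" for b s
    proof -
      \<comment> \<open>The parity \<open>b0 \<noteq> b\<close> makes the walk end in component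
        \<open>b\<close>, at most \<delta> before \<open>s\<close>.\<close>
      obtain x where x: "walk K \<tau> flip (b0 \<noteq> b) x" "t - s \<le> x" "x \<le> t - s + \<delta>"
        using R(2)[of "t - s" "b0 \<noteq> b"] s by auto
      have "x \<le> X" "T0 + \<sigma> \<le> t - x" unfolding X_def using x s t X_def by linarith+
      have "(M + \<epsilon>) - W (b0 \<noteq> (b0 \<noteq> b)) (t - x) \<le> exp (\<theta> * x) * ((M + \<epsilon>) - W b0 t)"
        by (rule renewal_deficit_along_walk[where flip = flip, OF fin pos le p Wsub _ x(1)])
          (use T1 T0_def \<open>T0 + \<sigma> \<le> t - x\<close> in auto)
      also have "\<dots> \<le> exp (\<theta> * X) * (2 * \<epsilon>)"
      proof -
        have "T1 \<le> t" using t(1) R(1) \<delta>(1) \<open>\<sigma> > 0\<close> unfolding X_def T0_def by linarith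
        then show ?thesis
          using t T1[of t b0] \<open>x \<le> X\<close> \<theta> \<open>\<epsilon> > 0\<close> by (intro mult_mono) auto
      qed
      finally have "M - 2 * \<epsilon> * exp (\<theta> * X) \<le> W b (t - x)"
        using \<open>\<epsilon> > 0\<close> by (cases b; cases b0; simp add: mult_ac)
      moreover have "W b (t - x) = Z b (t - x) + c * exp (- (\<theta> * (t - x)))"
        unfolding W_def Z_def by (simp add: algebra_simps)
      moreover have "c * exp (- (\<theta> * (t - x))) < \<epsilon>"
        using T2[of "t - x"] \<open>T0 + \<sigma> \<le> t - x\<close> \<open>\<sigma> > 0\<close> unfolding T0_def by simp
      ultimately have Zx: "M - \<eta> / 2 \<le> Z b (t - x)" using eps by linarith
      have "M - \<eta> \<le> exp (- \<theta> * \<delta>) * M - exp (- \<theta> * \<delta>) * (\<eta> / 2)"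
      proof -
        have "exp (- \<theta> * \<delta>) * (\<eta> / 2) \<le> 1 * (\<eta> / 2)"
          using \<delta> \<theta> \<open>\<eta> > 0\<close> by (intro mult_right_mono) auto
        then show ?thesis using \<delta> by linarith
      qed
      also have "\<dots> \<le> exp (- \<theta> * \<delta>) * Z b (t - x)"
        using mult_left_mono[OF Zx, of "exp (- \<theta> * \<delta>)"] by (simp add: right_diff_distrib)
      also have "\<dots> \<le> exp (- \<theta> * (s - (t - x))) * Z b (t - x)"
      proof (rule mult_right_mono)
        have "\<theta> * (s - (t - x)) \<le> \<theta> * \<delta>" using x \<theta> by (intro mult_left_mono) auto
        then show "exp (- \<theta> * \<delta>) \<le> exp (- \<theta> * (s - (t - x)))" by simp
      qed (rule Z0)
      also have "\<dots> = exp (- \<theta> * s) * F b (t - x)"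
      proof -
        have "exp (- (\<theta> * (s - (t - x)))) * exp (- (\<theta> * (t - x))) = exp (- (\<theta> * s))"
          by (simp flip: exp_add add: right_diff_distrib)
        then show ?thesis unfolding Z_def by (simp flip: mult.assoc)
      qed
      \<comment> \<open>Monotonicity carries the bound from the point hit by the walk forward to
        \<open>s\<close>.\<close>
      also have "\<dots> \<le> exp (- \<theta> * s) * F b s"
        using monoD[OF mono, of "t - x" s b] x by (intro mult_left_mono) auto
      finally show ?thesis unfolding Z_def .
    qed
    then have "M - \<eta> \<le> Z b s" if "s \<ge> t - R - \<sigma>" for b s
      by (intro Zprop[where T = "t - R" and s = s]) (use that in auto)
    then show ?thesis by blast
  qed
  have lim: "((\<lambda>t. exp (- \<theta> * t) * F b t) \<longlongrightarrow> M) at_top" for b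
    unfolding Z_def[symmetric]
  proof (rule tendstoI)
    fix \<epsilon> :: real assume "\<epsilon> > 0"
    obtain T1 where T1: "\<And>b s. s \<ge> T1 \<Longrightarrow> W b s \<le> M + \<epsilon> / 2"
      using upper[of "\<epsilon> / 2"] \<open>\<epsilon> > 0\<close> by auto
    obtain T2 where T2: "\<And>b s. s \<ge> T2 \<Longrightarrow> M - \<epsilon> / 2 \<le> Z b s"
      using lower[of "\<epsilon> / 2"] \<open>\<epsilon> > 0\<close> by auto
    have "dist (Z b t) M < \<epsilon>" if "t \<ge> max T1 T2" for t
      using T1[of t b] T2[of t b] ZW[of b t] that \<open>\<epsilon> > 0\<close> unfolding dist_real_def by simp
    then show "\<forall>\<^sub>F t in at_top. dist (Z b t) M < \<epsilon>"
      unfolding eventually_at_top_linorder by blast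
  qed
  have "M > 0" if "F b t > 0" for b t
  proof -
    \<comment> \<open>The flipping step \<open>k0\<close> passes positivity on to the other
      component. Monotonicity then keeps both components above a fixed \<open>m > 0\<close> on a
      whole window, and the supersolution property preserves the resulting bound for
      \<open>Z\<close>.\<close>
    have *: "F (\<not> b) (t + \<tau> k0) > 0"
    proof -
      have "F b t = F ((\<not> b) \<noteq> flip k0) (t + \<tau> k0 - \<tau> k0)" using flip by simp
      also have "\<dots> \<le> (\<Sum>k\<in>K. F ((\<not> b) \<noteq> flip k) (t + \<tau> k0 - \<tau> k))"
        by (rule member_le_sum[OF flip(1) _ fin]) (rule nonneg)
      also have "\<dots> \<le> F (\<not> b) (t + \<tau> k0)" by (rule super)
      finally show ?thesis using that by simp
    qed
    define T where "T = t + \<tau> k0"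
    define m where "m = min (F b t) (F (\<not> b) T)"
    have "m > 0" unfolding m_def T_def using * that by simp
    have m: "F b' s \<ge> m" if "s \<ge> T" for b' s
    proof (cases "b' = b")
      case True
      have "F b t \<le> F b s" using monoD[OF mono, of t s b] that pos[OF flip(1)] by (simp add: T_def)
      then show ?thesis using True by (simp add: m_def)
    next
      case False
      then have "b' = (\<not> b)" by auto
      moreover have "F (\<not> b) T \<le> F (\<not> b) s" using monoD[OF mono, of T s "\<not> b"] that by simp
      ultimately show ?thesis by (simp add: m_def)
    qed
    define x where "x = exp (- \<theta> * (T + \<sigma>)) * m"
    have "x > 0" unfolding x_def using \<open>m > 0\<close> by simp
    have "x \<le> Z b' s" if "s \<ge> T" for b' s
    proof (rule Zprop[where T = "T + \<sigma>" and s = s])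
      fix b'' s assume s: "T + \<sigma> - \<sigma> \<le> s" "s \<le> T + \<sigma>"
      have "\<theta> * s \<le> \<theta> * (T + \<sigma>)" using s \<theta> by (intro mult_left_mono) auto
      then have "exp (- \<theta> * (T + \<sigma>)) \<le> exp (- \<theta> * s)" by simp
      then show "x \<le> Z b'' s" unfolding x_def Z_def
        using m[of s b''] s \<open>m > 0\<close> by (intro mult_mono) auto
    qed (use that in auto)
    then have "x \<le> M"
      using tendsto_lowerbound[OF lim[of b], of x] unfolding Z_def
      by (auto simp: eventually_at_top_linorder trivial_limit_at_top_linorder)
    then show ?thesis using \<open>x > 0\<close> by simp
  qed
  then show ?thesis using lim \<open>M \<ge> 0\<close> by blast
qed

subsection \<open>The negative index of a Hermitian form\<close>

text \<open>Gaussian elimination, one equation per step: \<open>p\<close> is the pivot column,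
  \<open>A'\<close> the reduced system and \<open>c'\<close> the back substitution.\<close>

lemma homogeneous_system_nontrivial_solution:
  fixes A :: "'l \<Rightarrow> 'j \<Rightarrow> 'a::field"
  assumes "finite L" "finite J" "card L < card J"
  shows "\<exists>c. (\<exists>j\<in>J. c j \<noteq> 0) \<and> (\<forall>l\<in>L. (\<Sum>j\<in>J. A l j * c j) = 0)"
  using assms
proof (induction L arbitrary: J A rule: finite_induct)
  case empty
  then have "J \<noteq> {}" by auto
  then show ?case by (intro exI[of _ "\<lambda>_. 1"]) auto
next
  case (insert l L)
  show ?case
  proof (cases "\<forall>j\<in>J. A l j = 0")
    case True
    from insert.IH[of J A] insert.prems insert.hyps obtain c where
      "\<exists>j\<in>J. c j \<noteq> 0" "\<forall>l\<in>L. (\<Sum>j\<in>J. A l j * c j) = 0" by auto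
    then show ?thesis using True by (intro exI[of _ c]) auto
  next
    case False
    then obtain p where p: "p \<in> J" "A l p \<noteq> 0" by blast
    define J' where "J' = J - {p}"
    have J': "finite J'" "card L < card J'" "J = insert p J'" "p \<notin> J'"
      unfolding J'_def using insert p by auto
    define A' where "A' i j = A i j - A i p * A l j / A l p" for i j
    from insert.IH[OF J'(1,2), of A'] obtain c where
      c: "\<exists>j\<in>J'. c j \<noteq> 0" "\<And>i. i \<in> L \<Longrightarrow> (\<Sum>j\<in>J'. A' i j * c j) = 0" by blast
    define s where "s = (\<Sum>j\<in>J'. A l j * c j)"
    define c' where "c' = c(p := - s / A l p)"
    have sum: "(\<Sum>j\<in>J. A i j * c' j) = (\<Sum>j\<in>J'. A i j * c j) - A i p * s / A l p" for i
    proof -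
      have "(\<Sum>j\<in>J'. A i j * c' j) = (\<Sum>j\<in>J'. A i j * c j)"
        by (rule sum.cong) (use J' in \<open>auto simp: c'_def\<close>)
      then show ?thesis using J' by (simp add: c'_def)
    qed
    have "(\<Sum>j\<in>J'. A' i j * c j) = (\<Sum>j\<in>J'. A i j * c j) - A i p * s / A l p" for i
      unfolding A'_def s_def
      by (simp add: left_diff_distrib sum_subtractf sum_distrib_left sum_divide_distrib mult.assoc)
    then have "\<forall>i\<in>L. (\<Sum>j\<in>J. A i j * c' j) = 0" using sum c(2) by simp
    moreover have "(\<Sum>j\<in>J. A l j * c' j) = 0" using sum[of l] p by (simp add: s_def)
    moreover have "\<exists>j\<in>J. c' j \<noteq> 0" using c(1) J' by (auto simp: c'_def)
    ultimately show ?thesis by blast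
  qed
qed

text \<open>Summed in the function space rather than pointwise, which is the form in which span,
  dependence and closure of subspaces are stated.\<close>

definition lincomb :: "(real \<Rightarrow> complex) set \<Rightarrow> ((real \<Rightarrow> complex) \<Rightarrow> complex) \<Rightarrow> real \<Rightarrow> complex" where
  "lincomb B c = (\<Sum>b\<in>B. (\<lambda>x. c b * b x))"

lemma lincomb_apply: "lincomb B c x = (\<Sum>b\<in>B. c b * b x)"
proof (cases "finite B")
  case True
  then show ?thesis unfolding lincomb_def by induction auto
qed (simp add: lincomb_def)

locale hermitian_form =
  fixes H :: "(real \<Rightarrow> complex) set"
    and T :: "(real \<Rightarrow> complex) \<Rightarrow> (real \<Rightarrow> complex) \<Rightarrow> complex"
  assumes subspace: "cfun.subspace H"
    and add: "y \<in> H \<Longrightarrow> z \<in> H \<Longrightarrow> w \<in> H \<Longrightarrow> T (y + z) w = T y w + T z w"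
    and scale: "y \<in> H \<Longrightarrow> w \<in> H \<Longrightarrow> T (\<lambda>x. c * y x) w = c * T y w"
    and hermitian: "y \<in> H \<Longrightarrow> z \<in> H \<Longrightarrow> T z y = cnj (T y z)"
begin

definition functional :: "((real \<Rightarrow> complex) \<Rightarrow> complex) \<Rightarrow> bool" where
  "functional l \<longleftrightarrow> (\<forall>y\<in>H. \<forall>z\<in>H. l (y + z) = l y + l z) \<and> (\<forall>c. \<forall>y\<in>H. l (\<lambda>x. c * y x) = c * l y)"

text \<open>Negativity for all nontrivial coefficients builds in linear independence, so
  \<open>card B\<close> is the dimension of a negative definite subspace and a lower bound for the
  index.\<close>

definition negative_set :: "(real \<Rightarrow> complex) set \<Rightarrow> bool" where
  "negative_set B \<longleftrightarrow> finite B \<and> B \<subseteq> H \<and>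
     (\<forall>c. (\<exists>b\<in>B. c b \<noteq> 0) \<longrightarrow> T (lincomb B c) (lincomb B c) < 0)"

text \<open>The dual certificate: finitely many linear conditions exclude all negative vectors, so
  their number bounds the index from above. Such pairs avoid dimension formulas in an
  infinite-dimensional space.\<close>

definition nonneg_on_kernel :: "((real \<Rightarrow> complex) \<Rightarrow> complex) set \<Rightarrow> bool" where
  "nonneg_on_kernel L \<longleftrightarrow> finite L \<and> (\<forall>l\<in>L. functional l) \<and>
     (\<forall>y\<in>H. (\<forall>l\<in>L. l y = 0) \<longrightarrow> \<not> T y y < 0)"

lemma zero_mem: "0 \<in> H"
  using subspace by (rule cfun.subspace_0)

lemma add_mem: "y \<in> H \<Longrightarrow> z \<in> H \<Longrightarrow> y + z \<in> H"
  using subspace by (rule cfun.subspace_add)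

lemma scale_mem: "y \<in> H \<Longrightarrow> (\<lambda>x. c * y x) \<in> H"
  using cfun.subspace_scale[OF subspace] .

lemma functional_zero: "functional l \<Longrightarrow> l 0 = 0"
proof -
  assume "functional l"
  then have "l (0 + 0) = l 0 + l 0" using zero_mem unfolding functional_def by blast
  then show "l 0 = 0" by simp
qed

lemma lincomb_mem: "finite B \<Longrightarrow> B \<subseteq> H \<Longrightarrow> lincomb B c \<in> H"
  unfolding lincomb_def by (intro cfun.subspace_sum[OF subspace] scale_mem) auto

lemma functional_lincomb:
  assumes "functional l" "finite B" "B \<subseteq> H"
  shows "l (lincomb B c) = (\<Sum>b\<in>B. c b * l b)"
  using assms(2,3)
proof induction
  case empty
  have "lincomb {} c = 0" unfolding lincomb_def by (rule sum.empty)
  then show ?case using functional_zero[OF assms(1)] by (simp only: sum.empty)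
next
  case (insert b B)
  have "l (lincomb (insert b B) c) = l ((\<lambda>x. c b * b x) + lincomb B c)"
    using insert by (simp add: lincomb_def)
  also have "\<dots> = l (\<lambda>x. c b * b x) + l (lincomb B c)"
    using assms(1) scale_mem lincomb_mem insert unfolding functional_def by blast
  also have "l (\<lambda>x. c b * b x) = c b * l b"
    using assms(1) insert unfolding functional_def by blast
  finally show ?case using insert by simp
qed

lemma functional_form: "w \<in> H \<Longrightarrow> functional (\<lambda>y. T y w)"
  unfolding functional_def using add scale by blast

lemma form_zero: "T 0 0 = 0"
  using functional_zero[OF functional_form[OF zero_mem]] .

lemma add_right: "y \<in> H \<Longrightarrow> z \<in> H \<Longrightarrow> w \<in> H \<Longrightarrow> T w (y + z) = T w y + T w z"
  using hermitian[of "y + z" w] hermitian[of y w] hermitian[of z w] add[of y z w] add_mem by simp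

lemma scale_right: "y \<in> H \<Longrightarrow> w \<in> H \<Longrightarrow> T w (\<lambda>x. c * y x) = cnj c * T w y"
  using hermitian[of "\<lambda>x. c * y x" w] hermitian[of y w] scale[of y w c] scale_mem by simp

lemma form_scale_self: "y \<in> H \<Longrightarrow> T (\<lambda>x. c * y x) (\<lambda>x. c * y x) = of_real ((cmod c)\<^sup>2) * T y y"
  unfolding complex_norm_square by (simp add: scale scale_right scale_mem)

text \<open>With fewer conditions than vectors, some nontrivial combination satisfies all conditions
  and would be negative and not negative at once.\<close>

lemma card_negative_set_le:
  assumes B: "negative_set B" and L: "nonneg_on_kernel L"
  shows "card B \<le> card L"
proof (rule ccontr)
  assume "\<not> ?thesis"
  then obtain c where c: "\<exists>b\<in>B. c b \<noteq> 0" "\<forall>l\<in>L. (\<Sum>b\<in>B. l b * c b) = 0"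
    using homogeneous_system_nontrivial_solution[of L B "\<lambda>l b. l b"] B L
    unfolding negative_set_def nonneg_on_kernel_def by auto
  have "T (lincomb B c) (lincomb B c) < 0" using B c(1) unfolding negative_set_def by blast
  moreover have "\<forall>l\<in>L. l (lincomb B c) = 0"
    using functional_lincomb[of _ B c] B L c(2) unfolding negative_set_def nonneg_on_kernel_def
    by (simp add: mult.commute)
  moreover have "lincomb B c \<in> H" using B lincomb_mem unfolding negative_set_def by blast
  ultimately show False using L unfolding nonneg_on_kernel_def by blast
qed

lemma negative_set_empty: "negative_set {}"
  unfolding negative_set_def by simp

text \<open>Orthogonality removes the mixed terms, so the form on the enlarged span is a sum of two
  nonpositive parts, at least one of them strictly negative.\<close>

lemma negative_set_insert:
  assumes B: "negative_set B" and y: "y \<in> H" "\<And>b. b \<in> B \<Longrightarrow> T y b = 0" "T y y < 0"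
  shows "y \<notin> B" "negative_set (insert y B)"
proof -
  show "y \<notin> B" using y(2)[of y] y(3) by auto
  have finB: "finite B" "B \<subseteq> H" using B unfolding negative_set_def by auto
  have "T (lincomb (insert y B) c) (lincomb (insert y B) c) < 0" if c: "\<exists>b\<in>insert y B. c b \<noteq> 0" for c
  proof -
    define v where "v = lincomb B c"
    define u where "u = (\<lambda>x. c y * y x)"
    have H: "v \<in> H" "u \<in> H" unfolding v_def u_def using finB y lincomb_mem scale_mem by auto
    have "T v y = (\<Sum>b\<in>B. c b * T b y)"
      unfolding v_def by (rule functional_lincomb[OF functional_form[OF y(1)] finB])
    also have "\<dots> = 0"
    proof (intro sum.neutral ballI)
      fix b assume "b \<in> B"
      then show "c b * T b y = 0" using hermitian[of y b] y finB by auto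
    qed
    finally have "T v y = 0" .
    then have "T v u = 0" unfolding u_def using scale_right[of y v] y H by simp
    then have "T u v = 0" using hermitian[of v u] H by simp
    have "lincomb (insert y B) c = u + v"
      unfolding lincomb_def u_def v_def using \<open>y \<notin> B\<close> finB by simp
    then have eq: "T (lincomb (insert y B) c) (lincomb (insert y B) c) = T u u + T v v"
      using H add_mem \<open>T v u = 0\<close> \<open>T u v = 0\<close> by (simp add: add add_right)
    have u: "T u u = of_real ((cmod (c y))\<^sup>2) * T y y"
      unfolding u_def by (rule form_scale_self[OF y(1)])
    have v: "T v v < 0 \<or> (\<forall>b\<in>B. c b = 0) \<and> T v v = 0"
    proof (cases "\<exists>b\<in>B. c b \<noteq> 0")
      case True
      then show ?thesis using B unfolding v_def negative_set_def by blast
    next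
      case False
      then have "v = 0" unfolding v_def by (auto simp: fun_eq_iff lincomb_apply intro!: sum.neutral)
      then show ?thesis using False form_zero by auto
    qed
    show ?thesis
    proof (cases "c y = 0")
      case True
      then show ?thesis using eq u v c by auto
    next
      case False
      then have "(cmod (c y))\<^sup>2 > 0" by simp
      then have "T u u < 0" unfolding u using y(3)
        by (auto simp: less_complex_def mult_pos_neg)
      then show ?thesis unfolding eq using v by (auto simp: less_complex_def)
    qed
  qed
  then show "negative_set (insert y B)" using finB y unfolding negative_set_def by auto
qed

text \<open>A negative set of maximal size is its own upper certificate, because a negative vector
  orthogonal to all its members could be added. The given \<open>L\<close> makes the maximum
  exist.\<close>

lemma finite_index_witness:
  assumes L: "nonneg_on_kernel L"
  shows "\<exists>B L'. negative_set B \<and> nonneg_on_kernel L' \<and> card L' = card B"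
proof -
  define n where "n = Max (card ` Collect negative_set)"
  have fin: "finite (card ` Collect negative_set)"
    by (rule finite_subset[of _ "{..card L}"]) (use card_negative_set_le[OF _ L] in auto)
  have "n \<in> card ` Collect negative_set"
    unfolding n_def by (rule Max_in[OF fin]) (use negative_set_empty in auto)
  then obtain B where B: "negative_set B" "card B = n" by auto
  have max: "card B' \<le> card B" if "negative_set B'" for B'
    unfolding B(2) n_def by (rule Max_ge[OF fin]) (use that in auto)
  have finB: "finite B" "B \<subseteq> H" using B unfolding negative_set_def by auto
  define L' where "L' = (\<lambda>w y. T y w) ` B"
  have "\<not> T y y < 0" if y: "y \<in> H" "\<forall>l\<in>L'. l y = 0" for y
  proof
    assume "T y y < 0"
    then have "y \<notin> B" "negative_set (insert y B)"
      using negative_set_insert[OF B(1) y(1)] y(2) unfolding L'_def by auto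
    then show False using max[of "insert y B"] finB by simp
  qed
  then have "nonneg_on_kernel L'"
    unfolding nonneg_on_kernel_def L'_def using functional_form finB by auto
  moreover have "card L' \<le> card B" unfolding L'_def by (rule card_image_le[OF finB(1)])
  \<comment> \<open>A priori, distinct members of \<open>B\<close> could induce the same functional;
    the general bound rules out that loss.\<close>
  moreover have "card B \<le> card L'"
    by (rule card_negative_set_le[OF B(1)]) fact
  ultimately show ?thesis using B by (intro exI[of _ B] exI[of _ L']) auto
qed

lemma independent_negative_set:
  assumes "finite C" "C \<subseteq> S" "cfun.subspace S" "S \<subseteq> H" "cfun.independent C"
    and neg: "\<forall>y\<in>S. y \<noteq> 0 \<longrightarrow> T y y < 0"
  shows "negative_set C"
  unfolding negative_set_def
proof (intro conjI allI impI)
  fix c :: "(real \<Rightarrow> complex) \<Rightarrow> complex" assume c: "\<exists>b\<in>C. c b \<noteq> 0"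
  have "lincomb C c \<noteq> 0"
    using cfun.independentD[OF assms(5,1) order.refl, of c] c unfolding lincomb_def by blast
  moreover have "lincomb C c \<in> S"
    unfolding lincomb_def using assms
    by (intro cfun.subspace_sum[OF assms(3)] cfun.subspace_scale[OF assms(3)]) auto
  ultimately show "T (lincomb C c) (lincomb C c) < 0" using neg by blast
qed (use assms in auto)

text \<open>Ties the certificates to the supremum that defines the index. Finite subsets of a basis
  of a competing subspace are negative sets, hence no larger than \<open>card B\<close>; this also
  keeps the infinite value of \<open>cfun_edim\<close> out of the supremum.\<close>

lemma index_eq:
  assumes B: "negative_set B" and L: "nonneg_on_kernel L" "card L = card B"
  shows "Sup {cfun_edim S | S. cfun.subspace S \<and> S \<subseteq> H \<and> (\<forall>y\<in>S. y \<noteq> 0 \<longrightarrow> T y y < 0)} = enat (card B)"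
    (is "Sup ?A = _")
proof (rule antisym)
  have finB: "finite B" "B \<subseteq> H" using B unfolding negative_set_def by auto
  show "Sup ?A \<le> enat (card B)"
  proof (rule Sup_least)
    fix x assume "x \<in> ?A"
    then obtain S where S: "x = cfun_edim S" "cfun.subspace S" "S \<subseteq> H"
      "\<forall>y\<in>S. y \<noteq> 0 \<longrightarrow> T y y < 0" unfolding mem_Collect_eq by (elim exE conjE)
    obtain C where C: "C \<subseteq> S" "cfun.independent C" "S \<subseteq> cfun.span C"
      using cfun.maximal_independent_subset[of S] by blast
    have le: "card C' \<le> card B" if "finite C'" "C' \<subseteq> C" for C'
      using card_negative_set_le[OF independent_negative_set[of C' S] L(1)] L(2) S C that
        cfun.independent_mono[OF C(2) that(2)] by auto
    have "finite C"
    proof (rule ccontr)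
      assume "infinite C"
      then obtain C' where "finite C'" "card C' = Suc (card B)" "C' \<subseteq> C"
        using infinite_arbitrarily_large by blast
      then show False using le[of C'] by simp
    qed
    have "cfun.dim S = card C" using cfun.basis_card_eq_dim[OF C(1,3,2)] by simp
    moreover have "\<exists>B. finite B \<and> S \<subseteq> cfun.span B" using \<open>finite C\<close> C by blast
    ultimately show "x \<le> enat (card B)" using le[of C] \<open>finite C\<close> S by (simp add: cfun_edim_def)
  qed
  have span: "cfun.span B = range (lincomb B)"
    unfolding cfun.span_finite[OF finB(1)] lincomb_def by simp
  have "cfun.independent B"
  proof
    assume "cfun.dependent B"
    then obtain u where "\<exists>v\<in>B. u v \<noteq> 0" "lincomb B u = 0"
      unfolding cfun.dependent_finite[OF finB(1)] lincomb_def by blast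
    then show False using B form_zero unfolding negative_set_def by (metis less_irrefl)
  qed
  then have "cfun.dim (cfun.span B) = card B" by (rule cfun.dim_span_eq_card_independent)
  then have edim: "cfun_edim (cfun.span B) = enat (card B)"
    using finB unfolding cfun_edim_def by auto
  have "T y y < 0" if y: "y \<in> cfun.span B" "y \<noteq> 0" for y
  proof -
    obtain c where c: "y = lincomb B c" using y(1) span by auto
    have "\<exists>b\<in>B. c b \<noteq> 0"
    proof (rule ccontr)
      assume "\<not> ?thesis"
      then have "y = 0" unfolding c by (auto simp: fun_eq_iff lincomb_apply intro!: sum.neutral)
      then show False using y by simp
    qed
    then show ?thesis using B unfolding c negative_set_def by blast
  qed
  moreover have "cfun.span B \<subseteq> H" using cfun.span_minimal[OF finB(2) subspace] .
  ultimately have "cfun_edim (cfun.span B) \<in> ?A" using cfun.subspace_span by blast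
  then show "enat (card B) \<le> Sup ?A" unfolding edim[symmetric] by (rule Sup_upper)
qed

end

subsection \<open>Borel representatives\<close>

text \<open>Completeness of Lebesgue measure: a preimage that differs from a measurable one within a
  null set is measurable.\<close>

lemma borel_measurable_lebesgue_AE:
  fixes f g :: "real \<Rightarrow> 'a::topological_space"
  assumes g: "g \<in> borel_measurable lebesgue" and ae: "AE x in lebesgue. f x = g x"
  shows "f \<in> borel_measurable lebesgue"
proof (rule borel_measurableI)
  fix S :: "'a set" assume "open S"
  then have sets: "g -` S \<inter> space lebesgue \<in> sets lebesgue"
    using g by (intro measurable_sets) auto
  have "AE x in lebesgue. x \<in> g -` S \<inter> space lebesgue \<longleftrightarrow> x \<in> f -` S \<inter> space lebesgue"
    using ae by eventually_elim auto
  then show "f -` S \<inter> space lebesgue \<in> sets lebesgue"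
    using sets by (rule completion.in_sets_AE) simp
qed

lemma integral_lebesgue_AE:
  fixes f :: "real \<Rightarrow> 'a::{banach, second_countable_topology}"
  assumes f': "f' \<in> borel_measurable borel" and ae: "AE x in lborel. f x = f' x"
  shows "integral\<^sup>L lebesgue f = integral\<^sup>L lborel f'"
proof -
  have m: "f' \<in> borel_measurable lebesgue" using f' by (intro measurable_completion) simp
  have "integral\<^sup>L lebesgue f = integral\<^sup>L lebesgue f'"
    using borel_measurable_lebesgue_AE[OF m AE_completion[OF ae]] m AE_completion[OF ae]
    by (rule integral_cong_AE)
  also have "\<dots> = integral\<^sup>L lborel f'" using f' by (intro integral_completion) simp
  finally show ?thesis .
qed

lemma integrable_lebesgue_AE:
  fixes f :: "real \<Rightarrow> 'a::{banach, second_countable_topology}"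
  assumes f': "f' \<in> borel_measurable borel" and ae: "AE x in lborel. f x = f' x"
  shows "integrable lebesgue f \<longleftrightarrow> integrable lborel f'"
proof -
  have m: "f' \<in> borel_measurable lebesgue" using f' by (intro measurable_completion) simp
  have "integrable lebesgue f \<longleftrightarrow> integrable lebesgue f'"
    using borel_measurable_lebesgue_AE[OF m AE_completion[OF ae]] m AE_completion[OF ae]
    by (rule integrable_cong_AE)
  also have "\<dots> \<longleftrightarrow> integrable lborel f'" using f' by (intro integrable_completion) simp
  finally show ?thesis .
qed

text \<open>A Borel representative cut off outside [0,1]. Integrals over the interval become
  integrals over the line with respect to \<open>lborel\<close>, where Fubini and affine
  substitution apply directly.\<close>

definition L2_rep :: "(real \<Rightarrow> 'a::{banach, second_countable_topology}) \<Rightarrow> (real \<Rightarrow> 'a) \<Rightarrow> bool" where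
  "L2_rep f g \<longleftrightarrow> g \<in> borel_measurable borel \<and> (\<forall>x. x \<notin> {0..1} \<longrightarrow> g x = 0) \<and>
     integrable lborel (\<lambda>x. (norm (g x))\<^sup>2) \<and> (AE x in lborel. x \<in> {0..1} \<longrightarrow> f x = g x)"

lemma L2_repI:
  fixes f :: "real \<Rightarrow> 'a::{banach, second_countable_topology}"
  assumes "L2_01 f" and h: "h \<in> borel_measurable borel" "AE x in lborel. indicator {0..1} x *\<^sub>R f x = h x"
  shows "L2_rep f (\<lambda>x. indicator {0..1} x *\<^sub>R h x)"
proof -
  have ae: "AE x in lborel. x \<in> {0..1} \<longrightarrow> f x = indicator {0..1} x *\<^sub>R h x"
    using h(2) by eventually_elim (auto simp: indicator_def split: if_splits)
  have "AE x in lborel. indicator {0..1} x *\<^sub>R (norm (f x))\<^sup>2 = (norm (indicator {0..1} x *\<^sub>R h x))\<^sup>2"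
    using ae by eventually_elim (auto simp: indicator_def)
  moreover have "integrable lebesgue (\<lambda>x. indicator {0..1} x *\<^sub>R (norm (f x))\<^sup>2)"
    using assms(1) unfolding L2_01_def set_integrable_def by blast
  moreover have "(\<lambda>x. (norm (indicator {0..1} x *\<^sub>R h x))\<^sup>2) \<in> borel_measurable borel"
    using h(1) by measurable
  ultimately have "integrable lborel (\<lambda>x. (norm (indicator {0..1} x *\<^sub>R h x))\<^sup>2)"
    by (simp only: integrable_lebesgue_AE)
  moreover have "(\<lambda>x. indicator {0..1} x *\<^sub>R h x) \<in> borel_measurable borel" using h(1) by measurable
  ultimately show ?thesis unfolding L2_rep_def using ae by (simp add: indicator_def)
qed

lemma L2_rep_real_exists:
  fixes f :: "real \<Rightarrow> real"
  assumes "L2_01 f"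
  shows "\<exists>g. L2_rep f g"
proof -
  have "(\<lambda>x. indicator {0..1} x *\<^sub>R f x) \<in> borel_measurable lebesgue"
    using assms unfolding L2_01_def set_borel_measurable_def by blast
  from completion_ex_borel_measurable_real[OF this] obtain h where
    "h \<in> borel_measurable lborel" "AE x in lborel. indicator {0..1} x *\<^sub>R f x = h x" by blast
  then show ?thesis using L2_repI[OF assms, of h] by auto
qed

lemma L2_rep_complex_exists:
  fixes f :: "real \<Rightarrow> complex"
  assumes "L2_01 f"
  shows "\<exists>g. L2_rep f g"
proof -
  let ?f = "\<lambda>x. indicator {0..1} x *\<^sub>R f x"
  have m: "?f \<in> borel_measurable lebesgue"
    using assms unfolding L2_01_def set_borel_measurable_def by blast
  have "(\<lambda>x. Re (?f x)) \<in> borel_measurable lebesgue" "(\<lambda>x. Im (?f x)) \<in> borel_measurable lebesgue"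
    using measurable_compose[OF m, of Re borel] measurable_compose[OF m, of Im borel] by simp_all
  from this[THEN completion_ex_borel_measurable_real] obtain u v where
    uv: "u \<in> borel_measurable lborel" "v \<in> borel_measurable lborel"
    "AE x in lborel. Re (?f x) = u x" "AE x in lborel. Im (?f x) = v x" by blast
  have "AE x in lborel. ?f x = Complex (u x) (v x)"
    using uv(3,4) by eventually_elim (simp add: complex_eq_iff)
  moreover have "(\<lambda>x. Complex (u x) (v x)) \<in> borel_measurable borel"
    using uv(1,2) by (simp add: Complex_eq)
  ultimately show ?thesis using L2_repI[OF assms] by blast
qed

lemma le_one_plus_square: "r \<le> 1 + (r::real)\<^sup>2"
proof -
  have "2 * r \<le> r\<^sup>2 + 1" using sum_squares_bound[of r 1] by simp
  moreover have "0 \<le> r\<^sup>2" by simp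
  ultimately show ?thesis by linarith
qed

lemma integrable_of_square_integrable:
  fixes g :: "real \<Rightarrow> 'a::{banach, second_countable_topology}"
  assumes "g \<in> borel_measurable borel" "\<And>x. x \<notin> {0..1} \<Longrightarrow> g x = 0"
    and "integrable lborel (\<lambda>x. (norm (g x))\<^sup>2)"
  shows "integrable lborel g"
proof (rule Bochner_Integration.integrable_bound)
  show "integrable lborel (\<lambda>x. indicator {0..1} x + (norm (g x))\<^sup>2)"
    using assms by (intro Bochner_Integration.integrable_add) auto
  have "norm (g x) \<le> norm (indicator {0..1} x + (norm (g x))\<^sup>2)" for x
    using assms(2)[of x] le_one_plus_square[of "norm (g x)"] by (cases "x \<in> {0..1}") auto
  then show "AE x in lborel. norm (g x) \<le> norm (indicator {0..1} x + (norm (g x))\<^sup>2)" by simp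
qed (use assms in simp)

lemma integrable_mult_of_square_integrable:
  fixes f g :: "real \<Rightarrow> 'a::{real_normed_field, banach, second_countable_topology}"
  assumes "f \<in> borel_measurable borel" "g \<in> borel_measurable borel"
    "integrable lborel (\<lambda>x. (norm (f x))\<^sup>2)" "integrable lborel (\<lambda>x. (norm (g x))\<^sup>2)"
  shows "integrable lborel (\<lambda>x. f x * g x)"
proof (rule Bochner_Integration.integrable_bound)
  show "integrable lborel (\<lambda>x. (norm (f x))\<^sup>2 + (norm (g x))\<^sup>2)"
    using assms by (intro Bochner_Integration.integrable_add) auto
  have "norm (f x * g x) \<le> norm ((norm (f x))\<^sup>2 + (norm (g x))\<^sup>2)" for x
  proof -
    have "2 * norm (f x) * norm (g x) \<le> (norm (f x))\<^sup>2 + (norm (g x))\<^sup>2"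
      by (rule sum_squares_bound)
    moreover have "0 \<le> norm (f x) * norm (g x)" by simp
    ultimately have "norm (f x) * norm (g x) \<le> (norm (f x))\<^sup>2 + (norm (g x))\<^sup>2" by linarith
    then show ?thesis unfolding norm_mult by simp
  qed
  then show "AE x in lborel. norm (f x * g x) \<le> norm ((norm (f x))\<^sup>2 + (norm (g x))\<^sup>2)" by simp
qed (use assms in simp)

subsection \<open>Primitives of integrable functions\<close>

text \<open>For functions vanishing outside [0,1] this is the integral from 0 to \<open>x\<close>;
  the half-line form is a plain line integral for every real \<open>x\<close>.\<close>

definition primitive :: "(real \<Rightarrow> complex) \<Rightarrow> real \<Rightarrow> complex" where
  "primitive g x = (LINT t|lborel. indicator {..x} t *\<^sub>R g t)"

lemma integrable_indicator_scaleR: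
  "integrable lborel g \<Longrightarrow> integrable lborel (\<lambda>t. indicator {..x::real} t *\<^sub>R (g t :: complex))"
  by (rule integrable_mult_indicator) auto

lemma primitive_measurable [measurable]:
  assumes [measurable]: "g \<in> borel_measurable borel"
  shows "primitive g \<in> borel_measurable borel"
proof -
  have "(\<lambda>x. LINT t|lborel. (if t \<le> x then g t else 0)) \<in> borel_measurable borel"
    by measurable
  moreover have "primitive g = (\<lambda>x. LINT t|lborel. (if t \<le> x then g t else 0))"
    unfolding primitive_def by (intro ext Bochner_Integration.integral_cong) auto
  ultimately show ?thesis by simp
qed

lemma norm_primitive_le:
  assumes "integrable lborel g"
  shows "cmod (primitive g x) \<le> (LINT t|lborel. cmod (g t))"
proof -
  have "cmod (primitive g x) \<le> (LINT t|lborel. cmod (indicator {..x} t *\<^sub>R g t))"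
    unfolding primitive_def by (rule integral_norm_bound)
  also have "\<dots> \<le> (LINT t|lborel. cmod (g t))"
    using integrable_indicator_scaleR[OF assms] assms
    by (intro integral_mono integrable_norm) (auto simp: indicator_def)
  finally show ?thesis .
qed

lemma primitive_add:
  "integrable lborel g \<Longrightarrow> integrable lborel h \<Longrightarrow>
   primitive (\<lambda>x. g x + h x) x = primitive g x + primitive h x"
  unfolding primitive_def by (simp add: scaleR_add_right integrable_indicator_scaleR)

lemma primitive_scale: "primitive (\<lambda>x. c * g x) x = c * primitive g x"
  unfolding primitive_def by (simp flip: mult_scaleR_right)

text \<open>Half-lines generate the Borel sets and are stable under intersection; sets of zero
  integral are closed under complements, thanks to \<open>tot\<close>, and under countable disjoint
  unions. By Dynkin's argument every Borel set has zero integral.\<close>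

lemma AE_eq_0_of_primitive:
  assumes g: "integrable lborel g" and tot: "integral\<^sup>L lborel g = 0" and "\<And>x. primitive g x = 0"
  shows "AE x in lborel. g x = 0"
proof (rule sigma_finite_measure.density_zero[OF sigma_finite_lborel g])
  fix A :: "real set" assume "A \<in> sets lborel"
  have borel: "sets lborel = sigma_sets UNIV (range (\<lambda>a. {..a::real}))"
    unfolding sets_lborel by (subst borel_eq_atMost) (rule sets_measure_of, simp)
  then have A: "A \<in> sigma_sets UNIV (range (\<lambda>a. {..a::real}))"
    using \<open>A \<in> sets lborel\<close> by simp
  have m: "B \<in> sets lborel" if "B \<in> sigma_sets UNIV (range (\<lambda>a. {..a::real}))" for B
    using that borel by simp
  have i: "set_integrable lborel B g" if "B \<in> sets lborel" for B
    using that g unfolding set_integrable_def by (rule integrable_mult_indicator)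
  show "(LINT x:A|lborel. g x) = 0"
  proof (rule sigma_sets_induct_disjoint[OF _ _ A])
    show "Int_stable (range (\<lambda>a. {..a::real}))"
      by (auto simp: Int_stable_def)
    fix B assume "B \<in> range (\<lambda>a. {..a::real})"
    then show "(LINT x:B|lborel. g x) = 0"
      using assms(3) unfolding primitive_def set_lebesgue_integral_def by auto
  next
    fix B assume B: "B \<in> sigma_sets UNIV (range (\<lambda>a. {..a::real}))" "(LINT x:B|lborel. g x) = 0"
    have "(LINT x:UNIV - B|lborel. g x) + (LINT x:B|lborel. g x) = (LINT x:(UNIV - B) \<union> B|lborel. g x)"
      using m[OF B(1)] i by (intro set_integral_Un[symmetric]) auto
    also have "\<dots> = 0" using tot by (simp add: set_lebesgue_integral_def)
    finally show "(LINT x:UNIV - B|lborel. g x) = 0" using B by simp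
  next
    fix B :: "nat \<Rightarrow> real set"
    assume B: "disjoint_family B" "range B \<subseteq> sigma_sets UNIV (range (\<lambda>a. {..a::real}))"
      "\<And>i. (LINT x:B i|lborel. g x) = 0"
    have "(LINT x:(\<Union>i. B i)|lborel. g x) = (\<Sum>i. (LINT x:B i|lborel. g x))"
    proof (intro lebesgue_integral_countable_add i sets.countable_UN)
      show "B i \<in> sets lborel" for i using m B(2) by blast
      then show "range B \<subseteq> sets lborel" by blast
      show "B i \<inter> B j = {}" if "i \<noteq> j" for i j
        using B(1) that by (simp add: disjoint_family_on_def)
    qed
    then show "(LINT x:(\<Union>i. B i)|lborel. g x) = 0" using B(3) by simp
  qed (auto simp: set_lebesgue_integral_def)
qed

text \<open>Integration by parts without pointwise differentiation: the product of the two integrals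
  is a double integral, which is cut along the diagonal into two triangles; Fubini evaluates them in
  opposite orders.\<close>

lemma primitive_mult:
  assumes f: "integrable lborel f" and g: "integrable lborel g"
  shows "primitive f x * primitive g x = primitive (\<lambda>t. f t * primitive g t + primitive f t * g t) x"
proof -
  have [measurable]: "f \<in> borel_measurable borel" "g \<in> borel_measurable borel"
    using f g by auto
  define f1 where "f1 t = indicator {..x} t *\<^sub>R f t" for t
  define g1 where "g1 t = indicator {..x} t *\<^sub>R g t" for t
  have [measurable]: "f1 \<in> borel_measurable borel" "g1 \<in> borel_measurable borel"
    unfolding f1_def g1_def by measurable
  have fg1: "integrable lborel f1" "integrable lborel g1"
    unfolding f1_def g1_def using f g by (auto intro: integrable_indicator_scaleR)
  have prod: "integrable (lborel \<Otimes>\<^sub>M lborel) (\<lambda>(s, t). f1 s * g1 t)"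
  proof (rule lborel_pair.Fubini_integrable)
    show "integrable lborel (\<lambda>s. LINT t|lborel. norm (case (s, t) of (s, t) \<Rightarrow> f1 s * g1 t))"
      using fg1 by (simp add: norm_mult)
    show "AE s in lborel. integrable lborel (\<lambda>t. case (s, t) of (s, t) \<Rightarrow> f1 s * g1 t)"
      using fg1 by simp
  qed measurable
  have low: "integrable (lborel \<Otimes>\<^sub>M lborel) (\<lambda>(s, t). (if s < t then f1 s * g1 t else 0))"
    by (rule Bochner_Integration.integrable_bound[OF prod]) auto
  have G: "(LINT t|lborel. (if t \<le> s then f1 s * g1 t else 0)) = f1 s * primitive g s" for s
  proof (cases "s \<le> x")
    case True
    have "(LINT t|lborel. (if t \<le> s then f1 s * g1 t else 0)) = (LINT t|lborel. f1 s * (indicator {..s} t *\<^sub>R g t))"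
      by (rule Bochner_Integration.integral_cong) (use True in \<open>auto simp: g1_def indicator_def\<close>)
    then show ?thesis unfolding primitive_def by (simp only: integral_mult_right_zero)
  qed (simp add: f1_def cong: if_cong)
  have F: "(LINT s|lborel. (if s < t then f1 s * g1 t else 0)) = primitive f t * g1 t" for t
  proof (cases "t \<le> x")
    case True
    have "(LINT s|lborel. (if s < t then f1 s * g1 t else 0)) = (LINT s|lborel. (indicator {..t} s *\<^sub>R f s) * g1 t)"
    proof (rule integral_cong_AE)
      \<comment> \<open>The strict triangle misses the diagonal, a single point for each
        \<open>t\<close>.\<close>
      show "AE s in lborel. (if s < t then f1 s * g1 t else 0) = (indicator {..t} s *\<^sub>R f s) * g1 t"
        using AE_lborel_singleton[of t]
        by eventually_elim (use True in \<open>auto simp: f1_def indicator_def\<close>)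
    qed measurable
    then show ?thesis unfolding primitive_def by (simp only: integral_mult_left_zero)
  qed (simp add: g1_def cong: if_cong)
  have intF: "integrable lborel (\<lambda>t. primitive f t * g1 t)"
    using lborel_pair.integrable_snd[OF low] unfolding F .
  have intG: "integrable lborel (\<lambda>s. f1 s * primitive g s)"
  proof -
    have "integrable (lborel \<Otimes>\<^sub>M lborel) (\<lambda>(s, t). (if t \<le> s then f1 s * g1 t else 0))"
      by (rule Bochner_Integration.integrable_bound[OF prod]) auto
    from lborel_pair.integrable_fst[OF this] show ?thesis unfolding G .
  qed
  have "primitive f x * primitive g x = (LINT s|lborel. f1 s) * (LINT t|lborel. g1 t)"
    unfolding primitive_def f1_def g1_def ..
  also have "\<dots> = (LINT s|lborel. (LINT t|lborel. f1 s * g1 t))" by simp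
  also have "\<dots> = (LINT s|lborel. (LINT t|lborel. (if t \<le> s then f1 s * g1 t else 0)) +
      (LINT t|lborel. (if s < t then f1 s * g1 t else 0)))"
  proof (rule Bochner_Integration.integral_cong[OF refl])
    fix s
    have "integrable lborel (\<lambda>t. f1 s * g1 t)" using fg1 by simp
    then have "integrable lborel (\<lambda>t. if t \<le> s then f1 s * g1 t else 0)"
        "integrable lborel (\<lambda>t. if s < t then f1 s * g1 t else 0)"
      by (auto intro: Bochner_Integration.integrable_bound)
    then have "(LINT t|lborel. (if t \<le> s then f1 s * g1 t else 0) + (if s < t then f1 s * g1 t else 0)) =
        (LINT t|lborel. (if t \<le> s then f1 s * g1 t else 0)) + (LINT t|lborel. (if s < t then f1 s * g1 t else 0))"
      by (rule Bochner_Integration.integral_add)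
    moreover have "(LINT t|lborel. f1 s * g1 t) =
        (LINT t|lborel. (if t \<le> s then f1 s * g1 t else 0) + (if s < t then f1 s * g1 t else 0))"
      by (rule Bochner_Integration.integral_cong) auto
    ultimately show "(LINT t|lborel. f1 s * g1 t) = (LINT t|lborel. (if t \<le> s then f1 s * g1 t else 0)) +
      (LINT t|lborel. (if s < t then f1 s * g1 t else 0))"
      by (rule trans[rotated])
  qed
  also have "\<dots> = (LINT s|lborel. f1 s * primitive g s) +
      (LINT s|lborel. LINT t|lborel. (if s < t then f1 s * g1 t else 0))"
    unfolding G using intG lborel_pair.integrable_fst[OF low]
    by (intro Bochner_Integration.integral_add) auto
  also have "(LINT s|lborel. LINT t|lborel. (if s < t then f1 s * g1 t else 0)) =
      (LINT t|lborel. LINT s|lborel. (if s < t then f1 s * g1 t else 0))"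
    by (rule lborel_pair.Fubini_integral[OF low, symmetric])
  also have "\<dots> = (LINT t|lborel. primitive f t * g1 t)" unfolding F ..
  also have "(LINT s|lborel. f1 s * primitive g s) + (LINT t|lborel. primitive f t * g1 t) =
      primitive (\<lambda>t. f t * primitive g t + primitive f t * g t) x"
    unfolding primitive_def[of "\<lambda>t. f t * primitive g t + primitive f t * g t"]
      Bochner_Integration.integral_add[OF intG intF, symmetric]
    by (rule Bochner_Integration.integral_cong) (simp_all add: f1_def g1_def scaleR_add_right)
  finally show ?thesis .
qed

subsection \<open>The Sobolev space\<close>

lemma borel_measurable_cnj [measurable]: "cnj \<in> borel_measurable borel"
  by (intro borel_measurable_continuous_onI continuous_intros)

text \<open>A working form of the space with an explicit Borel derivative. Vanishing at 0 is
  automatic because \<open>g\<close> is 0 to the left, and \<open>primitive g 1 = 0\<close> is the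
  condition at 1.\<close>

definition sobolev0 :: "(real \<Rightarrow> complex) \<Rightarrow> (real \<Rightarrow> complex) \<Rightarrow> bool" where
  "sobolev0 y g \<longleftrightarrow> g \<in> borel_measurable borel \<and> (\<forall>x. x \<notin> {0..1} \<longrightarrow> g x = 0) \<and>
     integrable lborel (\<lambda>x. (cmod (g x))\<^sup>2) \<and> y = primitive g \<and> primitive g 1 = 0"

lemma primitive_left:
  assumes "\<And>x. x \<notin> {0..1} \<Longrightarrow> g x = 0" and [measurable]: "g \<in> borel_measurable borel" and "x \<le> 0"
  shows "primitive g x = 0"
proof -
  have "primitive g x = integral\<^sup>L lborel (\<lambda>t::real. 0)"
    unfolding primitive_def
  proof (rule integral_cong_AE)
    show "AE t in lborel. indicator {..x} t *\<^sub>R g t = 0"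
      using AE_lborel_singleton[of 0]
    proof eventually_elim
      fix t :: real assume "t \<noteq> 0"
      then show "indicator {..x} t *\<^sub>R g t = 0"
        using assms(1)[of t] assms(3) by (cases "t \<le> x") auto
    qed
  qed measurable
  then show ?thesis by simp
qed

lemma primitive_right:
  assumes "\<And>x. x \<notin> {0..1} \<Longrightarrow> g x = 0" and "1 \<le> x"
  shows "primitive g x = primitive g 1" "integral\<^sup>L lborel g = primitive g 1"
proof -
  have "indicator {..x} t *\<^sub>R g t = indicator {..1} t *\<^sub>R g t"
    "g t = indicator {..1} t *\<^sub>R g t" for t
    using assms(1)[of t] assms(2) by (auto simp: indicator_def)
  then show "primitive g x = primitive g 1" "integral\<^sup>L lborel g = primitive g 1"
    unfolding primitive_def by (auto intro: Bochner_Integration.integral_cong)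
qed

lemma has_sobolev_deriv_primitive:
  assumes y: "has_sobolev_deriv y g" and h: "L2_rep g h" and x: "x \<in> {0..1}"
  shows "y x = y 0 + primitive h x"
proof -
  have [measurable]: "h \<in> borel_measurable borel" using h unfolding L2_rep_def by blast
  have "(LINT t:{0..x}|lebesgue. g t) = (LINT t|lborel. indicator {..x} t *\<^sub>R h t)"
    unfolding set_lebesgue_integral_def
  proof (rule integral_lebesgue_AE)
    have "AE t in lborel. t \<in> {0..1} \<longrightarrow> g t = h t" using h unfolding L2_rep_def by blast
    then show "AE t in lborel. indicator {0..x} t *\<^sub>R g t = indicator {..x} t *\<^sub>R h t"
    proof eventually_elim
      fix t :: real assume t: "t \<in> {0..1} \<longrightarrow> g t = h t"
      have "t \<notin> {0..1} \<longrightarrow> h t = 0" using h unfolding L2_rep_def by blast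
      with t x show "indicator {0..x} t *\<^sub>R g t = indicator {..x} t *\<^sub>R h t"
        by (auto simp: indicator_def)
    qed
  qed measurable
  moreover have "y x = y 0 + (LINT t:{0..x}|lebesgue. g t)"
    using y x unfolding has_sobolev_deriv_def by blast
  ultimately show ?thesis unfolding primitive_def by simp
qed

lemma L2_rep_integrable: "L2_rep f (g :: real \<Rightarrow> complex) \<Longrightarrow> integrable lborel g"
  using integrable_of_square_integrable[of g] unfolding L2_rep_def by blast

text \<open>Makes the choice behind \<open>sobolev_deriv\<close> harmless: the difference of two
  representatives has a primitive that is 0 everywhere.\<close>

lemma has_sobolev_deriv_unique:
  assumes "has_sobolev_deriv y g" "has_sobolev_deriv y g'"
  shows "AE x in lborel. x \<in> {0..1} \<longrightarrow> g x = g' x"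
proof -
  obtain h h' where h: "L2_rep g h" "L2_rep g' h'"
    using L2_rep_complex_exists assms unfolding has_sobolev_deriv_def by blast
  note int = L2_rep_integrable[OF h(1)] L2_rep_integrable[OF h(2)]
  define d where "d x = h x + (-1) * h' x" for x
  have supp: "d x = 0" if "x \<notin> {0..1}" for x
    using h that unfolding L2_rep_def d_def by simp
  have prim: "primitive d x = primitive h x - primitive h' x" for x
    unfolding d_def using primitive_add[OF int(1) integrable_mult_right[OF int(2), of "-1"]] primitive_scale[of "-1" h']
    by simp
  have d01: "primitive d x = 0" if "x \<in> {0..1}" for x
    using has_sobolev_deriv_primitive[OF assms(1) h(1) that]
      has_sobolev_deriv_primitive[OF assms(2) h(2) that] unfolding prim by simp
  have intd: "integrable lborel d" unfolding d_def using int by simp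
  have "AE x in lborel. d x = 0"
  proof (rule AE_eq_0_of_primitive[OF intd])
    show "integral\<^sup>L lborel d = 0" using primitive_right(2)[of d 1] supp d01[of 1] by simp
    show "primitive d x = 0" for x
    proof -
      consider "x \<le> 0" | "0 \<le> x" "x \<le> 1" | "1 \<le> x" by linarith
      then show ?thesis
      proof cases
        case 1
        then show ?thesis using primitive_left[of d x] supp intd by simp
      next
        case 2
        then show ?thesis by (simp add: d01)
      next
        case 3
        then show ?thesis using primitive_right(1)[of d x] supp d01[of 1] by simp
      qed
    qed
  qed
  moreover have "AE x in lborel. x \<in> {0..1} \<longrightarrow> g x = h x" "AE x in lborel. x \<in> {0..1} \<longrightarrow> g' x = h' x"
    using h unfolding L2_rep_def by auto
  ultimately show ?thesis by eventually_elim (simp add: d_def)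
qed

context
  fixes y g :: "real \<Rightarrow> complex"
  assumes yg: "sobolev0 y g"
begin

lemma sobolev0_measurable: "g \<in> borel_measurable borel" "y \<in> borel_measurable borel"
  using yg primitive_measurable unfolding sobolev0_def by auto

lemma sobolev0_deriv_outside: "x \<notin> {0..1} \<Longrightarrow> g x = 0"
  using yg unfolding sobolev0_def by blast

lemma sobolev0_square_integrable: "integrable lborel (\<lambda>x. (cmod (g x))\<^sup>2)"
  using yg unfolding sobolev0_def by blast

lemma sobolev0_integrable: "integrable lborel g"
  using yg integrable_of_square_integrable[of g] unfolding sobolev0_def by blast

lemma sobolev0_outside: "x \<notin> {0<..<1} \<Longrightarrow> y x = 0"
  using yg primitive_left[of g x] primitive_right(1)[of g x]
  unfolding sobolev0_def by (cases "x \<le> 0") auto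

lemma sobolev0_L2_01: "L2_01 g"
  unfolding L2_01_def set_borel_measurable_def set_integrable_def
proof
  show "(\<lambda>x. indicator {0..1} x *\<^sub>R g x) \<in> borel_measurable lebesgue"
    using sobolev0_measurable by (intro measurable_completion) simp
  have eq: "indicator {0..1} x *\<^sub>R (norm (g x))\<^sup>2 = (norm (g x))\<^sup>2" for x
    using sobolev0_deriv_outside[of x] by (cases "x \<in> {0..1}") auto
  have "(\<lambda>x. (norm (g x))\<^sup>2) \<in> borel_measurable borel" using sobolev0_measurable by simp
  then show "integrable lebesgue (\<lambda>x. indicator {0..1} x *\<^sub>R (norm (g x))\<^sup>2)"
    unfolding eq using sobolev0_square_integrable by (subst integrable_lebesgue_AE) auto
qed

lemma sobolev0_has_sobolev_deriv: "has_sobolev_deriv y g"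
proof -
  have "(LINT t:{0..x}|lebesgue. g t) = y x" if "x \<in> {0..1}" for x
  proof -
    have "(LINT t:{0..x}|lebesgue. g t) = (LINT t|lborel. indicator {..x} t *\<^sub>R g t)"
      unfolding set_lebesgue_integral_def
    proof (rule integral_lebesgue_AE)
      show "(\<lambda>t. indicator {..x} t *\<^sub>R g t) \<in> borel_measurable borel"
        using sobolev0_measurable by simp
      have "indicator {0..x} t *\<^sub>R g t = indicator {..x} t *\<^sub>R g t" for t
        using sobolev0_deriv_outside[of t] by (auto simp: indicator_def)
      then show "AE t in lborel. indicator {0..x} t *\<^sub>R g t = indicator {..x} t *\<^sub>R g t"
        by simp
    qed
    then show ?thesis using yg unfolding sobolev0_def primitive_def by simp
  qed
  then show ?thesis
    unfolding has_sobolev_deriv_def using sobolev0_L2_01 sobolev0_outside[of 0] by simp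
qed

lemma sobolev0_W21_0: "y \<in> W21_0"
  unfolding W21_0_def using sobolev0_has_sobolev_deriv sobolev0_outside by auto

lemma sobolev_deriv_AE: "AE x in lborel. x \<in> {0..1} \<longrightarrow> sobolev_deriv y x = g x"
proof (rule has_sobolev_deriv_unique)
  show "has_sobolev_deriv y (sobolev_deriv y)"
    unfolding sobolev_deriv_def using sobolev0_has_sobolev_deriv by (rule someI[of "has_sobolev_deriv y"])
qed (rule sobolev0_has_sobolev_deriv)

lemma sobolev0_bound: "cmod (y x) \<le> (LINT t|lborel. cmod (g t))"
  using norm_primitive_le[OF sobolev0_integrable] yg unfolding sobolev0_def by simp

text \<open>Cauchy-Schwarz on an interval of length 1, obtained by integrating the square of
  \<open>cmod (g t) - A\<close>, where \<open>A\<close> is the mean.\<close>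

lemma sobolev0_bound_energy: "(LINT t|lborel. cmod (g t))\<^sup>2 \<le> (LINT t|lborel. (cmod (g t))\<^sup>2)"
proof -
  define A where "A = (LINT t|lborel. cmod (g t))"
  have int: "integrable lborel (\<lambda>t. (cmod (g t))\<^sup>2 - (2 * A) * cmod (g t))"
    using sobolev0_integrable sobolev0_square_integrable by simp
  have int': "integrable lborel (\<lambda>t. A\<^sup>2 * indicator {0..1::real} t)" by simp
  have "0 \<le> (LINT t|lborel. ((cmod (g t))\<^sup>2 - (2 * A) * cmod (g t)) + A\<^sup>2 * indicator {0..1} t)"
  proof (rule Bochner_Integration.integral_nonneg)
    fix t
    have "0 \<le> (cmod (g t) - A)\<^sup>2" by simp
    then have "0 \<le> (cmod (g t))\<^sup>2 - (2 * A) * cmod (g t) + A\<^sup>2"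
      by (simp add: power2_diff mult_ac)
    then show "0 \<le> ((cmod (g t))\<^sup>2 - (2 * A) * cmod (g t)) + A\<^sup>2 * indicator {0..1} t"
      using sobolev0_deriv_outside[of t] by (cases "t \<in> {0..1}") auto
  qed
  also have "\<dots> = ((LINT t|lborel. (cmod (g t))\<^sup>2) - 2 * A * A) + A\<^sup>2"
    using sobolev0_integrable sobolev0_square_integrable
    unfolding Bochner_Integration.integral_add[OF int int'] by (simp add: A_def)
  finally show ?thesis unfolding A_def[symmetric] by (simp add: power2_eq_square)
qed

end

lemma W21_0_sobolev0:
  assumes "y \<in> W21_0"
  shows "\<exists>g. sobolev0 y g"
proof -
  obtain g' where g': "has_sobolev_deriv y g'" using assms unfolding W21_0_def by blast
  then obtain g where g: "L2_rep g' g"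
    using L2_rep_complex_exists unfolding has_sobolev_deriv_def by blast
  have y: "y 0 = 0" "y 1 = 0" "\<And>x. x \<notin> {0..1} \<Longrightarrow> y x = 0"
    using assms unfolding W21_0_def by auto
  have prim: "y x = primitive g x" if "x \<in> {0..1}" for x
    using has_sobolev_deriv_primitive[OF g' g that] y by simp
  have "primitive g 1 = 0" using prim[of 1] y by simp
  have gs: "\<And>x. x \<notin> {0..1} \<Longrightarrow> g x = 0" "g \<in> borel_measurable borel" using g unfolding L2_rep_def by auto
  have "y x = primitive g x" for x
  proof -
    consider "x < 0" | "0 \<le> x" "x \<le> 1" | "1 < x" by linarith
    then show ?thesis
    proof cases
      case 1
      then show ?thesis using primitive_left[OF gs, of x] y(3)[of x] by simp
    next
      case 2
      then show ?thesis by (simp add: prim)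
    next
      case 3
      then show ?thesis using primitive_right(1)[of g x] gs(1) y(3)[of x] \<open>primitive g 1 = 0\<close> by simp
    qed
  qed
  then show ?thesis
    using g \<open>primitive g 1 = 0\<close> unfolding sobolev0_def L2_rep_def by auto
qed

lemma sobolev0_add:
  assumes "sobolev0 y g" "sobolev0 z h"
  shows "sobolev0 (y + z) (\<lambda>x. g x + h x)"
proof -
  have [measurable]: "g \<in> borel_measurable borel" "h \<in> borel_measurable borel"
    using sobolev0_measurable assms by auto
  have prim: "primitive (\<lambda>x. g x + h x) x = primitive g x + primitive h x" for x
    using assms by (intro primitive_add sobolev0_integrable) auto
  have "integrable lborel (\<lambda>x. (cmod (g x + h x))\<^sup>2)"
  proof (rule Bochner_Integration.integrable_bound)
    show "integrable lborel (\<lambda>x. 2 * (cmod (g x))\<^sup>2 + 2 * (cmod (h x))\<^sup>2)"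
      using sobolev0_square_integrable assms by (intro Bochner_Integration.integrable_add) auto
    have "norm ((cmod (g x + h x))\<^sup>2) \<le> norm (2 * (cmod (g x))\<^sup>2 + 2 * (cmod (h x))\<^sup>2)" for x
    proof -
      have "(cmod (g x + h x))\<^sup>2 \<le> (cmod (g x) + cmod (h x))\<^sup>2"
        by (intro power_mono norm_triangle_ineq) simp
      also have "\<dots> \<le> 2 * (cmod (g x))\<^sup>2 + 2 * (cmod (h x))\<^sup>2"
        using sum_squares_bound[of "cmod (g x)" "cmod (h x)"] by (simp add: power2_sum)
      finally show ?thesis by simp
    qed
    then show "AE x in lborel. norm ((cmod (g x + h x))\<^sup>2) \<le> norm (2 * (cmod (g x))\<^sup>2 + 2 * (cmod (h x))\<^sup>2)"
      by simp
  qed measurable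
  then show ?thesis using assms prim unfolding sobolev0_def by (auto simp: fun_eq_iff)
qed

lemma sobolev0_scale:
  assumes "sobolev0 y g"
  shows "sobolev0 (\<lambda>x. c * y x) (\<lambda>x. c * g x)"
  unfolding sobolev0_def
proof (intro conjI allI impI)
  show "(\<lambda>x. c * g x) \<in> borel_measurable borel" using sobolev0_measurable[OF assms] by simp
  show "integrable lborel (\<lambda>x. (cmod (c * g x))\<^sup>2)"
    using sobolev0_square_integrable[OF assms] by (simp add: norm_mult power_mult_distrib)
  show "(\<lambda>x. c * y x) = primitive (\<lambda>x. c * g x)" "primitive (\<lambda>x. c * g x) 1 = 0"
    using assms unfolding sobolev0_def by (auto simp: primitive_scale)
qed (use sobolev0_deriv_outside[OF assms] in simp)

lemma sobolev0_zero: "sobolev0 0 (\<lambda>x. 0)"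
  unfolding sobolev0_def by (auto simp: primitive_def fun_eq_iff)

lemma subspace_W21_0: "cfun.subspace W21_0"
proof (rule cfun.subspaceI)
  show "0 \<in> W21_0" using sobolev0_W21_0[OF sobolev0_zero] .
next
  fix y z assume "y \<in> W21_0" "z \<in> W21_0"
  then obtain g h where "sobolev0 y g" "sobolev0 z h" using W21_0_sobolev0 by blast
  then show "y + z \<in> W21_0" using sobolev0_W21_0[OF sobolev0_add] by blast
next
  fix c y assume "y \<in> W21_0"
  then obtain g where "sobolev0 y g" using W21_0_sobolev0 by blast
  then show "(\<lambda>x. c * y x) \<in> W21_0" by (rule sobolev0_W21_0[OF sobolev0_scale])
qed

lemma primitive_cnj: "primitive (\<lambda>x. cnj (g x)) x = cnj (primitive g x)"
proof -
  have "indicator {..x} t *\<^sub>R cnj (g t) = cnj (indicator {..x} t *\<^sub>R g t)" for t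
    by (simp add: scaleR_conv_of_real)
  then show ?thesis unfolding primitive_def by (simp only: Bochner_Integration.integral_cnj)
qed

text \<open>The product rule for \<open>y\<close> and its conjugate, with boundedness of
  \<open>y\<close> giving square integrability. It places |y|^2 in the space, where the generalized
  derivative can be evaluated, and shows that its derivative integrates to 0.\<close>

lemma sobolev0_square:
  assumes "sobolev0 y g"
  shows "sobolev0 (\<lambda>x. of_real ((cmod (y x))\<^sup>2)) (\<lambda>x. of_real (2 * Re (g x * cnj (y x))))"
proof -
  note m [measurable] = sobolev0_measurable[OF assms]
  have y: "y = primitive g" using assms unfolding sobolev0_def by blast
  have "of_real ((cmod (y x))\<^sup>2) = primitive (\<lambda>x. of_real (2 * Re (g x * cnj (y x)))) x" for x
  proof -
    have "of_real ((cmod (y x))\<^sup>2) = primitive g x * primitive (\<lambda>x. cnj (g x)) x"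
      unfolding primitive_cnj y by (rule complex_norm_square)
    also have "\<dots> = primitive (\<lambda>t. g t * cnj (y t) + y t * cnj (g t)) x"
      unfolding y primitive_cnj[symmetric] using sobolev0_integrable[OF assms]
      by (intro primitive_mult) auto
    also have "(\<lambda>t. g t * cnj (y t) + y t * cnj (g t)) = (\<lambda>x. of_real (2 * Re (g x * cnj (y x))))"
      by (simp add: fun_eq_iff complex_eq_iff)
    finally show ?thesis .
  qed
  moreover have "integrable lborel (\<lambda>x. (cmod (of_real (2 * Re (g x * cnj (y x)))))\<^sup>2)"
  proof (rule Bochner_Integration.integrable_bound)
    define M where "M = (LINT t|lborel. cmod (g t))"
    show "integrable lborel (\<lambda>x. (2 * M)\<^sup>2 * (cmod (g x))\<^sup>2)"
      using sobolev0_square_integrable[OF assms] by simp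
    have "norm ((cmod (of_real (2 * Re (g x * cnj (y x)))))\<^sup>2) \<le> norm ((2 * M)\<^sup>2 * (cmod (g x))\<^sup>2)" for x
    proof -
      have "cmod (of_real (2 * Re (g x * cnj (y x)))) \<le> 2 * cmod (g x * cnj (y x))"
        using abs_Re_le_cmod[of "g x * cnj (y x)"] by (simp add: norm_mult del: times_complex.sel)
      also have "\<dots> \<le> 2 * M * cmod (g x)"
        using sobolev0_bound[OF assms, of x] by (simp add: norm_mult M_def mult_left_mono mult.commute)
      finally have "(cmod (of_real (2 * Re (g x * cnj (y x)))))\<^sup>2 \<le> (2 * M * cmod (g x))\<^sup>2"
        by (rule power_mono) simp
      then show ?thesis by (simp add: power_mult_distrib)
    qed
    then show "AE x in lborel. norm ((cmod (of_real (2 * Re (g x * cnj (y x)))))\<^sup>2) \<le> norm ((2 * M)\<^sup>2 * (cmod (g x))\<^sup>2)"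
      by simp
  qed measurable
  moreover have "(\<lambda>x. complex_of_real (2 * Re (g x * cnj (y x)))) \<in> borel_measurable borel" by measurable
  moreover have "complex_of_real (2 * Re (g x * cnj (y x))) = 0" if "x \<notin> {0..1}" for x
    using sobolev0_deriv_outside[OF assms that] by simp
  moreover have "primitive (\<lambda>x. of_real (2 * Re (g x * cnj (y x)))) 1 = 0"
    using sobolev0_outside[OF assms, of 1] calculation(1)[of 1] by (simp del: times_complex.sel)
  ultimately show ?thesis unfolding sobolev0_def by (intro conjI ext allI impI)
qed

subsection \<open>The pencil in terms of Borel representatives\<close>

definition energy :: "(real \<Rightarrow> complex) \<Rightarrow> real" where
  "energy g = (LINT x|lborel. (cmod (g x))\<^sup>2)"

text \<open>Minus the pairing of the generalized derivative with |y|^2, for \<open>g\<close> the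
  derivative of \<open>y\<close>.\<close>

definition weight_form :: "(real \<Rightarrow> real) \<Rightarrow> (real \<Rightarrow> complex) \<Rightarrow> (real \<Rightarrow> complex) \<Rightarrow> real" where
  "weight_form p y g = (LINT x|lborel. p x * (2 * Re (g x * cnj (y x))))"

context
  fixes P p :: "real \<Rightarrow> real"
  assumes Pp: "L2_rep P p"
begin

lemma L2_rep_measurable: "p \<in> borel_measurable borel"
  using Pp unfolding L2_rep_def by blast

lemma integrable_weight:
  assumes y: "sobolev0 y g" and z: "sobolev0 z h"
  shows "integrable lborel (\<lambda>x. of_real (p x) * (g x * cnj (z x)))"
proof (rule Bochner_Integration.integrable_bound)
  note [measurable] = sobolev0_measurable[OF y] sobolev0_measurable[OF z] L2_rep_measurable
  define M where "M = (LINT t|lborel. cmod (h t))"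
  have "integrable lborel (\<lambda>x. complex_of_real (p x) * g x)"
    using Pp sobolev0_square_integrable[OF y] L2_rep_measurable
    by (intro integrable_mult_of_square_integrable) (auto simp: L2_rep_def)
  then show "integrable lborel (\<lambda>x. of_real M * (complex_of_real (p x) * g x))" by simp
  show "AE x in lborel. norm (of_real (p x) * (g x * cnj (z x))) \<le> norm (of_real M * (complex_of_real (p x) * g x))"
  proof (rule AE_I2)
    fix x
    have "cmod (z x) \<le> \<bar>M\<bar>" using sobolev0_bound[OF z, of x] unfolding M_def by linarith
    then have "(\<bar>p x\<bar> * cmod (g x)) * cmod (z x) \<le> (\<bar>p x\<bar> * cmod (g x)) * \<bar>M\<bar>"
      by (intro mult_left_mono) auto
    then show "norm (of_real (p x) * (g x * cnj (z x))) \<le> norm (of_real M * (complex_of_real (p x) * g x))"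
      by (simp add: norm_mult mult_ac)
  qed
  show "(\<lambda>x. of_real (p x) * (g x * cnj (z x))) \<in> borel_measurable lborel" by measurable
qed

lemma integrable_weight':
  assumes y: "sobolev0 y g" and z: "sobolev0 z h"
  shows "integrable lborel (\<lambda>x. of_real (p x) * (y x * cnj (h x)))"
proof -
  have "integrable lborel (\<lambda>x. cnj (of_real (p x) * (h x * cnj (y x))))"
    using integrable_weight[OF z y] by (rule Bochner_Integration.integrable_cnj)
  then show ?thesis by (simp add: mult_ac)
qed

lemma integrable_deriv_product:
  assumes y: "sobolev0 y g" and z: "sobolev0 z h"
  shows "integrable lborel (\<lambda>x. g x * cnj (h x))"
  using assms sobolev0_measurable[OF z] sobolev0_measurable[OF y]
  by (intro integrable_mult_of_square_integrable) (auto intro: sobolev0_square_integrable)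

text \<open>Trades the chosen derivatives for Borel ones and separates the integrals, so that
  sesquilinearity reduces to linearity of each integral.\<close>

lemma pencil_eq:
  assumes y: "sobolev0 y g" and z: "sobolev0 z h"
  shows "pencil P lam y z = (LINT x|lborel. g x * cnj (h x)) +
    of_real lam * ((LINT x|lborel. of_real (p x) * (g x * cnj (z x))) + (LINT x|lborel. of_real (p x) * (y x * cnj (h x))))"
proof -
  note [measurable] = sobolev0_measurable[OF y] sobolev0_measurable[OF z] L2_rep_measurable
  have "pencil P lam y z = (LINT x|lborel. g x * cnj (h x) +
    of_real lam * (of_real (p x) * (g x * cnj (z x)) + of_real (p x) * (y x * cnj (h x))))"
    unfolding pencil_def set_lebesgue_integral_def
  proof (rule integral_lebesgue_AE)
    have "AE x in lborel. x \<in> {0..1} \<longrightarrow> P x = p x" using Pp unfolding L2_rep_def by blast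
    then show "AE x in lborel. indicator {0..1} x *\<^sub>R
           (sobolev_deriv y x * cnj (sobolev_deriv z x) +
            complex_of_real (lam * P x) *
            (sobolev_deriv y x * cnj (z x) + y x * cnj (sobolev_deriv z x))) =
          g x * cnj (h x) +
          of_real lam * (of_real (p x) * (g x * cnj (z x)) + of_real (p x) * (y x * cnj (h x)))"
      using sobolev_deriv_AE[OF y] sobolev_deriv_AE[OF z]
    proof eventually_elim
      case (elim x)
      then show ?case
        using sobolev0_deriv_outside[OF y, of x] sobolev0_deriv_outside[OF z, of x]
        by (cases "x \<in> {0..1}") (auto simp: algebra_simps)
    qed
  qed measurable
  then show ?thesis
    using integrable_weight[OF y z] integrable_weight'[OF y z] integrable_deriv_product[OF y z] by simp
qed

lemma generalized_deriv_eq: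
  assumes y: "sobolev0 y g"
  shows "generalized_deriv P y = - (LINT x|lborel. of_real (p x) * cnj (g x))"
  unfolding generalized_deriv_def set_lebesgue_integral_def
proof (subst integral_lebesgue_AE)
  note [measurable] = sobolev0_measurable[OF y] L2_rep_measurable
  show "(\<lambda>x. of_real (p x) * cnj (g x)) \<in> borel_measurable borel" by measurable
  have "AE x in lborel. x \<in> {0..1} \<longrightarrow> P x = p x" using Pp unfolding L2_rep_def by blast
  then show "AE x in lborel. indicator {0..1} x *\<^sub>R (of_real (P x) * cnj (sobolev_deriv y x)) = of_real (p x) * cnj (g x)"
    using sobolev_deriv_AE[OF y]
    by eventually_elim (use sobolev0_deriv_outside[OF y] in \<open>auto simp: indicator_def\<close>)
qed simp

lemma generalized_deriv_square:
  assumes y: "sobolev0 y g"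
  shows "generalized_deriv P (\<lambda>x. of_real ((cmod (y x))\<^sup>2)) = of_real (- weight_form p y g)"
  unfolding generalized_deriv_eq[OF sobolev0_square[OF y]] weight_form_def
  by (simp only: complex_cnj_complex_of_real of_real_mult[symmetric] integral_complex_of_real of_real_minus)

lemma integrable_weight_form:
  assumes y: "sobolev0 y g"
  shows "integrable lborel (\<lambda>x. p x * (2 * Re (g x * cnj (y x))))"
proof -
  have "integrable lborel (\<lambda>x. 2 * Re (of_real (p x) * (g x * cnj (y x))))"
    using integrable_weight[OF y y] by (intro integrable_mult_right) (rule Bochner_Integration.integrable_Re)
  moreover have "2 * Re (of_real (p x) * (g x * cnj (y x))) = p x * (2 * Re (g x * cnj (y x)))" for x
    by (simp add: algebra_simps)
  ultimately show ?thesis by (simp only:)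
qed

lemma pencil_self:
  assumes y: "sobolev0 y g"
  shows "pencil P lam y y = of_real (energy g + lam * weight_form p y g)"
proof -
  have "(LINT x|lborel. g x * cnj (g x)) = of_real (energy g)"
    unfolding energy_def by (simp only: complex_norm_square[symmetric] integral_complex_of_real)
  moreover have "(LINT x|lborel. of_real (p x) * (g x * cnj (y x))) + (LINT x|lborel. of_real (p x) * (y x * cnj (g x)))
      = (LINT x|lborel. of_real (p x) * (g x * cnj (y x)) + of_real (p x) * (y x * cnj (g x)))"
    by (rule Bochner_Integration.integral_add[symmetric, OF integrable_weight[OF y y] integrable_weight'[OF y y]])
  moreover have "\<dots> = of_real (weight_form p y g)"
    unfolding weight_form_def integral_complex_of_real[symmetric]
    by (rule Bochner_Integration.integral_cong[OF refl]) (simp add: complex_eq_iff algebra_simps)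
  ultimately show ?thesis unfolding pencil_eq[OF y y] by simp
qed

lemma pencil_add:
  assumes "y \<in> W21_0" "z \<in> W21_0" "w \<in> W21_0"
  shows "pencil P lam (y + z) w = pencil P lam y w + pencil P lam z w"
proof -
  obtain g where y: "sobolev0 y g" using W21_0_sobolev0 assms(1) by blast
  obtain h where z: "sobolev0 z h" using W21_0_sobolev0 assms(2) by blast
  obtain k where w: "sobolev0 w k" using W21_0_sobolev0 assms(3) by blast
  have "(LINT x|lborel. (g x + h x) * cnj (k x)) =
      (LINT x|lborel. g x * cnj (k x)) + (LINT x|lborel. h x * cnj (k x))"
    using integrable_deriv_product[OF y w] integrable_deriv_product[OF z w] by (simp add: distrib_right)
  moreover have "(LINT x|lborel. of_real (p x) * ((g x + h x) * cnj (w x))) =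
      (LINT x|lborel. of_real (p x) * (g x * cnj (w x))) + (LINT x|lborel. of_real (p x) * (h x * cnj (w x)))"
    using integrable_weight[OF y w] integrable_weight[OF z w] by (simp add: distrib_left distrib_right)
  moreover have "(LINT x|lborel. of_real (p x) * ((y + z) x * cnj (k x))) =
      (LINT x|lborel. of_real (p x) * (y x * cnj (k x))) + (LINT x|lborel. of_real (p x) * (z x * cnj (k x)))"
    using integrable_weight'[OF y w] integrable_weight'[OF z w] by (simp add: distrib_left distrib_right)
  ultimately show ?thesis
    unfolding pencil_eq[OF y w] pencil_eq[OF z w] pencil_eq[OF sobolev0_add[OF y z] w]
    by (simp only:) (simp add: algebra_simps)
qed

lemma pencil_scale:
  assumes "y \<in> W21_0" "w \<in> W21_0"
  shows "pencil P lam (\<lambda>x. c * y x) w = c * pencil P lam y w"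
proof -
  obtain g where y: "sobolev0 y g" using W21_0_sobolev0 assms(1) by blast
  obtain k where w: "sobolev0 w k" using W21_0_sobolev0 assms(2) by blast
  have "of_real (p x) * (c * g x * cnj (w x)) = c * (of_real (p x) * (g x * cnj (w x)))"
    "of_real (p x) * (c * y x * cnj (k x)) = c * (of_real (p x) * (y x * cnj (k x)))"
    "c * g x * cnj (k x) = c * (g x * cnj (k x))" for x
    by (simp_all add: mult_ac)
  then show ?thesis
    unfolding pencil_eq[OF y w] pencil_eq[OF sobolev0_scale[OF y] w]
    by (simp only: integral_mult_right_zero) (simp add: algebra_simps)
qed

lemma pencil_hermitian:
  assumes "y \<in> W21_0" "z \<in> W21_0"
  shows "pencil P lam z y = cnj (pencil P lam y z)"
proof -
  obtain g where y: "sobolev0 y g" using W21_0_sobolev0 assms(1) by blast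
  obtain h where z: "sobolev0 z h" using W21_0_sobolev0 assms(2) by blast
  have "(LINT x|lborel. h x * cnj (g x)) = cnj (LINT x|lborel. g x * cnj (h x))"
    "(LINT x|lborel. of_real (p x) * (h x * cnj (y x))) = cnj (LINT x|lborel. of_real (p x) * (y x * cnj (h x)))"
    "(LINT x|lborel. of_real (p x) * (z x * cnj (g x))) = cnj (LINT x|lborel. of_real (p x) * (g x * cnj (z x)))"
    unfolding Bochner_Integration.integral_cnj[symmetric]
    by (auto intro!: Bochner_Integration.integral_cong)
  then show ?thesis unfolding pencil_eq[OF y z] pencil_eq[OF z y] by simp
qed

end

subsection \<open>Affine changes of variables and localisation\<close>

lemma primitive_stretch:
  assumes "a > 0"
  shows "primitive (\<lambda>x. h ((x - \<alpha>) / a) / of_real a) x = primitive h ((x - \<alpha>) / a)"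
proof -
  have "primitive (\<lambda>x. h ((x - \<alpha>) / a) / of_real a) x =
      \<bar>a\<bar> *\<^sub>R (LINT t|lborel. indicator {..x} (\<alpha> + a * t) *\<^sub>R (h ((\<alpha> + a * t - \<alpha>) / a) / of_real a))"
    unfolding primitive_def by (rule lborel_integral_real_affine) (use assms in simp)
  also have "\<dots> = (LINT t|lborel. \<bar>a\<bar> *\<^sub>R (indicator {..x} (\<alpha> + a * t) *\<^sub>R (h ((\<alpha> + a * t - \<alpha>) / a) / of_real a)))"
    by (rule integral_scaleR_right[symmetric])
  also have "\<dots> = primitive h ((x - \<alpha>) / a)"
    unfolding primitive_def
  proof (rule Bochner_Integration.integral_cong[OF refl])
    fix t
    have "\<alpha> + a * t \<le> x \<longleftrightarrow> t \<le> (x - \<alpha>) / a" using assms by (simp add: field_simps)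
    then show "\<bar>a\<bar> *\<^sub>R (indicator {..x} (\<alpha> + a * t) *\<^sub>R (h ((\<alpha> + a * t - \<alpha>) / a) / of_real a)) =
        indicator {..(x - \<alpha>) / a} t *\<^sub>R h t"
      using assms by (auto simp: indicator_def scaleR_conv_of_real)
  qed
  finally show ?thesis .
qed

lemma sobolev0_stretch:
  assumes u: "sobolev0 u h" and a: "a > 0" "0 \<le> \<alpha>" "\<alpha> + a \<le> 1"
  shows "sobolev0 (\<lambda>x. u ((x - \<alpha>) / a)) (\<lambda>x. h ((x - \<alpha>) / a) / of_real a)"
  unfolding sobolev0_def
proof (intro conjI allI impI)
  note [measurable] = sobolev0_measurable[OF u]
  have uh: "u = primitive h" using u unfolding sobolev0_def by blast
  show "(\<lambda>x. h ((x - \<alpha>) / a) / of_real a) \<in> borel_measurable borel" by measurable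
  show "h ((x - \<alpha>) / a) / of_real a = 0" if "x \<notin> {0..1}" for x
  proof -
    have "(x - \<alpha>) / a \<notin> {0..1}" using that a by (auto simp: field_simps)
    then show ?thesis using sobolev0_deriv_outside[OF u] by simp
  qed
  have "integrable lborel (\<lambda>x. (cmod (h (- \<alpha> / a + (1 / a) * x)))\<^sup>2)"
    by (rule lborel_integrable_real_affine[OF sobolev0_square_integrable[OF u]]) (use a in simp)
  moreover have "- \<alpha> / a + (1 / a) * x = (x - \<alpha>) / a" for x
    by (simp add: diff_divide_distrib)
  ultimately have "integrable lborel (\<lambda>x. (cmod (h ((x - \<alpha>) / a)))\<^sup>2 / (cmod (of_real a))\<^sup>2)" by simp
  then show "integrable lborel (\<lambda>x. (cmod (h ((x - \<alpha>) / a) / of_real a))\<^sup>2)"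
    unfolding norm_divide power_divide .
  show "(\<lambda>x. u ((x - \<alpha>) / a)) = primitive (\<lambda>x. h ((x - \<alpha>) / a) / of_real a)"
    unfolding uh by (rule ext) (rule primitive_stretch[OF a(1), symmetric])
  have "(1 - \<alpha>) / a \<notin> {0<..<1}" using a by (auto simp: field_simps)
  then have "u ((1 - \<alpha>) / a) = 0" by (rule sobolev0_outside[OF u])
  then show "primitive (\<lambda>x. h ((x - \<alpha>) / a) / of_real a) 1 = 0"
    unfolding primitive_stretch[OF a(1)] uh .
qed

lemma sobolev0_compress:
  assumes y: "sobolev0 y g" and a: "a > 0" and supp: "\<And>x. x \<notin> {\<alpha>..\<alpha> + a} \<Longrightarrow> g x = 0"
  shows "sobolev0 (\<lambda>t. y (\<alpha> + a * t)) (\<lambda>t. of_real a * g (\<alpha> + a * t))"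
  unfolding sobolev0_def
proof (intro conjI allI impI)
  note [measurable] = sobolev0_measurable[OF y]
  have yg: "y = primitive g" using y unfolding sobolev0_def by blast
  show "(\<lambda>t. of_real a * g (\<alpha> + a * t)) \<in> borel_measurable borel" by measurable
  show "of_real a * g (\<alpha> + a * t) = 0" if "t \<notin> {0..1}" for t
  proof -
    have "\<alpha> + a * t \<notin> {\<alpha>..\<alpha> + a}" using that a by (auto simp: zero_le_mult_iff mult_le_cancel_left1)
    then show ?thesis using supp by simp
  qed
  have "integrable lborel (\<lambda>t. a\<^sup>2 * (cmod (g (\<alpha> + a * t)))\<^sup>2)"
    using lborel_integrable_real_affine[OF sobolev0_square_integrable[OF y], of a \<alpha>] a by simp
  then show "integrable lborel (\<lambda>t. (cmod (of_real a * g (\<alpha> + a * t)))\<^sup>2)"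
    by (simp add: norm_mult power_mult_distrib)
  have "y (\<alpha> + a * t) = primitive (\<lambda>t. of_real a * g (\<alpha> + a * t)) t" for t
    using primitive_stretch[OF a, of "\<lambda>t. of_real a * g (\<alpha> + a * t)" \<alpha> "\<alpha> + a * t"] a
    unfolding yg by simp
  then show eq: "(\<lambda>t. y (\<alpha> + a * t)) = primitive (\<lambda>t. of_real a * g (\<alpha> + a * t))" by blast
  \<comment> \<open>\<open>y\<close> is constant from \<open>\<alpha> + a\<close> on, since
    \<open>g\<close> vanishes beyond that point, and it is 0 from 1 on.\<close>
  have "y (\<alpha> + a * 1) = 0"
  proof -
    have "y (\<alpha> + a * 1) = primitive g (max 1 (\<alpha> + a))"
      unfolding yg primitive_def
    proof (rule Bochner_Integration.integral_cong[OF refl])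
      fix t show "indicator {..\<alpha> + a * 1} t *\<^sub>R g t = indicator {..max 1 (\<alpha> + a)} t *\<^sub>R g t"
        using supp[of t] by (auto simp: indicator_def)
    qed
    also have "\<dots> = 0" using sobolev0_outside[OF y, of "max 1 (\<alpha> + a)"] unfolding yg by simp
    finally show ?thesis .
  qed
  then show "primitive (\<lambda>t. of_real a * g (\<alpha> + a * t)) 1 = 0" using fun_cong[OF eq, of 1] by simp
qed

text \<open>Cutting off at zeros of \<open>y\<close> creates no jumps, so the truncated derivative
  integrates to the truncated function.\<close>

lemma sobolev0_localize:
  assumes y: "sobolev0 y g" and z: "y \<alpha> = 0" "y \<gamma> = 0" and "\<alpha> \<le> \<gamma>"
  shows "sobolev0 (\<lambda>x. indicator {\<alpha>..\<gamma>} x *\<^sub>R y x) (\<lambda>x. indicator {\<alpha>..\<gamma>} x *\<^sub>R g x)"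
proof -
  note [measurable] = sobolev0_measurable[OF y]
  have yg: "y = primitive g" using y unfolding sobolev0_def by blast
  let ?G = "\<lambda>x. indicator {\<alpha>..\<gamma>} x *\<^sub>R g x"
  have prim: "primitive ?G x = y (min x \<gamma>) - y \<alpha>" if "\<alpha> \<le> x" for x
  proof -
    have "primitive ?G x = (LINT t|lborel. indicator {..min x \<gamma>} t *\<^sub>R g t - indicator {..\<alpha>} t *\<^sub>R g t)"
      unfolding primitive_def
    proof (rule integral_cong_AE)
      show "AE t in lborel. indicator {..x} t *\<^sub>R ?G t = indicator {..min x \<gamma>} t *\<^sub>R g t - indicator {..\<alpha>} t *\<^sub>R g t"
        using AE_lborel_singleton[of \<alpha>]
        by eventually_elim (use that \<open>\<alpha> \<le> \<gamma>\<close> in \<open>auto simp: indicator_def min_def\<close>)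
    qed measurable
    also have "\<dots> = y (min x \<gamma>) - y \<alpha>"
      unfolding yg primitive_def using integrable_indicator_scaleR[OF sobolev0_integrable[OF y]]
      by (intro Bochner_Integration.integral_diff)
    finally show ?thesis .
  qed
  have left: "primitive ?G x = 0" if "x < \<alpha>" for x
  proof -
    have "(\<lambda>t. indicator {..x} t *\<^sub>R ?G t) = (\<lambda>t. 0)" using that by (auto simp: indicator_def)
    then show ?thesis unfolding primitive_def by simp
  qed
  have eq: "indicator {\<alpha>..\<gamma>} x *\<^sub>R y x = primitive ?G x" for x
  proof (cases "\<alpha> \<le> x")
    case True
    then show ?thesis using prim[OF True] z by (cases "x \<le> \<gamma>") (auto simp: min_def)
  next
    case False
    then show ?thesis using left[of x] by simp
  qed
  show ?thesis
    unfolding sobolev0_def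
  proof (intro conjI allI impI ext)
    show "?G \<in> borel_measurable borel" by measurable
    have "integrable lborel (\<lambda>x. indicator {\<alpha>..\<gamma>} x *\<^sub>R (cmod (g x))\<^sup>2)"
      by (rule integrable_mult_indicator[OF _ sobolev0_square_integrable[OF y]]) simp
    moreover have "indicator {\<alpha>..\<gamma>} x *\<^sub>R (cmod (g x))\<^sup>2 = (cmod (?G x))\<^sup>2" for x
      by (simp add: indicator_def)
    ultimately show "integrable lborel (\<lambda>x. (cmod (?G x))\<^sup>2)" by simp
    show "primitive ?G 1 = 0" using eq[of 1] sobolev0_outside[OF y, of 1] by simp
  qed (use sobolev0_deriv_outside[OF y] eq in auto)
qed

lemma integral_real_affine_pos:
  fixes f :: "real \<Rightarrow> real"
  assumes "a > 0"
  shows "(LINT x|lborel. f ((x - \<alpha>) / a)) = a * (LINT t|lborel. f t)"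
  using lborel_integral_real_affine[of a "\<lambda>x. f ((x - \<alpha>) / a)" \<alpha>] assms by simp

lemma energy_stretch:
  assumes "a > 0"
  shows "energy (\<lambda>x. h ((x - \<alpha>) / a) / of_real a) = energy h / a"
proof -
  have "energy (\<lambda>x. h ((x - \<alpha>) / a) / of_real a) = (LINT x|lborel. (cmod (h ((x - \<alpha>) / a)))\<^sup>2 / a\<^sup>2)"
    unfolding energy_def by (simp add: norm_divide power_divide)
  also have "\<dots> = (LINT x|lborel. (cmod (h ((x - \<alpha>) / a)))\<^sup>2) / a\<^sup>2" by simp
  also have "\<dots> = a * energy h / a\<^sup>2"
    unfolding energy_def using integral_real_affine_pos[OF assms, of "\<lambda>t. (cmod (h t))\<^sup>2" \<alpha>] by simp
  finally show ?thesis using assms by (simp add: power2_eq_square)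
qed

lemma integral_deriv_square_eq_0:
  assumes u: "sobolev0 u h"
  shows "(LINT t|lborel. 2 * Re (h t * cnj (u t))) = 0"
proof -
  have "(LINT t|lborel. complex_of_real (2 * Re (h t * cnj (u t)))) = 0"
    using primitive_right(2)[of "\<lambda>t. complex_of_real (2 * Re (h t * cnj (u t)))" 1]
      sobolev0_square[OF u] unfolding sobolev0_def by auto
  then show ?thesis unfolding integral_complex_of_real of_real_eq_0_iff .
qed

text \<open>The chain rule factor \<open>1 / a\<close> cancels the Jacobian \<open>a\<close>, so
  only \<open>d\<close> survives; the constant \<open>b\<close> multiplies the integral of the
  derivative of |u|^2, which is 0.\<close>

lemma weight_form_stretch:
  assumes p: "L2_rep P p" and u: "sobolev0 u h" and a: "a > 0"
    and ss: "AE x in lborel. x \<in> {\<alpha><..<\<alpha> + a} \<longrightarrow> p x = b + d * p ((x - \<alpha>) / a)"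
  shows "weight_form p (\<lambda>x. u ((x - \<alpha>) / a)) (\<lambda>x. h ((x - \<alpha>) / a) / of_real a) = d * weight_form p u h"
proof -
  note [measurable] = sobolev0_measurable[OF u] L2_rep_measurable[OF p]
  let ?f = "\<lambda>t. (b + d * p t) * (2 * Re (h t / of_real a * cnj (u t)))"
  have "weight_form p (\<lambda>x. u ((x - \<alpha>) / a)) (\<lambda>x. h ((x - \<alpha>) / a) / of_real a) =
      (LINT x|lborel. ?f ((x - \<alpha>) / a))"
    unfolding weight_form_def
  proof (rule integral_cong_AE)
    show "AE x in lborel. p x * (2 * Re (h ((x - \<alpha>) / a) / of_real a * cnj (u ((x - \<alpha>) / a)))) = ?f ((x - \<alpha>) / a)"
      using ss
    proof eventually_elim
      case (elim x)
      show ?case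
      proof (cases "x \<in> {\<alpha><..<\<alpha> + a}")
        case True
        then show ?thesis using elim by simp
      next
        case False
        \<comment> \<open>Off the open cell both integrands are 0, so the self-similarity relation
          is called for on the cell alone.\<close>
        then have "(x - \<alpha>) / a \<notin> {0<..<1}" using a by (auto simp: field_simps)
        then have "u ((x - \<alpha>) / a) = 0" by (rule sobolev0_outside[OF u])
        then show ?thesis by simp
      qed
    qed
  qed measurable
  also have "\<dots> = a * (LINT t|lborel. ?f t)" by (rule integral_real_affine_pos[OF a])
  also have "\<dots> = (LINT t|lborel. a * ?f t)" by simp
  also have "\<dots> = (LINT t|lborel. b * (2 * Re (h t * cnj (u t))) + d * (p t * (2 * Re (h t * cnj (u t)))))"
    by (rule Bochner_Integration.integral_cong[OF refl]) (use a in \<open>simp add: field_simps Re_divide_of_real\<close>)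
  also have "\<dots> = (LINT t|lborel. b * (2 * Re (h t * cnj (u t)))) + (LINT t|lborel. d * (p t * (2 * Re (h t * cnj (u t)))))"
  proof (rule Bochner_Integration.integral_add)
    have "integrable lborel (\<lambda>t. complex_of_real (2 * Re (h t * cnj (u t))))"
      by (rule sobolev0_integrable[OF sobolev0_square[OF u]])
    then have "integrable lborel (\<lambda>t. Re (complex_of_real (2 * Re (h t * cnj (u t)))))"
      by (rule Bochner_Integration.integrable_Re)
    then have "integrable lborel (\<lambda>t. 2 * Re (h t * cnj (u t)))" by (simp only: Re_complex_of_real)
    then show "integrable lborel (\<lambda>t. b * (2 * Re (h t * cnj (u t))))" by (rule integrable_mult_right)
    show "integrable lborel (\<lambda>t. d * (p t * (2 * Re (h t * cnj (u t)))))"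
      by (rule integrable_mult_right) (rule integrable_weight_form[OF p u])
  qed
  also have "(LINT t|lborel. b * (2 * Re (h t * cnj (u t)))) = b * (LINT t|lborel. 2 * Re (h t * cnj (u t)))"
    by (rule integral_mult_right_zero)
  also have "\<dots> = 0" unfolding integral_deriv_square_eq_0[OF u] by simp
  also have "(LINT t|lborel. d * (p t * (2 * Re (h t * cnj (u t))))) = d * weight_form p u h"
    unfolding weight_form_def by (rule integral_mult_right_zero)
  also have "0 + d * weight_form p u h = d * weight_form p u h" by simp
  finally show ?thesis .
qed

subsection \<open>Self-similar weights\<close>

text \<open>The exceptional set is first enlarged to a Borel null set, whose affine preimages are
  again null sets.\<close>

lemma AE_lborel_affine:
  fixes Q :: "real \<Rightarrow> bool"
  assumes "AE x in lborel. Q x" "a > 0"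
  shows "AE x in lborel. Q ((x - \<alpha>) / a)"
proof -
  obtain A where A: "{x \<in> space lborel. \<not> Q x} \<subseteq> A" "emeasure lborel A = 0" "A \<in> sets lborel"
    using assms(1) by (rule AE_E)
  have "AE x in lborel. x \<notin> A" using A by (intro AE_not_in) auto
  then have "AE x in lborel. - \<alpha> / a + (1 / a) * x \<notin> A"
    using A(3) assms(2) by (intro AE_borel_affine) auto
  then show ?thesis
    by eventually_elim (use A(1) in \<open>auto simp: diff_divide_distrib\<close>)
qed

locale self_similar_weight =
  fixes N :: nat and a d \<beta> :: "nat \<Rightarrow> real" and P p :: "real \<Rightarrow> real"
  assumes params: "selfsim_params N a d"
    and selfsim: "self_similar N a d \<beta> P"
    and rep: "L2_rep P p"
begin

abbreviation "\<alpha> \<equiv> breakpoint a"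

lemma a_pos: "k \<in> {1..N} \<Longrightarrow> a k > 0"
  using params unfolding selfsim_params_def by blast

lemma breakpoint_Suc: "1 \<le> k \<Longrightarrow> \<alpha> (Suc k) = \<alpha> k + a k"
  unfolding breakpoint_def by simp

lemma breakpoint_first: "\<alpha> 1 = 0"
  unfolding breakpoint_def by simp

lemma breakpoint_last: "\<alpha> (Suc N) = 1"
  using params unfolding breakpoint_def selfsim_params_def by (simp add: atLeastLessThanSuc_atLeastAtMost)

lemma breakpoint_le:
  assumes "1 \<le> i" "i \<le> j" "j \<le> Suc N"
  shows "\<alpha> i \<le> \<alpha> j"
  unfolding breakpoint_def using assms
  by (intro sum_mono2) (auto intro!: less_imp_le[OF a_pos])

lemma breakpoint_less:
  assumes "1 \<le> i" "i < j" "j \<le> Suc N"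
  shows "\<alpha> i + a i \<le> \<alpha> j"
  using breakpoint_le[of "Suc i" j] breakpoint_Suc[of i] assms by simp

lemma breakpoint_bounds:
  assumes "k \<in> {1..N}"
  shows "0 \<le> \<alpha> k" "\<alpha> k + a k \<le> 1"
  using breakpoint_le[of 1 k] breakpoint_less[of k "Suc N"] breakpoint_first breakpoint_last assms by auto

lemma weight_selfsim:
  assumes k: "k \<in> {1..N}"
  shows "AE x in lborel. x \<in> {\<alpha> k<..<\<alpha> k + a k} \<longrightarrow> p x = \<beta> k + d k * p ((x - \<alpha> k) / a k)"
proof -
  have "AE x in lborel. x \<in> {\<alpha> k<..<\<alpha> (k + 1)} \<longrightarrow> P x = \<beta> k + d k * P ((x - \<alpha> k) / a k)"
    using selfsim k unfolding self_similar_def AE_completion_iff by blast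
  moreover have Pp: "AE x in lborel. x \<in> {0..1} \<longrightarrow> P x = p x"
    using rep unfolding L2_rep_def by blast
  moreover have "AE x in lborel. (x - \<alpha> k) / a k \<in> {0..1} \<longrightarrow> P ((x - \<alpha> k) / a k) = p ((x - \<alpha> k) / a k)"
    using AE_lborel_affine[OF Pp a_pos[OF k]] .
  ultimately show ?thesis
  proof eventually_elim
    case (elim x)
    show ?case
    proof
      assume x: "x \<in> {\<alpha> k<..<\<alpha> k + a k}"
      then have "x \<in> {0..1}" using breakpoint_bounds[OF k] by auto
      moreover have "(x - \<alpha> k) / a k \<in> {0..1}" using x a_pos[OF k] by (auto simp: field_simps)
      ultimately show "p x = \<beta> k + d k * p ((x - \<alpha> k) / a k)"
        using elim x breakpoint_Suc[of k] k by simp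
    qed
  qed
qed

text \<open>Neighbouring closed cells overlap in a breakpoint, so these finitely many points are
  excluded.\<close>

lemma partition_AE:
  "AE x in lborel. (\<Sum>k=1..N. indicator {\<alpha> k..\<alpha> k + a k} x) = (indicator {0..1} x :: real)"
proof -
  have ind: "(\<Sum>k=1..n. indicator {\<alpha> k..\<alpha> k + a k} x) = (indicator {0..\<alpha> (Suc n)} x :: real)"
    if "n \<le> N" "x \<notin> \<alpha> ` {1..Suc N}" for n x
    using that(1)
  proof (induction n)
    case 0
    have "x \<noteq> 0" using that(2) breakpoint_first by force
    then show ?case using breakpoint_first by (simp add: indicator_def)
  next
    case (Suc n)
    have "x \<noteq> \<alpha> (Suc n)" using that(2) Suc.prems by auto
    moreover have "0 \<le> \<alpha> (Suc n)" "0 < a (Suc n)"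
      using breakpoint_bounds[of "Suc n"] a_pos[of "Suc n"] Suc.prems by auto
    ultimately show ?case using Suc breakpoint_Suc[of "Suc n"]
      by (auto simp: indicator_def)
  qed
  have "AE x in lborel. x \<notin> \<alpha> ` {1..Suc N}"
    by (intro AE_not_in finite_imp_null_set_lborel) simp
  then show ?thesis by eventually_elim (use ind[of N] breakpoint_last in simp)
qed

lemma integral_partition:
  fixes F :: "real \<Rightarrow> real"
  assumes F: "integrable lborel F" and "\<And>x. x \<notin> {0..1} \<Longrightarrow> F x = 0"
  shows "(LINT x|lborel. F x) = (\<Sum>k=1..N. LINT x|lborel. indicator {\<alpha> k..\<alpha> k + a k} x * F x)"
proof -
  have int: "integrable lborel (\<lambda>x. indicator {\<alpha> k..\<alpha> k + a k} x * F x)" for k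
    using integrable_mult_indicator[OF _ F, of "{\<alpha> k..\<alpha> k + a k}"] by simp
  have [measurable]: "F \<in> borel_measurable borel" using F by simp
  have "(LINT x|lborel. F x) = (LINT x|lborel. (\<Sum>k=1..N. indicator {\<alpha> k..\<alpha> k + a k} x * F x))"
  proof (rule integral_cong_AE)
    show "AE x in lborel. F x = (\<Sum>k=1..N. indicator {\<alpha> k..\<alpha> k + a k} x * F x)"
      using partition_AE
      by eventually_elim (use assms(2) in \<open>auto simp: sum_distrib_right[symmetric] indicator_def\<close>)
  qed measurable
  also have "\<dots> = (\<Sum>k=1..N. LINT x|lborel. indicator {\<alpha> k..\<alpha> k + a k} x * F x)"
    by (rule Bochner_Integration.integral_sum) (rule int)
  finally show ?thesis .
qed

text \<open>Inverse to \<open>transplant\<close> on cell \<open>k\<close>. The explicit cutoff keeps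
  values from neighbouring cells out; \<open>transplant\<close> has none because elements of the
  space already vanish outside [0,1].\<close>

definition restr :: "nat \<Rightarrow> (real \<Rightarrow> complex) \<Rightarrow> real \<Rightarrow> complex" where
  "restr k y = (\<lambda>t. if t \<in> {0..1} then y (\<alpha> k + a k * t) else 0)"

definition transplant :: "nat \<Rightarrow> (real \<Rightarrow> complex) \<Rightarrow> real \<Rightarrow> complex" where
  "transplant k u = (\<lambda>x. u ((x - \<alpha> k) / a k))"

definition quad :: "real \<Rightarrow> (real \<Rightarrow> complex) \<Rightarrow> real" where
  "quad lam y = Re (pencil P lam y y)"

lemma quad_eq: "sobolev0 y g \<Longrightarrow> quad lam y = energy g + lam * weight_form p y g"
  unfolding quad_def using pencil_self[OF rep] by simp

lemma pencil_quad: "y \<in> W21_0 \<Longrightarrow> pencil P lam y y = of_real (quad lam y)"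
  using W21_0_sobolev0 pencil_self[OF rep] quad_eq by metis

lemma transplant_mem:
  assumes "k \<in> {1..N}" "u \<in> W21_0"
  shows "transplant k u \<in> W21_0"
proof -
  obtain h where "sobolev0 u h" using W21_0_sobolev0 assms by blast
  from sobolev0_stretch[OF this a_pos breakpoint_bounds, OF assms(1,1,1)]
  show ?thesis unfolding transplant_def by (rule sobolev0_W21_0)
qed

context
  fixes y :: "real \<Rightarrow> complex" and g
  assumes y: "sobolev0 y g" and zero: "\<And>k. k \<in> {1..N} \<Longrightarrow> y (\<alpha> k) = 0"
begin

lemma zero_right: "k \<in> {1..N} \<Longrightarrow> y (\<alpha> k + a k) = 0"
  using zero[of "Suc k"] breakpoint_Suc[of k] breakpoint_last sobolev0_outside[OF y, of 1]
  by (cases "k = N") auto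

lemma sobolev0_restr:
  assumes k: "k \<in> {1..N}"
  shows "sobolev0 (restr k y) (\<lambda>t. of_real (a k) * (indicator {\<alpha> k..\<alpha> k + a k} (\<alpha> k + a k * t) *\<^sub>R g (\<alpha> k + a k * t)))"
proof -
  have "\<alpha> k \<le> \<alpha> k + a k" using a_pos[OF k] by simp
  from sobolev0_compress[OF sobolev0_localize[OF y zero[OF k] zero_right[OF k] this] a_pos[OF k], of "\<alpha> k"]
  have "sobolev0 (\<lambda>t. indicator {\<alpha> k..\<alpha> k + a k} (\<alpha> k + a k * t) *\<^sub>R y (\<alpha> k + a k * t))
    (\<lambda>t. of_real (a k) * (indicator {\<alpha> k..\<alpha> k + a k} (\<alpha> k + a k * t) *\<^sub>R g (\<alpha> k + a k * t)))" by simp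
  moreover have "(\<lambda>t. indicator {\<alpha> k..\<alpha> k + a k} (\<alpha> k + a k * t) *\<^sub>R y (\<alpha> k + a k * t)) = restr k y"
    using a_pos[OF k] unfolding restr_def
    by (auto simp: fun_eq_iff indicator_def zero_le_mult_iff mult_le_cancel_left1)
  ultimately show ?thesis by simp
qed

text \<open>Stretching to cell \<open>k\<close> divides the energy by \<open>a k\<close> and
  multiplies the weight term by \<open>d k\<close>; factoring out \<open>1 / a k\<close> leaves the
  form with parameter \<open>a k * d k * lam\<close>.\<close>

lemma quad_split: "quad lam y = (\<Sum>k=1..N. quad (a k * d k * lam) (restr k y) / a k)"
proof -
  let ?I = "\<lambda>k. {\<alpha> k..\<alpha> k + a k}"
  let ?h = "\<lambda>k t. of_real (a k) * (indicator (?I k) (\<alpha> k + a k * t) *\<^sub>R g (\<alpha> k + a k * t))"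
  have stretch: "?h k ((x - \<alpha> k) / a k) / of_real (a k) = indicator (?I k) x *\<^sub>R g x"
    "restr k y ((x - \<alpha> k) / a k) = indicator (?I k) x *\<^sub>R y x" if "k \<in> {1..N}" for k x
    using a_pos[OF that] unfolding restr_def by (auto simp: indicator_def field_simps)
  have "energy g = (\<Sum>k=1..N. LINT x|lborel. indicator (?I k) x * (cmod (g x))\<^sup>2)"
    unfolding energy_def
    by (rule integral_partition[OF sobolev0_square_integrable[OF y]]) (use sobolev0_deriv_outside[OF y] in auto)
  also have "\<dots> = (\<Sum>k=1..N. energy (?h k) / a k)"
  proof (rule sum.cong[OF refl])
    fix k assume k: "k \<in> {1..N}"
    have "energy (?h k) / a k = energy (\<lambda>x. indicator (?I k) x *\<^sub>R g x)"
      using energy_stretch[OF a_pos[OF k], of "?h k" "\<alpha> k"] unfolding stretch(1)[OF k] by simp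
    also have "\<dots> = (LINT x|lborel. indicator (?I k) x * (cmod (g x))\<^sup>2)"
      unfolding energy_def by (rule Bochner_Integration.integral_cong) (auto simp: indicator_def)
    finally show "(LINT x|lborel. indicator (?I k) x * (cmod (g x))\<^sup>2) = energy (?h k) / a k" ..
  qed
  finally have e: "energy g = (\<Sum>k=1..N. energy (?h k) / a k)" .
  have "weight_form p y g = (\<Sum>k=1..N. LINT x|lborel. indicator (?I k) x * (p x * (2 * Re (g x * cnj (y x)))))"
    unfolding weight_form_def
    by (rule integral_partition[OF integrable_weight_form[OF rep y]]) (use sobolev0_deriv_outside[OF y] in auto)
  also have "\<dots> = (\<Sum>k=1..N. d k * weight_form p (restr k y) (?h k))"
  proof (rule sum.cong[OF refl])
    fix k assume k: "k \<in> {1..N}"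
    have "d k * weight_form p (restr k y) (?h k) =
        weight_form p (\<lambda>x. indicator (?I k) x *\<^sub>R y x) (\<lambda>x. indicator (?I k) x *\<^sub>R g x)"
      using weight_form_stretch[OF rep sobolev0_restr[OF k] a_pos[OF k] weight_selfsim[OF k]]
      unfolding stretch[OF k] by simp
    also have "\<dots> = (LINT x|lborel. indicator (?I k) x * (p x * (2 * Re (g x * cnj (y x)))))"
      unfolding weight_form_def by (rule Bochner_Integration.integral_cong) (auto simp: indicator_def)
    finally show "(LINT x|lborel. indicator (?I k) x * (p x * (2 * Re (g x * cnj (y x))))) =
        d k * weight_form p (restr k y) (?h k)" ..
  qed
  finally have w: "weight_form p y g = (\<Sum>k=1..N. d k * weight_form p (restr k y) (?h k))" .
  have "quad lam y = (\<Sum>k=1..N. energy (?h k) / a k + lam * (d k * weight_form p (restr k y) (?h k)))"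
    unfolding quad_eq[OF y] e w by (simp add: sum.distrib sum_distrib_left)
  also have "\<dots> = (\<Sum>k=1..N. quad (a k * d k * lam) (restr k y) / a k)"
  proof (rule sum.cong[OF refl])
    fix k assume k: "k \<in> {1..N}"
    show "energy (?h k) / a k + lam * (d k * weight_form p (restr k y) (?h k)) =
        quad (a k * d k * lam) (restr k y) / a k"
      unfolding quad_eq[OF sobolev0_restr[OF k]] using a_pos[OF k] by (simp add: field_simps)
  qed
  finally show ?thesis .
qed

end

lemma transplant_outside:
  assumes k: "k \<in> {1..N}" and u: "u \<in> W21_0" and x: "x \<notin> {\<alpha> k<..<\<alpha> k + a k}"
  shows "transplant k u x = 0"
proof -
  obtain h where h: "sobolev0 u h" using W21_0_sobolev0 u by blast
  have "(x - \<alpha> k) / a k \<notin> {0<..<1}" using x a_pos[OF k] by (auto simp: field_simps)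
  then show ?thesis unfolding transplant_def by (rule sobolev0_outside[OF h])
qed

lemma interval_disjoint:
  assumes "j \<in> {1..N}" "k \<in> {1..N}" "j \<noteq> k" "x \<in> {\<alpha> k..\<alpha> k + a k}"
  shows "x \<notin> {\<alpha> j<..<\<alpha> j + a j}"
  using breakpoint_less[of j k] breakpoint_less[of k j] assms by (cases "j < k") auto

lemma transplant_breakpoint:
  assumes "j \<in> {1..N}" "k \<in> {1..N}" "u \<in> W21_0"
  shows "transplant j u (\<alpha> k) = 0"
  using transplant_outside[OF assms(1,3), of "\<alpha> k"] interval_disjoint[OF assms(1,2), of "\<alpha> k"] a_pos[OF assms(2)]
  by (cases "j = k") auto

lemma restr_transplant_sum:
  assumes u: "\<And>j. j \<in> {1..N} \<Longrightarrow> u j \<in> W21_0" and k: "k \<in> {1..N}"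
  shows "restr k (\<lambda>x. \<Sum>j=1..N. transplant j (u j) x) = u k"
proof
  fix t
  show "restr k (\<lambda>x. \<Sum>j=1..N. transplant j (u j) x) t = u k t"
  proof (cases "t \<in> {0..1}")
    case True
    then have x: "\<alpha> k + a k * t \<in> {\<alpha> k..\<alpha> k + a k}"
      using a_pos[OF k] by (auto simp: mult_le_cancel_left1)
    have "(\<Sum>j=1..N. transplant j (u j) (\<alpha> k + a k * t)) = (\<Sum>j=1..N. if j = k then transplant k (u k) (\<alpha> k + a k * t) else 0)"
    proof (rule sum.cong[OF refl])
      fix j assume j: "j \<in> {1..N}"
      show "transplant j (u j) (\<alpha> k + a k * t) = (if j = k then transplant k (u k) (\<alpha> k + a k * t) else 0)"
        using transplant_outside[OF j u[OF j] interval_disjoint[OF j k _ x]] by simp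
    qed
    also have "\<dots> = u k t" using k a_pos[OF k] by (simp add: transplant_def)
    finally show ?thesis using True unfolding restr_def by simp
  next
    case False
    obtain h where h: "sobolev0 (u k) h" using W21_0_sobolev0 u[OF k] by blast
    have "u k t = 0" by (rule sobolev0_outside[OF h]) (use False in auto)
    then show ?thesis using False unfolding restr_def by auto
  qed
qed

text \<open>\<open>A\<close> bounds |y|, so the weight term is at most the integral of
  \<open>2 * (A * \<bar>p x\<bar>) * cmod (g x)\<close>. The arithmetic-geometric inequality splits
  this into the energy and \<open>A\<^sup>2\<close> times the squared norm of \<open>p\<close>, and
  \<open>A\<^sup>2\<close> is at most the energy. This is the base case for finiteness of the
  index.\<close>

lemma quad_nonneg_small:
  assumes y: "y \<in> W21_0" and lam: "\<bar>lam\<bar> * (1 + (LINT x|lborel. (p x)\<^sup>2)) \<le> 1"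
  shows "quad lam y \<ge> 0"
proof -
  obtain g where g: "sobolev0 y g" using W21_0_sobolev0 y by blast
  note [measurable] = sobolev0_measurable[OF g] L2_rep_measurable[OF rep]
  define A where "A = (LINT t|lborel. cmod (g t))"
  have A: "\<And>x. cmod (y x) \<le> A" "A\<^sup>2 \<le> energy g"
    unfolding A_def energy_def using sobolev0_bound[OF g] sobolev0_bound_energy[OF g] by auto
  have A0: "0 \<le> A" using A(1)[of 0] norm_ge_zero order_trans by blast
  have p2: "integrable lborel (\<lambda>x. (p x)\<^sup>2)" using rep unfolding L2_rep_def by simp
  have "\<bar>weight_form p y g\<bar> \<le> (LINT x|lborel. \<bar>p x * (2 * Re (g x * cnj (y x)))\<bar>)"
    unfolding weight_form_def by (rule integral_abs_bound)
  also have "\<dots> \<le> (LINT x|lborel. A\<^sup>2 * (p x)\<^sup>2 + (cmod (g x))\<^sup>2)"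
  proof (rule integral_mono)
    show "integrable lborel (\<lambda>x. \<bar>p x * (2 * Re (g x * cnj (y x)))\<bar>)"
      using integrable_weight_form[OF rep g] by (rule integrable_abs)
    show "integrable lborel (\<lambda>x. A\<^sup>2 * (p x)\<^sup>2 + (cmod (g x))\<^sup>2)"
      using p2 sobolev0_square_integrable[OF g] by simp
    fix x
    have "\<bar>Re (g x * cnj (y x))\<bar> \<le> cmod (g x) * A"
      using abs_Re_le_cmod[of "g x * cnj (y x)"] A(1)[of x]
      by (simp add: norm_mult) (meson mult_left_mono norm_ge_zero order_trans)
    then have "\<bar>p x\<bar> * (2 * \<bar>Re (g x * cnj (y x))\<bar>) \<le> \<bar>p x\<bar> * (2 * (cmod (g x) * A))"
      by (intro mult_left_mono) auto
    also have "\<dots> = 2 * (A * \<bar>p x\<bar>) * cmod (g x)" by simp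
    also have "\<dots> \<le> (A * \<bar>p x\<bar>)\<^sup>2 + (cmod (g x))\<^sup>2" by (rule sum_squares_bound)
    finally show "\<bar>p x * (2 * Re (g x * cnj (y x)))\<bar> \<le> A\<^sup>2 * (p x)\<^sup>2 + (cmod (g x))\<^sup>2"
      by (simp add: abs_mult power_mult_distrib del: times_complex.sel)
  qed
  also have "\<dots> = A\<^sup>2 * (LINT x|lborel. (p x)\<^sup>2) + energy g"
    unfolding energy_def using p2 sobolev0_square_integrable[OF g] by simp
  also have "\<dots> \<le> energy g * (LINT x|lborel. (p x)\<^sup>2) + energy g"
    using A(2) by (intro add_right_mono mult_right_mono) auto
  finally have w: "\<bar>weight_form p y g\<bar> \<le> energy g * (1 + (LINT x|lborel. (p x)\<^sup>2))"
    by (simp add: algebra_simps)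
  have e: "0 \<le> energy g" unfolding energy_def by simp
  have "\<bar>lam * weight_form p y g\<bar> \<le> \<bar>lam\<bar> * (energy g * (1 + (LINT x|lborel. (p x)\<^sup>2)))"
    unfolding abs_mult using w by (rule mult_left_mono) simp
  also have "\<dots> = energy g * (\<bar>lam\<bar> * (1 + (LINT x|lborel. (p x)\<^sup>2)))" by simp
  also have "\<dots> \<le> energy g * 1" using lam e by (rule mult_left_mono)
  finally show ?thesis unfolding quad_eq[OF g] by linarith
qed

end

subsection \<open>Index inequalities\<close>

text \<open>Functionals pulled back from a cell are known to be linear only on functions vanishing
  at the breakpoints, while certificates need linearity on all of \<open>W21_0\<close>. A basis
  provides the extension.\<close>

lemma functional_extend:
  fixes l :: "(real \<Rightarrow> complex) \<Rightarrow> complex"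
  assumes S: "cfun.subspace S"
    and add: "\<And>y z. y \<in> S \<Longrightarrow> z \<in> S \<Longrightarrow> l (y + z) = l y + l z"
    and scale: "\<And>c y. y \<in> S \<Longrightarrow> l (\<lambda>x. c * y x) = c * l y"
  shows "\<exists>l'. (\<forall>y z. l' (y + z) = l' y + l' z) \<and> (\<forall>c y. l' (\<lambda>x. c * y x) = c * l' y) \<and> (\<forall>y\<in>S. l' y = l y)"
proof -
  interpret pair: vector_space_pair "\<lambda>(c::complex) (f::real \<Rightarrow> complex) x. c * f x" "(*) :: complex \<Rightarrow> complex \<Rightarrow> complex"
    by unfold_locales (simp_all add: distrib_left distrib_right)
  obtain B where B: "B \<subseteq> S" "cfun.independent B" "S \<subseteq> cfun.span B"
    using cfun.maximal_independent_subset[of S] by blast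
  obtain l' where l': "Vector_Spaces.linear (\<lambda>(c::complex) (f::real \<Rightarrow> complex) x. c * f x) (*) l'"
    "\<forall>b\<in>B. l' b = l b"
    using pair.linear_independent_extend[OF B(2)] by blast
  have lin: "l' (y + z) = l' y + l' z" "l' (\<lambda>x. c * y x) = c * l' y" for y z c
    using l'(1) unfolding Vector_Spaces.linear_iff by auto
  \<comment> \<open>Membership in \<open>S\<close> is carried through the induction because
    \<open>l\<close> is linear on \<open>S\<close> only.\<close>
  have "y \<in> S \<and> l' y = l y" if "y \<in> cfun.span B" for y
    using that
  proof (induction rule: cfun.span_induct_alt)
    case base
    have "l 0 = 0" using scale[of 0 0] cfun.subspace_0[OF S] by (simp add: zero_fun_def)
    moreover have "l' 0 = 0" using lin(2)[of 0 0] by (simp add: zero_fun_def)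
    ultimately show ?case using cfun.subspace_0[OF S] by metis
  next
    case (step c b y)
    then have "b \<in> S" "l' b = l b" using B(1) l'(2) by auto
    then have S': "(\<lambda>x. c * b x) \<in> S" "y \<in> S" using cfun.subspace_scale[OF S] step by blast+
    have "l' ((\<lambda>x. c * b x) + y) = c * l b + l y"
      using step \<open>l' b = l b\<close> by (simp only: lin)
    also have "\<dots> = l ((\<lambda>x. c * b x) + y)"
      using add[OF S'] scale[OF \<open>b \<in> S\<close>] by (simp only:)
    finally show ?case using cfun.subspace_add[OF S S'] by blast
  qed
  then show ?thesis using B(3) lin by blast
qed

context self_similar_weight
begin

lemma form: "hermitian_form W21_0 (pencil P lam)"
  by unfold_locales
    (use subspace_W21_0 pencil_add[OF rep] pencil_scale[OF rep] pencil_hermitian[OF rep] in blast)+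

abbreviation "functional \<equiv> hermitian_form.functional W21_0"
abbreviation "negset lam \<equiv> hermitian_form.negative_set W21_0 (pencil P lam)"
abbreviation "kerset lam \<equiv> hermitian_form.nonneg_on_kernel W21_0 (pencil P lam)"

lemma negset_iff:
  "negset lam B \<longleftrightarrow> finite B \<and> B \<subseteq> W21_0 \<and> (\<forall>c. (\<exists>b\<in>B. c b \<noteq> 0) \<longrightarrow> quad lam (lincomb B c) < 0)"
  unfolding hermitian_form.negative_set_def[OF form]
  using pencil_quad[of _ lam] hermitian_form.lincomb_mem[OF form]
  by (auto simp: less_complex_def)

lemma kerset_iff:
  "kerset lam L \<longleftrightarrow> finite L \<and> (\<forall>l\<in>L. functional l) \<and> (\<forall>y\<in>W21_0. (\<forall>l\<in>L. l y = 0) \<longrightarrow> 0 \<le> quad lam y)"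
  unfolding hermitian_form.nonneg_on_kernel_def[OF form] using pencil_quad[of _ lam]
  by (auto simp: less_complex_def not_less)

lemma quad_scale:
  assumes "y \<in> W21_0"
  shows "quad lam (\<lambda>x. c * y x) = (cmod c)\<^sup>2 * quad lam y"
  using hermitian_form.form_scale_self[OF form assms, of lam c] unfolding quad_def by simp

lemma quad_0: "quad lam 0 = 0"
  using hermitian_form.form_zero[OF form, of lam] unfolding quad_def by simp

definition pinned :: "(real \<Rightarrow> complex) set" where
  "pinned = {y \<in> W21_0. \<forall>k\<in>{1..N}. y (\<alpha> k) = 0}"

lemma subspace_pinned: "cfun.subspace pinned"
proof (rule cfun.subspaceI)
  show "0 \<in> pinned" using cfun.subspace_0[OF subspace_W21_0] unfolding pinned_def by simp
qed (use cfun.subspace_add[OF subspace_W21_0] cfun.subspace_scale[OF subspace_W21_0] in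
    \<open>auto simp: pinned_def\<close>)

lemma restr_mem: "y \<in> pinned \<Longrightarrow> k \<in> {1..N} \<Longrightarrow> restr k y \<in> W21_0"
  using W21_0_sobolev0 sobolev0_restr sobolev0_W21_0 unfolding pinned_def by blast

lemma restr_add: "restr k (y + z) = restr k y + restr k z"
  unfolding restr_def by (auto simp: fun_eq_iff)

lemma restr_scale: "restr k (\<lambda>x. c * y x) = (\<lambda>x. c * restr k y x)"
  unfolding restr_def by (auto simp: fun_eq_iff)

lemma quad_split_pinned:
  "y \<in> pinned \<Longrightarrow> quad lam y = (\<Sum>k=1..N. quad (a k * d k * lam) (restr k y) / a k)"
  using W21_0_sobolev0 quad_split unfolding pinned_def by blast

lemma restr_functional_extend:
  assumes "functional l" "k \<in> {1..N}"
  shows "\<exists>l'. functional l' \<and> (\<forall>y\<in>pinned. l' y = l (restr k y))"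
proof -
  have l: "\<And>y z. y \<in> W21_0 \<Longrightarrow> z \<in> W21_0 \<Longrightarrow> l (y + z) = l y + l z"
    "\<And>c y. y \<in> W21_0 \<Longrightarrow> l (\<lambda>x. c * y x) = c * l y"
    using assms(1) unfolding hermitian_form.functional_def[OF form] by auto
  have "\<exists>l'. (\<forall>y z. l' (y + z) = l' y + l' z) \<and> (\<forall>c y. l' (\<lambda>x. c * y x) = c * l' y) \<and>
      (\<forall>y\<in>pinned. l' y = l (restr k y))"
    by (rule functional_extend[OF subspace_pinned])
      (simp_all add: restr_add restr_scale l restr_mem[OF _ assms(2)])
  then show ?thesis unfolding hermitian_form.functional_def[OF form] by blast
qed

text \<open>Evaluations at the breakpoints force \<open>y\<close> into \<open>pinned\<close>; the
  extended functionals then make every summand of the split form nonnegative.\<close>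

lemma kerset_combine:
  assumes L: "\<And>k. k \<in> {1..N} \<Longrightarrow> kerset (a k * d k * lam) (L k)"
  shows "\<exists>L'. kerset lam L' \<and> card L' \<le> (\<Sum>k=1..N. card (L k)) + (N - 1)"
proof -
  have L': "finite (L k)" "\<And>l. l \<in> L k \<Longrightarrow> functional l"
    "\<And>y. y \<in> W21_0 \<Longrightarrow> (\<And>l. l \<in> L k \<Longrightarrow> l y = 0) \<Longrightarrow> 0 \<le> quad (a k * d k * lam) y"
    if "k \<in> {1..N}" for k
    using L[OF that] unfolding kerset_iff by blast+
  have "\<exists>E. \<forall>l\<in>L k. functional (E l) \<and> (\<forall>y\<in>pinned. E l y = l (restr k y))" if k: "k \<in> {1..N}" for k
    using restr_functional_extend[OF L'(2)[OF k] k] by (intro bchoice) blast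
  then obtain E where E: "\<And>k l. k \<in> {1..N} \<Longrightarrow> l \<in> L k \<Longrightarrow> functional (E k l)"
    "\<And>k l y. k \<in> {1..N} \<Longrightarrow> l \<in> L k \<Longrightarrow> y \<in> pinned \<Longrightarrow> E k l y = l (restr k y)" by metis
  \<comment> \<open>The first breakpoint is the endpoint 0, where \<open>y\<close> vanishes anyway;
    starting at 2 gives the count \<open>N - 1\<close>.\<close>
  define V where "V = (\<lambda>k y. y (\<alpha> k) :: complex) ` {2..N}"
  define M where "M = (\<Union>k\<in>{1..N}. E k ` L k)"
  have fin: "finite V" "finite M" unfolding V_def M_def using L'(1) by auto
  have "kerset lam (V \<union> M)"
    unfolding kerset_iff
  proof (intro conjI ballI impI)
    show "finite (V \<union> M)" using fin by simp
    show "functional l" if "l \<in> V \<union> M" for l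
      using that E(1) unfolding V_def M_def by (auto simp: hermitian_form.functional_def[OF form])
    fix y assume y: "y \<in> W21_0" and ker: "\<forall>l\<in>V \<union> M. l y = 0"
    obtain g where g: "sobolev0 y g" using W21_0_sobolev0 y by blast
    have "y (\<alpha> k) = 0" if "k \<in> {1..N}" for k
    proof (cases "k = 1")
      case True
      then show ?thesis using breakpoint_first sobolev0_outside[OF g, of 0] by simp
    next
      case False
      then show ?thesis using ker that unfolding V_def by auto
    qed
    then have pin: "y \<in> pinned" using y unfolding pinned_def by blast
    show "0 \<le> quad lam y"
      unfolding quad_split_pinned[OF pin]
    proof (intro sum_nonneg divide_nonneg_pos)
      fix k assume k: "k \<in> {1..N}"
      show "0 < a k" using a_pos[OF k] .
      show "0 \<le> quad (a k * d k * lam) (restr k y)"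
      proof (rule L'(3)[OF k restr_mem[OF pin k]])
        fix l assume l: "l \<in> L k"
        then have "E k l \<in> M" using k unfolding M_def by blast
        then have "E k l y = 0" using ker by blast
        then show "l (restr k y) = 0" unfolding E(2)[OF k l pin] .
      qed
    qed
  qed
  moreover have "card (V \<union> M) \<le> (\<Sum>k=1..N. card (L k)) + (N - 1)"
  proof -
    have "card V \<le> card {2..N}" unfolding V_def by (rule card_image_le) simp
    moreover have "card M \<le> (\<Sum>k=1..N. card (E k ` L k))" unfolding M_def by (rule card_UN_le) simp
    moreover have "\<dots> \<le> (\<Sum>k=1..N. card (L k))"
      by (intro sum_mono card_image_le L'(1))
    ultimately show ?thesis using card_Un_le[of V M] by simp
  qed
  ultimately show ?thesis by blast
qed

lemma transplant_sum_pinned: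
  assumes "\<And>k. k \<in> {1..N} \<Longrightarrow> u k \<in> W21_0"
  shows "(\<lambda>x. \<Sum>k=1..N. transplant k (u k) x) \<in> pinned"
proof -
  have "(\<lambda>x. \<Sum>k=1..N. transplant k (u k) x) = (\<Sum>k=1..N. transplant k (u k))"
    by (induction N) (auto simp: fun_eq_iff)
  moreover have "(\<Sum>k=1..N. transplant k (u k)) \<in> W21_0"
    by (intro cfun.subspace_sum[OF subspace_W21_0] transplant_mem assms)
  moreover have "(\<Sum>j=1..N. transplant j (u j) (\<alpha> k)) = 0" if "k \<in> {1..N}" for k
    by (intro sum.neutral ballI transplant_breakpoint assms that)
  ultimately show ?thesis
    unfolding pinned_def mem_Collect_eq by (intro conjI ballI) (simp_all only:)
qed

lemma restr_transplant:
  assumes "k \<in> {1..N}" "j \<in> {1..N}" "u \<in> W21_0"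
  shows "restr k (transplant j u) = (if j = k then u else 0)"
proof -
  define v where "v i = (if i = j then u else 0)" for i
  have v: "v i \<in> W21_0" for i
    using assms(3) cfun.subspace_0[OF subspace_W21_0] unfolding v_def by simp
  have "(\<lambda>x. \<Sum>i=1..N. transplant i (v i) x) = transplant j u"
  proof
    fix x
    have "(\<Sum>i=1..N. transplant i (v i) x) = (\<Sum>i=1..N. if i = j then transplant j u x else 0)"
      by (rule sum.cong) (auto simp: v_def transplant_def)
    then show "(\<Sum>i=1..N. transplant i (v i) x) = transplant j u x" using assms(2) by simp
  qed
  then show ?thesis using restr_transplant_sum[of v, OF v assms(1)] unfolding v_def by auto
qed

text \<open>Transplanted functions occupy different cells, so the form of a combination is a sum
  over the cells, with no positive term and at least one negative term.\<close>

lemma negset_combine: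
  assumes B: "\<And>k. k \<in> {1..N} \<Longrightarrow> negset (a k * d k * lam) (B k)"
  shows "\<exists>B'. negset lam B' \<and> card B' = (\<Sum>k=1..N. card (B k))"
proof -
  have B': "finite (B k)" "B k \<subseteq> W21_0"
    "\<And>c. \<exists>b\<in>B k. c b \<noteq> 0 \<Longrightarrow> quad (a k * d k * lam) (lincomb (B k) c) < 0"
    if "k \<in> {1..N}" for k
    using B[OF that] unfolding negset_iff by blast+
  \<comment> \<open>A common member of two transplanted sets would restrict to 0 on its cell, so
    excluding 0 keeps the images disjoint and the cardinalities additive.\<close>
  have zero: "0 \<notin> B k" if k: "k \<in> {1..N}" for k
  proof
    assume "0 \<in> B k"
    then have "quad (a k * d k * lam) (lincomb (B k) (\<lambda>b. if b = 0 then 1 else 0)) < 0"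
      by (intro B'(3)[OF k]) auto
    moreover have "lincomb (B k) (\<lambda>b. if b = 0 then 1 else 0) = 0"
      by (auto simp: fun_eq_iff lincomb_apply intro!: sum.neutral)
    ultimately show False using quad_0 by simp
  qed
  have inj: "inj_on (transplant k) (B k)" if k: "k \<in> {1..N}" for k
    by (rule inj_on_inverseI[of _ "restr k"]) (use restr_transplant[OF k k] B'(2)[OF k] in auto)
  define C where "C = (\<Union>k\<in>{1..N}. transplant k ` B k)"
  have disj: "transplant j ` B j \<inter> transplant k ` B k = {}"
    if jk: "j \<in> {1..N}" "k \<in> {1..N}" "j \<noteq> k" for j k
  proof (rule ccontr)
    assume "\<not> ?thesis"
    then obtain u v where uv: "u \<in> B j" "v \<in> B k" "transplant j u = transplant k v" by blast
    have "u \<in> W21_0" "v \<in> W21_0" using uv B'(2) jk by auto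
    then have "u = 0"
      using restr_transplant[OF jk(1,1), of u] restr_transplant[OF jk(1,2), of v] uv(3) jk(3) by simp
    then show False using uv zero[OF jk(1)] by simp
  qed
  have "card C = (\<Sum>k=1..N. card (transplant k ` B k))"
    unfolding C_def using B'(1) disj by (intro card_UN_disjoint) auto
  also have "\<dots> = (\<Sum>k=1..N. card (B k))"
    by (rule sum.cong) (auto simp: card_image inj)
  finally have card: "card C = (\<Sum>k=1..N. card (B k))" .
  have "quad lam (lincomb C c) < 0" if c: "\<exists>b\<in>C. c b \<noteq> 0" for c
  proof -
    define u where "u k = lincomb (B k) (\<lambda>b. c (transplant k b))" for k
    have u: "u k \<in> W21_0" if "k \<in> {1..N}" for k
      unfolding u_def using hermitian_form.lincomb_mem[OF form] B'(1,2) that by blast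
    have eq: "lincomb C c = (\<lambda>x. \<Sum>k=1..N. transplant k (u k) x)"
    proof
      fix x
      have "lincomb C c x = (\<Sum>k=1..N. \<Sum>b\<in>transplant k ` B k. c b * b x)"
        unfolding lincomb_apply C_def using B'(1) disj by (intro sum.UNION_disjoint) auto
      also have "\<dots> = (\<Sum>k=1..N. \<Sum>b\<in>B k. c (transplant k b) * transplant k b x)"
        by (rule sum.cong[OF refl]) (simp add: sum.reindex inj)
      also have "\<dots> = (\<Sum>k=1..N. transplant k (u k) x)"
        unfolding u_def transplant_def lincomb_apply ..
      finally show "lincomb C c x = (\<Sum>k=1..N. transplant k (u k) x)" .
    qed
    have quad: "quad lam (lincomb C c) = (\<Sum>k=1..N. quad (a k * d k * lam) (u k) / a k)"
    proof -
      have pin: "(\<lambda>x. \<Sum>k=1..N. transplant k (u k) x) \<in> pinned"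
        by (rule transplant_sum_pinned) (rule u)
      have "restr k (\<lambda>x. \<Sum>k=1..N. transplant k (u k) x) = u k" if "k \<in> {1..N}" for k
        using u that by (rule restr_transplant_sum)
      then show ?thesis
        unfolding eq quad_split_pinned[OF pin] by (intro sum.cong refl) (simp only:)
    qed
    have le: "quad (a k * d k * lam) (u k) / a k \<le> 0" if k: "k \<in> {1..N}" for k
    proof (cases "\<exists>b\<in>B k. c (transplant k b) \<noteq> 0")
      case True
      then have "quad (a k * d k * lam) (u k) < 0" unfolding u_def by (rule B'(3)[OF k])
      then show ?thesis using a_pos[OF k] by (simp add: divide_nonpos_pos)
    next
      case False
      then have "u k = 0" unfolding u_def by (auto simp: fun_eq_iff lincomb_apply intro!: sum.neutral)
      then show ?thesis using quad_0 by simp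
    qed
    obtain k b where k: "k \<in> {1..N}" "b \<in> B k" "c (transplant k b) \<noteq> 0"
      using c unfolding C_def by blast
    then have "quad (a k * d k * lam) (u k) < 0" unfolding u_def by (intro B'(3)) auto
    then have "quad (a k * d k * lam) (u k) / a k < 0" using a_pos[OF k(1)] by (simp add: divide_neg_pos)
    then have "(\<Sum>k=1..N. quad (a k * d k * lam) (u k) / a k) < (\<Sum>k=1..N. 0)"
      using k(1) le by (intro sum_strict_mono_ex1) auto
    then show ?thesis unfolding quad by simp
  qed
  then have "negset lam C"
    unfolding negset_iff C_def using B'(1,2) transplant_mem by blast
  then show ?thesis using card by blast
qed

section \<open>Finiteness, additivity and monotonicity of the index\<close>

text \<open>By \<open>a k \<le> 1\<close>, the square is at most one term of a sum that is below 1.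
  This makes the delays positive and drives iterated parameters to 0.\<close>

lemma contraction:
  assumes k: "k \<in> {1..N}"
  shows "a k * \<bar>d k\<bar> < 1"
proof -
  have "a k \<le> 1" using breakpoint_bounds[OF k] by simp
  have "a k * (d k)\<^sup>2 \<le> (\<Sum>k=1..N. a k * (d k)\<^sup>2)"
    by (rule member_le_sum[OF k]) (auto intro!: mult_nonneg_nonneg less_imp_le[OF a_pos])
  then have "a k * (d k)\<^sup>2 < 1" using params unfolding selfsim_params_def by simp
  have "(a k * \<bar>d k\<bar>)\<^sup>2 = a k * (a k * (d k)\<^sup>2)" by (simp add: power2_eq_square)
  also have "\<dots> \<le> 1 * (a k * (d k)\<^sup>2)"
    using \<open>a k \<le> 1\<close> a_pos[OF k] by (intro mult_right_mono) auto
  also have "\<dots> < 1" using \<open>a k * (d k)\<^sup>2 < 1\<close> by simp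
  finally have "(a k * \<bar>d k\<bar>)\<^sup>2 < 1" .
  then show ?thesis using power2_less_imp_less[of "a k * \<bar>d k\<bar>" 1] by simp
qed

text \<open>Each splitting shrinks all parameters at least by a factor \<open>c < 1\<close>, so
  after finitely many splittings the form is nonnegative on every piece and the empty certificate
  serves there.\<close>

lemma kerset_exists: "\<exists>L. kerset lam L"
proof -
  define m where "m = 1 + (LINT x|lborel. (p x)\<^sup>2)"
  have m: "m > 0" unfolding m_def by (simp add: add_pos_nonneg)
  define c where "c = Max ((\<lambda>k. a k * \<bar>d k\<bar>) ` {1..N})"
  have N: "{1..N} \<noteq> {}" using params unfolding selfsim_params_def by auto
  have c: "c < 1" "\<And>k. k \<in> {1..N} \<Longrightarrow> a k * \<bar>d k\<bar> \<le> c"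
    unfolding c_def using contraction N by auto
  have "0 \<le> c"
    using c(2)[of 1] a_pos[of 1] N by (auto intro: order_trans[rotated] mult_nonneg_nonneg less_imp_le)
  have step: "\<exists>L. kerset lam L" if "\<bar>lam\<bar> * c ^ n * m \<le> 1" for n lam
    using that
  proof (induction n arbitrary: lam)
    case 0
    then have "kerset lam {}" unfolding kerset_iff using quad_nonneg_small unfolding m_def by simp
    then show ?case ..
  next
    case (Suc n)
    have "\<exists>L. kerset (a k * d k * lam) L" if k: "k \<in> {1..N}" for k
    proof (rule Suc.IH)
      have "\<bar>a k * d k * lam\<bar> = (a k * \<bar>d k\<bar>) * \<bar>lam\<bar>" using a_pos[OF k] by (simp add: abs_mult)
      also have "\<dots> \<le> c * \<bar>lam\<bar>" using c(2)[OF k] by (intro mult_right_mono) auto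
      finally have "\<bar>a k * d k * lam\<bar> * (c ^ n * m) \<le> (c * \<bar>lam\<bar>) * (c ^ n * m)"
        using \<open>0 \<le> c\<close> m by (intro mult_right_mono) auto
      then show "\<bar>a k * d k * lam\<bar> * c ^ n * m \<le> 1" using Suc.prems by (simp add: mult_ac)
    qed
    then obtain L where "\<And>k. k \<in> {1..N} \<Longrightarrow> kerset (a k * d k * lam) (L k)" by metis
    from kerset_combine[OF this] show ?case by blast
  qed
  have "(\<lambda>n. (\<bar>lam\<bar> * m) * c ^ n) \<longlonglongrightarrow> (\<bar>lam\<bar> * m) * 0"
    by (intro tendsto_mult_left LIMSEQ_power_zero) (use c \<open>0 \<le> c\<close> in simp)
  then have "\<forall>\<^sub>F n in sequentially. (\<bar>lam\<bar> * m) * c ^ n < 1"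
    by (rule order_tendstoD) simp
  then obtain n where "(\<bar>lam\<bar> * m) * c ^ n < 1" by (auto simp: eventually_sequentially)
  then show ?thesis by (intro step[of lam n]) (simp add: mult_ac)
qed

text \<open>The arbitrary value for an infinite index is never met, as \<open>ind_witness\<close>
  shows.\<close>

definition ind :: "real \<Rightarrow> nat" where
  "ind lam = the_enat (negative_index (pencil P lam))"

lemma ind_witness:
  "\<exists>B L. negset lam B \<and> kerset lam L \<and> card B = ind lam \<and> card L = ind lam"
  "negative_index (pencil P lam) = enat (ind lam)"
proof -
  obtain L where "kerset lam L" using kerset_exists by blast
  then obtain B L' where BL: "negset lam B" "kerset lam L'" "card L' = card B"
    using hermitian_form.finite_index_witness[OF form] by blast
  have "negative_index (pencil P lam) = enat (card B)"
    unfolding negative_index_def using hermitian_form.index_eq[OF form BL] .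
  then show "\<exists>B L. negset lam B \<and> kerset lam L \<and> card B = ind lam \<and> card L = ind lam"
    "negative_index (pencil P lam) = enat (ind lam)"
    using BL unfolding ind_def by auto
qed

lemma card_negset_le:
  assumes "negset lam B"
  shows "card B \<le> ind lam"
proof -
  obtain L where "kerset lam L" "card L = ind lam" using ind_witness(1) by blast
  then show ?thesis using hermitian_form.card_negative_set_le[OF form assms] by force
qed

lemma ind_le_card_kerset:
  assumes "kerset lam L"
  shows "ind lam \<le> card L"
proof -
  obtain B where "negset lam B" "card B = ind lam" using ind_witness(1) by blast
  then show ?thesis using hermitian_form.card_negative_set_le[OF form _ assms] by force
qed

lemma ind_superadditive: "(\<Sum>k=1..N. ind (a k * d k * lam)) \<le> ind lam"
proof -
  obtain B where "\<And>k. negset (a k * d k * lam) (B k) \<and> card (B k) = ind (a k * d k * lam)"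
    using choice[of "\<lambda>k B. negset (a k * d k * lam) B \<and> card B = ind (a k * d k * lam)"] ind_witness(1) by blast
  then obtain B' where "negset lam B'" "card B' = (\<Sum>k=1..N. ind (a k * d k * lam))"
    using negset_combine[of lam B] by auto
  then show ?thesis using card_negset_le[of lam B'] by simp
qed

lemma ind_subadditive: "ind lam \<le> (\<Sum>k=1..N. ind (a k * d k * lam)) + (N - 1)"
proof -
  obtain L where "\<And>k. kerset (a k * d k * lam) (L k) \<and> card (L k) = ind (a k * d k * lam)"
    using choice[of "\<lambda>k L. kerset (a k * d k * lam) L \<and> card L = ind (a k * d k * lam)"] ind_witness(1) by blast
  then obtain L' where "kerset lam L'" "card L' \<le> (\<Sum>k=1..N. ind (a k * d k * lam)) + (N - 1)"
    using kerset_combine[of lam L] by auto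
  then show ?thesis using ind_le_card_kerset[of lam L'] by linarith
qed

text \<open>Cells with \<open>d k = 0\<close> contribute the index at parameter 0 and therefore drop
  out of the renewal sum.\<close>

lemma ind_0: "ind 0 = 0"
proof -
  have "kerset 0 {}" unfolding kerset_iff using quad_nonneg_small[of _ 0] by simp
  then show ?thesis using ind_le_card_kerset[of 0 "{}"] by simp
qed

text \<open>The energy is nonnegative, so a negative total comes from the weight term, which a
  factor \<open>t \<ge> 1\<close> can only lower.\<close>

lemma quad_neg_mono:
  assumes y: "y \<in> W21_0" and neg: "quad lam y < 0" and t: "t \<ge> 1"
  shows "quad (t * lam) y < 0"
proof -
  obtain g where g: "sobolev0 y g" using W21_0_sobolev0 y by blast
  have e: "0 \<le> energy g" unfolding energy_def by simp
  have "lam * weight_form p y g < 0" using neg e unfolding quad_eq[OF g] by simp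
  then have "t * (lam * weight_form p y g) \<le> 1 * (lam * weight_form p y g)"
    using t by (intro mult_right_mono_neg) auto
  then show ?thesis using neg unfolding quad_eq[OF g] by (simp add: mult.assoc)
qed

lemma ind_mono:
  assumes "t \<ge> 1"
  shows "ind lam \<le> ind (t * lam)"
proof -
  obtain B where B: "negset lam B" "card B = ind lam" using ind_witness(1) by blast
  have "negset (t * lam) B"
    using B(1) quad_neg_mono[OF _ _ assms] hermitian_form.lincomb_mem[OF form]
    unfolding negset_iff by blast
  then show ?thesis using card_negset_le[of "t * lam" B] B(2) by simp
qed

lemma ind_pos:
  assumes "y \<in> W21_0" "quad lam y < 0"
  shows "ind lam > 0"
proof -
  have "negset lam {y}"
    unfolding negset_iff
  proof (intro conjI allI impI)
    fix c :: "(real \<Rightarrow> complex) \<Rightarrow> complex" assume "\<exists>b\<in>{y}. c b \<noteq> 0"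
    moreover have "lincomb {y} c = (\<lambda>x. c y * y x)" by (simp add: fun_eq_iff lincomb_apply)
    ultimately show "quad lam (lincomb {y} c) < 0"
      using quad_scale[OF assms(1)] assms(2) by (simp add: mult_pos_neg)
  qed (use assms in auto)
  then show ?thesis using card_negset_le[of lam "{y}"] by simp
qed

end

section \<open>Growth rate of the index as the parameter tends to infinity\<close>

lemma smallo_1I: "((r :: real \<Rightarrow> real) \<longlongrightarrow> 0) F \<Longrightarrow> r \<in> o[F](\<lambda>_. 1)"
  by (rule smalloI_tendsto) auto

context self_similar_weight
begin

text \<open>The defining equation of \<open>D\<close> says that the weights
  \<open>exp (- (D / 2) * \<tau> k)\<close> have total mass 1, so the renewal exponent is
  \<open>D / 2\<close>. A negative \<open>d k\<close> couples the two signs and forces a common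
  limit.\<close>

lemma index_asymptotics:
  assumes nonarith: "non_arithmetic N a d" and D: "is_spectral_order N a d D" "D > 0"
  shows "\<exists>s :: bool \<Rightarrow> real. (\<forall>b. s b \<ge> 0 \<and>
      ((\<lambda>t. exp (- (D / 2) * t) * real (ind ((if b then 1 else -1) * exp t))) \<longlongrightarrow> s b) at_top \<and>
      ((\<exists>t. ind ((if b then 1 else -1) * exp t) > 0) \<longrightarrow> s b > 0)) \<and>
      ((\<exists>k\<in>{1..N}. d k < 0) \<longrightarrow> s True = s False)"
proof -
  define K where "K = {k \<in> {1..N}. d k \<noteq> 0}"
  define \<tau> where "\<tau> k = - ln (a k * \<bar>d k\<bar>)" for k
  define sgn where "sgn b = (if b then 1 else -1 :: real)" for b
  define F where "F b t = real (ind (sgn b * exp t))" for b t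
  have K: "k \<in> {1..N}" "a k > 0" "d k \<noteq> 0" "a k * \<bar>d k\<bar> > 0" if "k \<in> K" for k
    using that a_pos unfolding K_def by auto
  have fin: "finite K" unfolding K_def by simp
  have pos: "\<tau> k > 0" if "k \<in> K" for k
    using contraction[OF K(1)[OF that]] K(4)[OF that] unfolding \<tau>_def by simp
  have p: "(\<Sum>k\<in>K. exp (- (D / 2) * \<tau> k)) = 1"
  proof -
    have "(\<Sum>k\<in>K. exp (- (D / 2) * \<tau> k)) = (\<Sum>k\<in>K. (a k * \<bar>d k\<bar>) powr (D / 2))"
    proof (rule sum.cong[OF refl])
      fix k assume "k \<in> K"
      then show "exp (- (D / 2) * \<tau> k) = (a k * \<bar>d k\<bar>) powr (D / 2)"
        using K(2)[of k] K(3)[of k] unfolding powr_def \<tau>_def by simp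
    qed
    then show ?thesis using D(1) unfolding is_spectral_order_def K_def by simp
  qed
  \<comment> \<open>\<open>K\<close> is nonempty because an empty sum could not equal 1.\<close>
  then obtain k0 where k0: "k0 \<in> K" by fastforce
  have nonar: "\<not> (\<exists>\<nu>>0. \<forall>k\<in>K. \<exists>m::int. \<tau> k = of_int m * \<nu>)"
  proof
    assume "\<exists>\<nu>>0. \<forall>k\<in>K. \<exists>m::int. \<tau> k = of_int m * \<nu>"
    then obtain \<nu> where \<nu>: "\<nu> > 0" "\<And>k. k \<in> K \<Longrightarrow> \<exists>m::int. \<tau> k = of_int m * \<nu>" by blast
    have "\<exists>m::int. ln (a k * \<bar>d k\<bar>) = of_int m * \<nu>" if k: "k \<in> {1..N}" "d k \<noteq> 0" for k
    proof -
      obtain m :: int where "\<tau> k = of_int m * \<nu>" using \<nu>(2) k unfolding K_def by blast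
      then have "ln (a k * \<bar>d k\<bar>) = of_int (- m) * \<nu>" unfolding \<tau>_def by simp
      then show ?thesis by blast
    qed
    then show False using nonarith \<nu>(1) unfolding non_arithmetic_def by blast
  qed
  have mono: "mono (F b)" for b
  proof (rule monoI)
    fix s t :: real assume "s \<le> t"
    then have "ind (sgn b * exp s) \<le> ind (exp (t - s) * (sgn b * exp s))" by (intro ind_mono) simp
    also have "exp (t - s) * (sgn b * exp s) = sgn b * exp t" by (simp add: exp_diff)
    finally show "F b s \<le> F b t" unfolding F_def by simp
  qed
  have exp_tau: "exp (t - \<tau> k) = exp t * (a k * \<bar>d k\<bar>)" if "k \<in> K" for k t
    using K(4)[OF that] unfolding \<tau>_def by (simp add: exp_add)
  \<comment> \<open>The absolute value of \<open>d k\<close> enters the delay; its sign is moved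
    into the component.\<close>
  have shift: "ind (a k * d k * (sgn b * exp t)) = ind (sgn (b \<noteq> (d k < 0)) * exp (t - \<tau> k))" if "k \<in> K" for k b t
  proof -
    have "a k * d k * (sgn b * exp t) = sgn (b \<noteq> (d k < 0)) * exp (t - \<tau> k)"
      unfolding exp_tau[OF that] sgn_def by (cases "d k < 0"; cases b) auto
    then show ?thesis by simp
  qed
  have sum_K: "real (\<Sum>k=1..N. ind (a k * d k * (sgn b * exp t))) = (\<Sum>k\<in>K. F (b \<noteq> (d k < 0)) (t - \<tau> k))" for b t
  proof -
    have "real (\<Sum>k=1..N. ind (a k * d k * (sgn b * exp t))) = (\<Sum>k=1..N. real (ind (a k * d k * (sgn b * exp t))))"
      by simp
    also have "\<dots> = (\<Sum>k\<in>K. real (ind (a k * d k * (sgn b * exp t))))"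
      unfolding K_def by (rule sum.mono_neutral_right) (auto simp: ind_0)
    also have "\<dots> = (\<Sum>k\<in>K. F (b \<noteq> (d k < 0)) (t - \<tau> k))"
      unfolding F_def by (rule sum.cong[OF refl]) (simp only: shift)
    finally show ?thesis .
  qed
  have super: "(\<Sum>k\<in>K. F (b \<noteq> (d k < 0)) (t - \<tau> k)) \<le> F b t" for b t
    unfolding sum_K[symmetric] unfolding F_def of_nat_le_iff by (rule ind_superadditive)
  have sub: "F b t \<le> (\<Sum>k\<in>K. F (b \<noteq> (d k < 0)) (t - \<tau> k)) + real (N - 1)" for b t
    unfolding sum_K[symmetric] unfolding F_def of_nat_add[symmetric] of_nat_le_iff by (rule ind_subadditive)
  have "\<exists>s. (\<forall>b. s b \<ge> 0 \<and> ((\<lambda>t. exp (- (D / 2) * t) * F b t) \<longlongrightarrow> s b) at_top \<and> ((\<exists>t. F b t > 0) \<longrightarrow> s b > 0)) \<and>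
      ((\<exists>k\<in>{1..N}. d k < 0) \<longrightarrow> s True = s False)"
  proof (cases "\<exists>k\<in>{1..N}. d k < 0")
    case True
    then obtain k where k: "k \<in> K" "d k < 0" unfolding K_def by auto
    have "\<exists>s\<ge>0. (\<forall>b. ((\<lambda>t. exp (- (D / 2) * t) * F b t) \<longlongrightarrow> s) at_top) \<and> ((\<exists>b t. F b t > 0) \<longrightarrow> s > 0)"
      by (rule renewal_limit[where flip = "\<lambda>k. d k < 0", OF nonar fin pos _ p k mono _ super sub])
        (use D in \<open>auto simp: F_def\<close>)
    then obtain s where "s \<ge> 0" "\<And>b. ((\<lambda>t. exp (- (D / 2) * t) * F b t) \<longlongrightarrow> s) at_top" "(\<exists>b t. F b t > 0) \<longrightarrow> s > 0"
      by blast
    then show ?thesis by (intro exI[of _ "\<lambda>_. s"]) auto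
  next
    case False
    \<comment> \<open>Without sign changes the two half-lines decouple; feeding the same function into both
      components makes any choice of flips admissible.\<close>
    have "\<exists>s\<ge>0. (\<forall>_::bool. ((\<lambda>t. exp (- (D / 2) * t) * F b t) \<longlongrightarrow> s) at_top) \<and> ((\<exists>(_::bool) t. F b t > 0) \<longrightarrow> s > 0)" for b
    proof (rule renewal_limit[where flip = "\<lambda>_. True" and F = "\<lambda>_. F b", OF nonar fin pos _ p k0 TrueI mono])
      have eq: "(\<Sum>k\<in>K. F (b \<noteq> (d k < 0)) (t - \<tau> k)) = (\<Sum>k\<in>K. F b (t - \<tau> k))" for t
        by (rule sum.cong[OF refl]) (use False K(1) in auto)
      show "(\<Sum>k\<in>K. F b (t - \<tau> k)) \<le> F b t" for t using super[of b t] unfolding eq .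
      show "F b t \<le> (\<Sum>k\<in>K. F b (t - \<tau> k)) + real (N - 1)" for t using sub[of b t] unfolding eq .
    qed (use D in \<open>auto simp: F_def\<close>)
    then have "\<forall>b. \<exists>s. s \<ge> 0 \<and> ((\<lambda>t. exp (- (D / 2) * t) * F b t) \<longlongrightarrow> s) at_top \<and> ((\<exists>t. F b t > 0) \<longrightarrow> s > 0)"
      by blast
    from choice[OF this] show ?thesis using False by blast
  qed
  then show ?thesis unfolding F_def sgn_def by simp
qed

lemma weight_form_of_generalized_deriv:
  assumes "y \<in> W21_0"
  obtains g where "sobolev0 y g" "generalized_deriv P (\<lambda>x. of_real ((cmod (y x))\<^sup>2)) = of_real (- weight_form p y g)"
  using W21_0_sobolev0[OF assms] generalized_deriv_square[OF rep] by blast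

lemma ind_pos_eventually:
  assumes g: "sobolev0 y g" and neg: "c * weight_form p y g < 0"
  shows "\<exists>t. ind (c * exp t) > 0"
proof -
  define w where "w = - (c * weight_form p y g)"
  have "w > 0" using neg unfolding w_def by simp
  have e: "0 \<le> energy g" unfolding energy_def by simp
  \<comment> \<open>Chosen so that the form takes the value \<open>- w\<close> at
    \<open>y\<close>.\<close>
  define T where "T = energy g / w + 1"
  have "T > 0" unfolding T_def using e \<open>w > 0\<close> by (simp add: add_nonneg_pos)
  have "quad (c * exp (ln T)) y = energy g - T * w"
    unfolding quad_eq[OF g] w_def using \<open>T > 0\<close> by simp
  also have "\<dots> < 0" unfolding T_def using \<open>w > 0\<close> by (simp add: field_simps)
  finally have "quad (c * exp (ln T)) y < 0" .
  then show ?thesis using ind_pos[OF sobolev0_W21_0[OF g]] by blast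
qed

end

theorem mainTheorem2:
  fixes N :: nat and a d \<beta> :: "nat \<Rightarrow> real" and P :: "real \<Rightarrow> real" and D :: real
    and \<rho> :: "(real \<Rightarrow> complex) \<Rightarrow> complex"
  assumes params: "selfsim_params N a d"
    and P_L2: "L2_01 P"
    and P_selfsim: "self_similar N a d \<beta> P"
    and nonarith: "non_arithmetic N a d"
    and D_order: "is_spectral_order N a d D"
    and D_pos: "D > 0"
    and rho: "\<rho> = generalized_deriv P"
  shows "\<exists>s_plus s_minus :: real. s_plus \<ge> 0 \<and> s_minus \<ge> 0 \<and>
    (\<exists>r. r \<in> o[at_top](\<lambda>_. 1) \<and>
       (\<forall>\<^sub>F lam in at_top. ereal_of_enat (negative_index (pencil P lam))
          = ereal (\<bar>lam\<bar> powr (D / 2) * (s_plus + r lam)))) \<and>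
    (\<exists>r. r \<in> o[at_bot](\<lambda>_. 1) \<and>
       (\<forall>\<^sub>F lam in at_bot. ereal_of_enat (negative_index (pencil P lam))
          = ereal (\<bar>lam\<bar> powr (D / 2) * (s_minus + r lam)))) \<and>
    ((\<exists>k\<in>{1..N}. d k < 0) \<longrightarrow> s_plus = s_minus) \<and>
    ((\<exists>y\<in>W21_0. \<rho> (\<lambda>x. of_real ((cmod (y x))\<^sup>2)) > 0) \<longrightarrow> s_plus > 0) \<and>
    ((\<exists>y\<in>W21_0. \<rho> (\<lambda>x. of_real ((cmod (y x))\<^sup>2)) < 0) \<longrightarrow> s_minus > 0)"
proof -
  obtain p where p: "L2_rep P p" using L2_rep_real_exists[OF P_L2] by blast
  interpret self_similar_weight N a d \<beta> P p
    using params P_selfsim p by unfold_locales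
  obtain s :: "bool \<Rightarrow> real" where s: "\<And>b. s b \<ge> 0"
    "\<And>b. ((\<lambda>t. exp (- (D / 2) * t) * real (ind ((if b then 1 else -1) * exp t))) \<longlongrightarrow> s b) at_top"
    "\<And>b t. ind ((if b then 1 else -1) * exp t) > 0 \<Longrightarrow> s b > 0"
    "(\<exists>k\<in>{1..N}. d k < 0) \<longrightarrow> s True = s False"
    using index_asymptotics[OF nonarith D_order D_pos] by blast
  \<comment> \<open>The exact error, so the formula holds for every nonzero \<open>lam\<close> and
    only convergence remains.\<close>
  define r where "r b lam = real (ind lam) / \<bar>lam\<bar> powr (D / 2) - s b" for b lam
  have index: "ereal_of_enat (negative_index (pencil P lam)) = ereal (\<bar>lam\<bar> powr (D / 2) * (s b + r b lam))"
    if "lam \<noteq> 0" for b lam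
    using that unfolding ind_witness(2) r_def by simp
  \<comment> \<open>Treats both ends at once: \<open>G\<close> stands for \<open>at_top\<close> or
    \<open>at_bot\<close>, and the sign of \<open>lam\<close> is eventually fixed.\<close>
  have lim: "(r b \<longlongrightarrow> 0) G"
    if G: "filterlim (\<lambda>lam. ln \<bar>lam\<bar>) at_top G" "\<forall>\<^sub>F lam in G. lam = (if b then 1 else -1) * \<bar>lam\<bar> \<and> lam \<noteq> 0" for b G
  proof -
    have "((\<lambda>lam. exp (- (D / 2) * ln \<bar>lam\<bar>) * real (ind ((if b then 1 else -1) * exp (ln \<bar>lam\<bar>)))) \<longlongrightarrow> s b) G"
      by (rule filterlim_compose[OF s(2) G(1)])
    moreover have "\<forall>\<^sub>F lam in G. exp (- (D / 2) * ln \<bar>lam\<bar>) * real (ind ((if b then 1 else -1) * exp (ln \<bar>lam\<bar>))) =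
        real (ind lam) / \<bar>lam\<bar> powr (D / 2)"
      using G(2)
    proof eventually_elim
      case (elim lam)
      have e1: "exp (ln \<bar>lam\<bar>) = \<bar>lam\<bar>" using conjunct2[OF elim] by simp
      have e2: "(if b then 1 else -1) * \<bar>lam\<bar> = lam" by (rule conjunct1[OF elim, symmetric])
      have e3: "exp (- (D / 2) * ln \<bar>lam\<bar>) = inverse (\<bar>lam\<bar> powr (D / 2))"
        using conjunct2[OF elim] by (subst powr_def) (simp flip: exp_minus)
      show ?case unfolding e3 e1 e2 by (rule trans[OF mult.commute divide_inverse[symmetric]])
    qed
    ultimately have "((\<lambda>lam. real (ind lam) / \<bar>lam\<bar> powr (D / 2)) \<longlongrightarrow> s b) G"
      by (rule Lim_transform_eventually)
    then have "((\<lambda>lam. real (ind lam) / \<bar>lam\<bar> powr (D / 2) - s b) \<longlongrightarrow> s b - s b) G"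
      by (intro tendsto_diff tendsto_const)
    then show ?thesis unfolding r_def by simp
  qed
  have abs_lim: "filterlim (\<lambda>lam. ln \<bar>lam\<bar>) at_top G" if "filterlim (\<lambda>lam::real. \<bar>lam\<bar>) at_top G" for G
    by (rule filterlim_compose[OF ln_at_top that])
  have top: "(r True \<longlongrightarrow> 0) at_top"
  proof (rule lim)
    show "filterlim (\<lambda>lam. ln \<bar>lam\<bar>) at_top (at_top :: real filter)"
      by (rule abs_lim, rule filterlim_at_top_mono[OF filterlim_ident], rule always_eventually) (simp add: abs_ge_self abs_ge_minus_self)
    show "\<forall>\<^sub>F lam in at_top. lam = (if True then 1 else -1) * \<bar>lam\<bar> \<and> lam \<noteq> (0::real)"
      using eventually_gt_at_top[of 0] by eventually_elim simp
  qed
  have bot: "(r False \<longlongrightarrow> 0) at_bot"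
  proof (rule lim)
    show "filterlim (\<lambda>lam. ln \<bar>lam\<bar>) at_top (at_bot :: real filter)"
      by (rule abs_lim, rule filterlim_at_top_mono[OF filterlim_uminus_at_top_at_bot], rule always_eventually) (simp add: abs_ge_self abs_ge_minus_self)
    show "\<forall>\<^sub>F lam in at_bot. lam = (if False then 1 else -1) * \<bar>lam\<bar> \<and> lam \<noteq> (0::real)"
      using eventually_gt_at_bot[of 0] by eventually_elim simp
  qed
  have pos: "s b > 0"
    if y: "y \<in> W21_0" "(if b then 1 else -1) * Re (\<rho> (\<lambda>x. of_real ((cmod (y x))\<^sup>2))) > 0" for b y
  proof -
    obtain g where g: "sobolev0 y g" "\<rho> (\<lambda>x. of_real ((cmod (y x))\<^sup>2)) = of_real (- weight_form p y g)"
      unfolding rho using weight_form_of_generalized_deriv[OF y(1)] by blast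
    \<comment> \<open>A positive pairing with \<rho> means a negative weight form, hence a negative
      pencil for large positive \<open>lam\<close>; for a negative pairing both signs
      reverse.\<close>
    have "(if b then 1 else -1) * weight_form p y g < 0" using y(2) unfolding g(2) by (cases b) auto
    then show ?thesis using ind_pos_eventually[OF g(1)] s(3) by blast
  qed
  show ?thesis
  proof (rule exI[of _ "s True"], rule exI[of _ "s False"], intro conjI impI)
    show "\<exists>f. f \<in> o[at_top](\<lambda>_. 1) \<and> (\<forall>\<^sub>F lam in at_top. ereal_of_enat (negative_index (pencil P lam))
        = ereal (\<bar>lam\<bar> powr (D / 2) * (s True + f lam)))"
    proof (intro exI[of _ "r True"] conjI smallo_1I top)
      show "\<forall>\<^sub>F lam in at_top. ereal_of_enat (negative_index (pencil P lam))
          = ereal (\<bar>lam\<bar> powr (D / 2) * (s True + r True lam))"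
        using eventually_gt_at_top[of 0] by eventually_elim (rule index, simp)
    qed
    show "\<exists>f. f \<in> o[at_bot](\<lambda>_. 1) \<and> (\<forall>\<^sub>F lam in at_bot. ereal_of_enat (negative_index (pencil P lam))
        = ereal (\<bar>lam\<bar> powr (D / 2) * (s False + f lam)))"
    proof (intro exI[of _ "r False"] conjI smallo_1I bot)
      show "\<forall>\<^sub>F lam in at_bot. ereal_of_enat (negative_index (pencil P lam))
          = ereal (\<bar>lam\<bar> powr (D / 2) * (s False + r False lam))"
        using eventually_gt_at_bot[of 0] by eventually_elim (rule index, simp)
    qed
    show "s True = s False" if "\<exists>k\<in>{1..N}. d k < 0" using s(4) that by blast
    show "s True > 0" if "\<exists>y\<in>W21_0. \<rho> (\<lambda>x. of_real ((cmod (y x))\<^sup>2)) > 0"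
      using that pos[of _ True] by (auto simp: less_complex_def)
    show "s False > 0" if "\<exists>y\<in>W21_0. \<rho> (\<lambda>x. of_real ((cmod (y x))\<^sup>2)) < 0"
      using that pos[of _ False] by (auto simp: less_complex_def)
  qed (rule s(1))+
qed

end
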